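(* Consider the system $$\frac{\partial y^i}{\partial t}=\sum_{j=1}^n A^i_j\left(\frac{\partial^2 y^j}{\partial x^2}+\sum_{r=1}^n\sum_{s=1}^n\Gamma^j_{rs}\,\frac{\partial y^r}{\partial x}\,\frac{\partial y^s}{\partial x}\right),\qquad i=1,\dots,n,$$ where $A^i_j$ and $\Gamma^j_{rs}=\Gamma^j_{sr}$ are functions of $y^1,\dots,y^n$ with $\det A\neq0$, in the non-degenerate case $\det\Lambda_{\mathrm{sym}}\neq0$. This system can be brought to the diffusion form $$\frac{\partial\tilde y^i}{\partial t}=\sum_{j=1}^n\frac{\partial}{\partial x}\left(\tilde A^i_j\,\frac{\partial\tilde y^j}{\partial x}\right),\qquad i=1,\dots,n,$$ by means of some point transformation $\tilde y^i=\tilde y^i(y^1,\dots,y^n)$ (in some neighborhood of a given point) if and only if the quantities $$\theta^r_{pq}=\sum_{i=1}^n\sum_{j=1}^n D^{ij}_{pq}\left(\sum_{k=1}^n A^r_k\,\Gamma^k_{ij}-\frac12\left(\frac{\partial A^r_i}{\partial y^j}+\frac{\partial A^r_j}{\partial y^i}\right)\right)$$ satisfy (in a neighborhood of that point) the "zero curvature" condition $$\frac{\partial\theta^m_{kp}}{\partial y^q}-\frac{\partial\theta^m_{qp}}{\partial y^k}+\sum_{r=1}^n\theta^m_{qr}\,\theta^r_{kp}-\sum_{r=1}^n\theta^m_{kr}\,\theta^r_{qp}=0,\qquad m,k,p,q=1,\dots,n.$$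
   Context: All functions are assumed smooth. Put $$\Lambda^{pq}_{ij}=\frac{A^p_i\,\delta^q_j+A^p_j\,\delta^q_i+A^q_i\,\delta^p_j+A^q_j\,\delta^p_i}{4},$$ acting on bilinear forms by $(\Lambda w)_{ij}=\sum_{p,q}\Lambda^{pq}_{ij}w_{pq}$; it preserves the space $W_{\mathrm{sym}}$ of symmetric bilinear forms, and $\Lambda_{\mathrm{sym}}$ is its restriction to $W_{\mathrm{sym}}$. The non-degenerate case is $\det\Lambda_{\mathrm{sym}}\ne0$ (at all points considered). Then $D=\Lambda_{\mathrm{sym}}^{-1}$, extended by zero to skew-symmetric forms; its components $D^{ij}_{pq}$ (acting by $(Dw)_{pq}=\sum_{i,j}D^{ij}_{pq}w_{ij}$) are symmetric in the upper and in the lower indices and are uniquely determined by $$\sum_{i=1}^n\sum_{j=1}^n D^{ij}_{rs}\,\Lambda^{pq}_{ij}=\frac{\delta^p_r\,\delta^q_s+\delta^p_s\,\delta^q_r}{2}.$$ A point transformation is a local diffeomorphism $y\mapsto\tilde y$ of open subsets of $\mathbb{R}^n$. "Can be brought to the diffusion form" means that for some point transformation and some matrix $\tilde A=\tilde A(\tilde y^1,\dots,\tilde y^n)$ with $\det\tilde A\neq0$, the given system rewritten in the variables $\tilde y$ is identically the displayed diffusion-form system, i.e. after solving for $\partial\tilde y^i/\partial t$ the coefficients of $\partial^2\tilde y^j/\partial x^2$ and the (symmetrized) coefficients of the products $\frac{\partial\tilde y^r}{\partial x}\frac{\partial\tilde y^s}{\partial x}$ coincide. *)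

theory Defs
  imports "HOL-Analysis.Analysis" "HOL-Library.Uprod"
begin

section \<open>Smooth functions on open subsets of the coordinate space\<close>

definition partial_deriv :: "'n::finite \<Rightarrow> (real^'n \<Rightarrow> real) \<Rightarrow> real^'n \<Rightarrow> real" where
  "partial_deriv k f y = frechet_derivative f (at y) (axis k 1)"

text \<open>Only used for open \<open>S\<close>, where it is the usual class of \<open>k\<close> times continuously
  differentiable functions.\<close>

primrec Ck_on :: "nat \<Rightarrow> (real^'n::finite) set \<Rightarrow> (real^'n \<Rightarrow> real) \<Rightarrow> bool" where
  "Ck_on 0 S f \<longleftrightarrow> continuous_on S f"
| "Ck_on (Suc k) S f \<longleftrightarrow> f differentiable_on S \<and> (\<forall>i. Ck_on k S (partial_deriv i f))"

definition smooth_on :: "(real^'n::finite) set \<Rightarrow> (real^'n \<Rightarrow> real) \<Rightarrow> bool" where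
  "smooth_on S f \<longleftrightarrow> (\<forall>k. Ck_on k S f)"

text \<open>A point transformation \<open>\<phi>\<close> from \<open>V\<close> onto \<open>W\<close> together with its inverse \<open>\<psi>\<close>.\<close>

definition point_transformation ::
  "(real^'n::finite) set \<Rightarrow> (real^'n) set \<Rightarrow> (real^'n \<Rightarrow> real^'n) \<Rightarrow> (real^'n \<Rightarrow> real^'n) \<Rightarrow> bool"
where
  "point_transformation V W \<phi> \<psi> \<longleftrightarrow>
     open V \<and> open W \<and> homeomorphism V W \<phi> \<psi> \<and>
     (\<forall>i. smooth_on V (\<lambda>y. \<phi> y $ i)) \<and> (\<forall>i. smooth_on W (\<lambda>z. \<psi> z $ i))"


section \<open>The operator \<open>\<Lambda>\<close> and the inverse of its symmetric part\<close>

text \<open>Upper indices label rows: \<open>A $ i $ j\<close> is \<open>A\<^sup>i\<^sub>j\<close>. Bilinear forms are also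
  stored as matrices, \<open>w $ p $ q\<close> being \<open>w\<^sub>p\<^sub>q\<close>.\<close>

definition kron :: "'n \<Rightarrow> 'n \<Rightarrow> real" where
  "kron i j = (if i = j then 1 else 0)"

text \<open>\<open>Lambda_coeff A p q i j\<close> has upper indices \<open>p, q\<close> and lower indices \<open>i, j\<close>.\<close>

definition Lambda_coeff :: "real^'n^'n::finite \<Rightarrow> 'n \<Rightarrow> 'n \<Rightarrow> 'n \<Rightarrow> 'n \<Rightarrow> real" where
  "Lambda_coeff A p q i j =
     (A $ p $ i * kron q j + A $ p $ j * kron q i + A $ q $ i * kron p j + A $ q $ j * kron p i) / 4"

definition Lambda :: "real^'n^'n::finite \<Rightarrow> real^'n^'n \<Rightarrow> real^'n^'n" where
  "Lambda A w = (\<chi> i j. \<Sum>p\<in>UNIV. \<Sum>q\<in>UNIV. Lambda_coeff A p q i j * w $ p $ q)"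

definition sym_forms :: "(real^'n^'n::finite) set" where
  "sym_forms = {w. transpose w = w}"

lemma finite_UNIV_uprod: "finite (UNIV :: 'a::finite uprod set)"
proof (rule finite_subset)
  show "(UNIV :: 'a uprod set) \<subseteq> (\<lambda>(a, b). Upair a b) ` UNIV"
  proof
    fix u :: "'a uprod"
    show "u \<in> (\<lambda>(a, b). Upair a b) ` UNIV"
      by (cases u) auto
  qed
qed simp

instance uprod :: (finite) finite
  by standard (rule finite_UNIV_uprod)

text \<open>A symmetric form is given by its components, indexed by unordered pairs; \<open>sym_form\<close> is the
  resulting linear isomorphism onto \<open>sym_forms\<close>. The determinant of \<open>\<Lambda>\<^sub>s\<^sub>y\<^sub>m\<close> is that of its
  matrix in these coordinates.\<close>

definition sym_form :: "real^('n uprod) \<Rightarrow> real^'n^'n::finite" where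
  "sym_form c = (\<chi> i j. c $ Upair i j)"

definition det_Lambda_sym :: "real^'n^'n::finite \<Rightarrow> real" where
  "det_Lambda_sym A = det (matrix (inv sym_form \<circ> Lambda A \<circ> sym_form))"

definition sym_part :: "real^'n^'n::finite \<Rightarrow> real^'n^'n" where
  "sym_part w = (1/2) *\<^sub>R (w + transpose w)"

definition D_op :: "real^'n^'n::finite \<Rightarrow> real^'n^'n \<Rightarrow> real^'n^'n" where
  "D_op A w = the_inv_into sym_forms (Lambda A) (sym_part w)"

text \<open>\<open>D_coeff A i j p q\<close> has upper indices \<open>i, j\<close> and lower indices \<open>p, q\<close>.\<close>

definition D_coeff :: "real^'n^'n::finite \<Rightarrow> 'n \<Rightarrow> 'n \<Rightarrow> 'n \<Rightarrow> 'n \<Rightarrow> real" where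
  "D_coeff A i j p q = D_op A (axis i (axis j 1)) $ p $ q"


section \<open>The quantities \<open>\<theta>\<close> and the zero curvature condition\<close>

text \<open>\<open>\<Gamma> y j r s\<close> has upper index \<open>j\<close> and lower indices \<open>r, s\<close>; similarly \<open>theta A \<Gamma> y r p q\<close>
  has upper index \<open>r\<close>.\<close>

definition theta ::
  "(real^'n \<Rightarrow> real^'n^'n::finite) \<Rightarrow> (real^'n \<Rightarrow> 'n \<Rightarrow> 'n \<Rightarrow> 'n \<Rightarrow> real) \<Rightarrow>
   real^'n \<Rightarrow> 'n \<Rightarrow> 'n \<Rightarrow> 'n \<Rightarrow> real"
where
  "theta A \<Gamma> y r p q =
     (\<Sum>i\<in>UNIV. \<Sum>j\<in>UNIV. D_coeff (A y) i j p q *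
        ((\<Sum>k\<in>UNIV. A y $ r $ k * \<Gamma> y k i j)
         - 1/2 * (partial_deriv j (\<lambda>y. A y $ r $ i) y + partial_deriv i (\<lambda>y. A y $ r $ j) y)))"

definition zero_curvature_at ::
  "(real^'n \<Rightarrow> 'n \<Rightarrow> 'n \<Rightarrow> 'n::finite \<Rightarrow> real) \<Rightarrow> real^'n \<Rightarrow> bool"
where
  "zero_curvature_at \<theta> y \<longleftrightarrow>
     (\<forall>m k p q.
        partial_deriv q (\<lambda>y. \<theta> y m k p) y - partial_deriv k (\<lambda>y. \<theta> y m q p) y
        + (\<Sum>r\<in>UNIV. \<theta> y m q r * \<theta> y r k p) - (\<Sum>r\<in>UNIV. \<theta> y m k r * \<theta> y r q p) = 0)"


section \<open>Evolution systems and point transformations\<close>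

text \<open>A pair \<open>B, C\<close> stands for the system
  \<open>u\<^sub>t\<^sup>i = \<Sum>\<^sub>j B\<^sup>i\<^sub>j(u) u\<^sub>x\<^sub>x\<^sup>j + \<Sum>\<^sub>r \<Sum>\<^sub>s C\<^sup>i\<^sub>r\<^sub>s(u) u\<^sub>x\<^sup>r u\<^sub>x\<^sup>s\<close>,
  with \<open>C u i r s\<close> for \<open>C\<^sup>i\<^sub>r\<^sub>s(u)\<close>. Only the part of \<open>C\<close> symmetric in \<open>r, s\<close> matters.\<close>

definition same_system_on ::
  "(real^'n::finite) set \<Rightarrow>
   (real^'n \<Rightarrow> real^'n^'n) \<Rightarrow> (real^'n \<Rightarrow> 'n \<Rightarrow> 'n \<Rightarrow> 'n \<Rightarrow> real) \<Rightarrow>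
   (real^'n \<Rightarrow> real^'n^'n) \<Rightarrow> (real^'n \<Rightarrow> 'n \<Rightarrow> 'n \<Rightarrow> 'n \<Rightarrow> real) \<Rightarrow> bool"
where
  "same_system_on W B C B' C' \<longleftrightarrow>
     (\<forall>z\<in>W. B z = B' z \<and>
        (\<forall>i r s. (C z i r s + C z i s r) / 2 = (C' z i r s + C' z i s r) / 2))"

definition source_quad ::
  "(real^'n \<Rightarrow> real^'n^'n::finite) \<Rightarrow> (real^'n \<Rightarrow> 'n \<Rightarrow> 'n \<Rightarrow> 'n \<Rightarrow> real) \<Rightarrow>
   real^'n \<Rightarrow> 'n \<Rightarrow> 'n \<Rightarrow> 'n \<Rightarrow> real"
where
  "source_quad A \<Gamma> y i r s = (\<Sum>j\<in>UNIV. A y $ i $ j * \<Gamma> y j r s)"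

text \<open>From \<open>\<partial>\<^sub>x(B\<^sup>i\<^sub>r(z) z\<^sub>x\<^sup>r) = B\<^sup>i\<^sub>r(z) z\<^sub>x\<^sub>x\<^sup>r + \<partial>\<^sub>s B\<^sup>i\<^sub>r(z) z\<^sub>x\<^sup>r z\<^sub>x\<^sup>s\<close>;
  see \<open>diffusion_expansion\<close> below.\<close>

definition diffusion_quad ::
  "(real^'n \<Rightarrow> real^'n^'n::finite) \<Rightarrow> real^'n \<Rightarrow> 'n \<Rightarrow> 'n \<Rightarrow> 'n \<Rightarrow> real"
where
  "diffusion_quad B z i r s = partial_deriv s (\<lambda>z. B z $ i $ r) z"

text \<open>The system \<open>B, C\<close> in the new variables \<open>z = \<phi>(y)\<close>, \<open>y = \<psi>(z)\<close>: substitute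
  \<open>y\<^sub>x\<^sup>j = \<partial>\<^sub>r\<psi>\<^sup>j z\<^sub>x\<^sup>r\<close> and
  \<open>y\<^sub>x\<^sub>x\<^sup>j = \<partial>\<^sub>r\<psi>\<^sup>j z\<^sub>x\<^sub>x\<^sup>r + \<partial>\<^sub>r\<partial>\<^sub>s\<psi>\<^sup>j z\<^sub>x\<^sup>r z\<^sub>x\<^sup>s\<close>
  into \<open>z\<^sub>t\<^sup>i = \<partial>\<^sub>k\<phi>\<^sup>i y\<^sub>t\<^sup>k\<close>; see \<open>solves_transformed_iff\<close> below.\<close>

definition transformed_lead ::
  "(real^'n \<Rightarrow> real^'n) \<Rightarrow> (real^'n \<Rightarrow> real^'n) \<Rightarrow> (real^'n \<Rightarrow> real^'n^'n::finite) \<Rightarrow>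
   real^'n \<Rightarrow> real^'n^'n"
where
  "transformed_lead \<phi> \<psi> B z =
     (\<chi> i r. \<Sum>k\<in>UNIV. \<Sum>j\<in>UNIV.
        partial_deriv k (\<lambda>y. \<phi> y $ i) (\<psi> z) * B (\<psi> z) $ k $ j * partial_deriv r (\<lambda>z. \<psi> z $ j) z)"

definition transformed_quad ::
  "(real^'n \<Rightarrow> real^'n) \<Rightarrow> (real^'n \<Rightarrow> real^'n) \<Rightarrow> (real^'n \<Rightarrow> real^'n^'n::finite) \<Rightarrow>
   (real^'n \<Rightarrow> 'n \<Rightarrow> 'n \<Rightarrow> 'n \<Rightarrow> real) \<Rightarrow> real^'n \<Rightarrow> 'n \<Rightarrow> 'n \<Rightarrow> 'n \<Rightarrow> real"
where
  "transformed_quad \<phi> \<psi> B C z i r s =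
     (\<Sum>k\<in>UNIV. partial_deriv k (\<lambda>y. \<phi> y $ i) (\<psi> z) *
        ((\<Sum>j\<in>UNIV. B (\<psi> z) $ k $ j * partial_deriv s (partial_deriv r (\<lambda>z. \<psi> z $ j)) z)
         + (\<Sum>a\<in>UNIV. \<Sum>b\<in>UNIV. C (\<psi> z) k a b *
              partial_deriv r (\<lambda>z. \<psi> z $ a) z * partial_deriv s (\<lambda>z. \<psi> z $ b) z)))"

definition diffusion_form_near ::
  "(real^'n::finite) set \<Rightarrow> (real^'n \<Rightarrow> real^'n^'n) \<Rightarrow>
   (real^'n \<Rightarrow> 'n \<Rightarrow> 'n \<Rightarrow> 'n \<Rightarrow> real) \<Rightarrow> real^'n \<Rightarrow> bool"
where
  "diffusion_form_near U A \<Gamma> y0 \<longleftrightarrow>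
     (\<exists>V W \<phi> \<psi> A'. y0 \<in> V \<and> V \<subseteq> U \<and> point_transformation V W \<phi> \<psi> \<and>
        (\<forall>i j. smooth_on W (\<lambda>z. A' z $ i $ j)) \<and> (\<forall>z\<in>W. det (A' z) \<noteq> 0) \<and>
        same_system_on W
          (transformed_lead \<phi> \<psi> A) (transformed_quad \<phi> \<psi> A (source_quad A \<Gamma>))
          A' (diffusion_quad A'))"


section \<open>Consistency of the definitions\<close>

subsection \<open>\<open>D\<close> and its components\<close>

lemma sym_form_linear: "linear (sym_form :: real^('n::finite uprod) \<Rightarrow> real^'n^'n)"
  by (rule linearI) (simp_all add: sym_form_def vec_eq_iff)

lemma sym_form_inj: "inj (sym_form :: real^('n::finite uprod) \<Rightarrow> real^'n^'n)"
proof (rule injI)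
  fix c d :: "real^('n uprod)"
  assume eq: "sym_form c = sym_form d"
  have "c $ u = d $ u" for u
  proof (cases u)
    case (Upair i j)
    with eq show ?thesis by (metis (no_types) sym_form_def vec_lambda_beta)
  qed
  then show "c = d" by (simp add: vec_eq_iff)
qed

lemma sym_formsD: "w \<in> sym_forms \<Longrightarrow> w $ i $ j = w $ j $ i"
  unfolding sym_forms_def by (metis (mono_tags) mem_Collect_eq transpose_def vec_lambda_beta)

lemma sym_formsI: "(\<And>i j. w $ i $ j = w $ j $ i) \<Longrightarrow> w \<in> sym_forms"
  unfolding sym_forms_def by (simp add: transpose_def vec_eq_iff)

lemma range_sym_form: "range sym_form = sym_forms"
proof
  show "range sym_form \<subseteq> sym_forms"
    by (auto intro!: sym_formsI simp: sym_form_def) (metis Upair_inject)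
next
  show "sym_forms \<subseteq> range sym_form"
  proof
    fix w :: "real^'n^'n" assume w: "w \<in> sym_forms"
    define c where "c = (\<chi> u. THE x. \<exists>i j. u = Upair i j \<and> x = w $ i $ j)"
    have "c $ Upair i j = w $ i $ j" for i j
      unfolding c_def using sym_formsD[OF w] by (auto intro!: the_equality)
    then have "w = sym_form c" by (simp add: sym_form_def vec_eq_iff)
    then show "w \<in> range sym_form" by blast
  qed
qed

lemma Lambda_linear: "linear (Lambda A)"
  by (rule linearI)
     (simp_all add: Lambda_def vec_eq_iff sum.distrib distrib_left sum_distrib_left mult.left_commute)

lemma Lambda_mem: "Lambda A w \<in> sym_forms"
  by (rule sym_formsI) (simp add: Lambda_def Lambda_coeff_def algebra_simps)

lemma Lambda_sym_part: "Lambda A (sym_part w) = Lambda A w"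
proof -
  have "Lambda A (transpose w) = Lambda A w"
    unfolding Lambda_def vec_eq_iff transpose_def
    by (simp, intro allI, subst sum.swap) (simp add: Lambda_coeff_def algebra_simps)
  then show ?thesis
    by (simp add: sym_part_def linear_add[OF Lambda_linear] linear_cmul[OF Lambda_linear] scaleR_2[symmetric])
qed

lemma sym_part_mem: "sym_part w \<in> sym_forms"
  by (rule sym_formsI) (simp add: sym_part_def transpose_def)

lemma Lambda_bij:
  fixes A :: "real^'n^'n::finite"
  assumes "det_Lambda_sym A \<noteq> 0"
  shows "bij_betw (Lambda A) sym_forms sym_forms"
proof -
  let ?L = "inv sym_form \<circ> Lambda A \<circ> sym_form"
  have inv: "sym_form (inv sym_form w) = w" if "w \<in> sym_forms" for w :: "real^'n^'n"
    using that by (simp add: f_inv_into_f range_sym_form)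
  have inv': "inv sym_form (sym_form c) = c" for c :: "real^'n uprod"
    by (simp add: sym_form_inj)
  have closed: "v + w \<in> sym_forms" "r *\<^sub>R v \<in> sym_forms"
    if "v \<in> sym_forms" "w \<in> sym_forms" for v w :: "real^'n^'n" and r
    using that by (auto intro!: sym_formsI simp: sym_formsD)
  have "linear ?L"
  proof (rule linearI)
    fix b c and r :: real
    show "?L (b + c) = ?L b + ?L c"
      by (rule injD[OF sym_form_inj])
         (simp add: inv closed Lambda_mem linear_add[OF sym_form_linear] linear_add[OF Lambda_linear])
    show "?L (r *\<^sub>R b) = r *\<^sub>R ?L b"
      by (rule injD[OF sym_form_inj])
         (simp add: inv closed[OF Lambda_mem Lambda_mem] Lambda_mem linear_cmul[OF sym_form_linear] linear_cmul[OF Lambda_linear])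
  qed
  then have L: "?L c = matrix ?L *v c" for c
    by (simp add: matrix_works)
  have "invertible (matrix ?L)"
    using assms by (simp add: det_Lambda_sym_def invertible_det_nz)
  then have "bij ?L"
    using \<open>linear ?L\<close> by (metis L ext invertible_eq_bij)
  have eq: "Lambda A w = sym_form (?L (inv sym_form w))" if "w \<in> sym_forms" for w
    using that by (simp add: inv Lambda_mem)
  show ?thesis
  proof (rule bij_betw_imageI)
    show "inj_on (Lambda A) sym_forms"
    proof (rule inj_onI)
      fix v w :: "real^'n^'n"
      assume v: "v \<in> sym_forms" and w: "w \<in> sym_forms" and "Lambda A v = Lambda A w"
      then have "?L (inv sym_form v) = ?L (inv sym_form w)"
        by (simp add: inv)
      then have "inv sym_form v = inv sym_form w"
        using \<open>bij ?L\<close> by (rule injD[OF bij_is_inj, rotated])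
      then have "sym_form (inv sym_form v) = sym_form (inv sym_form w)" by (rule arg_cong)
      then show "v = w" by (simp only: inv[OF v] inv[OF w])
    qed
    show "Lambda A ` sym_forms = sym_forms"
    proof
      show "sym_forms \<subseteq> Lambda A ` sym_forms"
      proof
        fix w :: "real^'n^'n" assume w: "w \<in> sym_forms"
        obtain c where "?L c = inv sym_form w"
          using \<open>bij ?L\<close> by (metis bij_pointE)
        then have "sym_form (?L c) = sym_form (inv sym_form w)" by (rule arg_cong)
        then have "Lambda A (sym_form c) = w"
          by (simp only: o_apply inv[OF w] inv[OF Lambda_mem])
        then show "w \<in> Lambda A ` sym_forms"
          using range_sym_form by blast
      qed
    qed (auto intro: Lambda_mem)
  qed
qed

lemma D_op_inverse:
  assumes "det_Lambda_sym A \<noteq> 0"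
  shows "D_op A (Lambda A w) = sym_part w" "Lambda A (D_op A w) = sym_part w" "D_op A w \<in> sym_forms"
proof -
  note bij = Lambda_bij[OF assms]
  have inj: "inj_on (Lambda A) sym_forms" using bij by (rule bij_betw_imp_inj_on)
  have im: "Lambda A ` sym_forms = sym_forms" using bij by (rule bij_betw_imp_surj_on)
  have "sym_part (Lambda A w) = Lambda A w"
    using Lambda_mem[of A w] by (simp add: sym_part_def sym_forms_def scaleR_2[symmetric])
  then show "D_op A (Lambda A w) = sym_part w"
    unfolding D_op_def by (metis inj the_inv_into_f_f Lambda_sym_part sym_part_mem)
  show "Lambda A (D_op A w) = sym_part w"
    unfolding D_op_def by (metis inj im f_the_inv_into_f sym_part_mem)
  show "D_op A w \<in> sym_forms"
    unfolding D_op_def by (metis inj im the_inv_into_into sym_part_mem subset_refl)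
qed

lemma D_op_linear:
  assumes "det_Lambda_sym A \<noteq> 0"
  shows "linear (D_op A)"
proof (rule linearI)
  have inj: "inj_on (Lambda A) sym_forms" using Lambda_bij[OF assms] by (rule bij_betw_imp_inj_on)
  note D = D_op_inverse[OF assms]
  fix v w and r :: real
  have "D_op A v + D_op A w \<in> sym_forms" "r *\<^sub>R D_op A v \<in> sym_forms"
    using D(3)[of v] D(3)[of w] by (auto intro!: sym_formsI simp: sym_formsD)
  moreover have "Lambda A (D_op A v + D_op A w) = Lambda A (D_op A (v + w))"
    unfolding linear_add[OF Lambda_linear] D(2) by (simp add: sym_part_def vec_eq_iff transpose_def field_simps)
  moreover have "Lambda A (r *\<^sub>R D_op A v) = Lambda A (D_op A (r *\<^sub>R v))"
    unfolding linear_cmul[OF Lambda_linear] D(2) by (simp add: sym_part_def vec_eq_iff transpose_def distrib_left)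
  ultimately show "D_op A (v + w) = D_op A v + D_op A w" "D_op A (r *\<^sub>R v) = r *\<^sub>R D_op A v"
    using inj D(3) by (metis inj_onD)+
qed

lemma form_expand: "w = (\<Sum>i\<in>UNIV. \<Sum>j\<in>UNIV. w $ i $ j *\<^sub>R (axis i (axis j 1) :: real^'n^'n::finite))"
proof -
  have "(\<Sum>i\<in>UNIV. \<Sum>j\<in>UNIV. w $ i $ j *\<^sub>R axis i (axis j (1::real))) $ a $ b = w $ a $ b" for a b
  proof -
    have "(\<Sum>i\<in>UNIV. \<Sum>j\<in>UNIV. w $ i $ j *\<^sub>R axis i (axis j (1::real))) $ a $ b
      = (\<Sum>i\<in>UNIV. \<Sum>j\<in>UNIV. if i = a then if j = b then w $ i $ j else 0 else 0)"
      by (simp only: sum_component vector_scaleR_component, intro sum.cong refl)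
         (simp add: axis_def)
    also have "\<dots> = (\<Sum>i\<in>UNIV. if i = a then w $ i $ b else 0)"
      by (intro sum.cong refl) (simp add: sum.delta)
    finally show ?thesis by (simp add: sum.delta)
  qed
  then show ?thesis by (simp add: vec_eq_iff)
qed

lemma D_op_components:
  assumes "det_Lambda_sym A \<noteq> 0"
  shows "D_op A w $ p $ q = (\<Sum>i\<in>UNIV. \<Sum>j\<in>UNIV. D_coeff A i j p q * w $ i $ j)"
proof -
  note lin = D_op_linear[OF assms]
  have "D_op A w = D_op A (\<Sum>i\<in>UNIV. \<Sum>j\<in>UNIV. w $ i $ j *\<^sub>R axis i (axis j 1))"
    by (rule arg_cong[OF form_expand])
  also have "\<dots> = (\<Sum>i\<in>UNIV. \<Sum>j\<in>UNIV. w $ i $ j *\<^sub>R D_op A (axis i (axis j 1)))"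
    by (simp only: linear_sum[OF lin] linear_cmul[OF lin])
  finally show ?thesis
    by (simp add: D_coeff_def mult.commute)
qed

lemma D_coeff_sym:
  fixes A :: "real^'n^'n::finite"
  assumes "det_Lambda_sym A \<noteq> 0"
  shows "D_coeff A i j p q = D_coeff A j i p q" "D_coeff A i j p q = D_coeff A i j q p"
proof -
  have "sym_part (axis i (axis j 1)) = sym_part (axis j (axis i 1) :: real^'n^'n)"
    by (auto simp: sym_part_def vec_eq_iff transpose_def axis_def)
  then show "D_coeff A i j p q = D_coeff A j i p q" by (simp add: D_coeff_def D_op_def)
  show "D_coeff A i j p q = D_coeff A i j q p"
    unfolding D_coeff_def by (rule sym_formsD[OF D_op_inverse(3)[OF assms]])
qed

lemma D_coeff_identity:
  assumes "det_Lambda_sym A \<noteq> 0"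
  shows "(\<Sum>i\<in>UNIV. \<Sum>j\<in>UNIV. D_coeff A i j r s * Lambda_coeff A p q i j) =
    (kron p r * kron q s + kron p s * kron q r) / 2"
proof -
  have E: "Lambda A (axis p (axis q 1)) $ i $ j = Lambda_coeff A p q i j" for i j
  proof -
    have "Lambda A (axis p (axis q 1)) $ i $ j =
      (\<Sum>a\<in>UNIV. \<Sum>b\<in>UNIV. if a = p then if b = q then Lambda_coeff A a b i j else 0 else 0)"
      unfolding Lambda_def vec_lambda_beta by (intro sum.cong refl) (simp add: axis_def)
    also have "\<dots> = (\<Sum>a\<in>UNIV. if a = p then Lambda_coeff A a q i j else 0)"
      by (intro sum.cong refl) (simp add: sum.delta)
    finally show ?thesis by (simp add: sum.delta)
  qed
  have "(\<Sum>i\<in>UNIV. \<Sum>j\<in>UNIV. D_coeff A i j r s * Lambda_coeff A p q i j) =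
      sym_part (axis p (axis q 1)) $ r $ s"
    by (simp flip: D_op_components[OF assms] E D_op_inverse(1)[OF assms])
  then show ?thesis
    by (auto simp: sym_part_def transpose_def axis_def kron_def)
qed

subsection \<open>The coefficients describe the actual equations\<close>

definition system_rhs ::
  "(real^'n \<Rightarrow> real^'n^'n::finite) \<Rightarrow> (real^'n \<Rightarrow> 'n \<Rightarrow> 'n \<Rightarrow> 'n \<Rightarrow> real) \<Rightarrow>
   real^'n \<Rightarrow> real^'n \<Rightarrow> real^'n \<Rightarrow> real^'n"
where
  "system_rhs B C u p q =
     (\<chi> i. (\<Sum>j\<in>UNIV. B u $ i $ j * q $ j) + (\<Sum>r\<in>UNIV. \<Sum>s\<in>UNIV. C u i r s * p $ r * p $ s))"

text \<open>\<open>u\<^sub>t = ut\<close> and \<open>u\<^sub>x\<^sub>x = uxx\<close> at \<open>(t, x)\<close>, and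
  \<open>u\<^sub>x = ux\<close> along the line \<open>t = const\<close> near \<open>x\<close>.\<close>

definition has_jet_at ::
  "(real \<Rightarrow> real \<Rightarrow> real^'n::finite) \<Rightarrow> real \<Rightarrow> real \<Rightarrow> real^'n \<Rightarrow> (real \<Rightarrow> real^'n) \<Rightarrow> real^'n \<Rightarrow> bool"
where
  "has_jet_at u t x ut ux uxx \<longleftrightarrow>
     ((\<lambda>t. u t x) has_vector_derivative ut) (at t) \<and>
     (\<forall>\<^sub>F x' in nhds x. (u t has_vector_derivative ux x') (at x')) \<and>
     (ux has_vector_derivative uxx) (at x)"

lemma frechet_partial:
  assumes "f differentiable (at y)"
  shows "frechet_derivative f (at y) v = (\<Sum>k\<in>UNIV. partial_deriv k f y * v $ k)"
proof -
  have lin: "linear (frechet_derivative f (at y))"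
    using assms by (rule linear_frechet_derivative)
  have "v = (\<Sum>k\<in>UNIV. v $ k *\<^sub>R axis k 1)"
    by (simp add: vec_eq_iff axis_def if_distrib if_distribR sum.delta' cong: if_cong)
  then have "frechet_derivative f (at y) v = frechet_derivative f (at y) (\<Sum>k\<in>UNIV. v $ k *\<^sub>R axis k 1)"
    by simp
  also have "\<dots> = (\<Sum>k\<in>UNIV. partial_deriv k f y * v $ k)"
    by (simp add: linear_sum[OF lin] linear_cmul[OF lin] partial_deriv_def mult.commute)
  finally show ?thesis .
qed

lemma partial_chain:
  assumes "f differentiable (at (c x))" "(c has_vector_derivative c') (at x)"
  shows "((\<lambda>x. f (c x)) has_real_derivative (\<Sum>k\<in>UNIV. partial_deriv k f (c x) * c' $ k)) (at x)"
proof -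
  have lin: "linear (frechet_derivative f (at (c x)))"
    using assms(1) by (rule linear_frechet_derivative)
  have "((\<lambda>x. f (c x)) has_derivative (\<lambda>h. frechet_derivative f (at (c x)) (h *\<^sub>R c'))) (at x)"
    using assms has_derivative_compose frechet_derivative_works has_vector_derivative_def by metis
  moreover have "frechet_derivative f (at (c x)) (h *\<^sub>R c') =
      (\<Sum>k\<in>UNIV. partial_deriv k f (c x) * c' $ k) * h" for h
    by (simp only: linear_cmul[OF lin]) (simp add: frechet_partial[OF assms(1)])
  ultimately show ?thesis
    by (simp add: has_field_derivative_def)
qed

lemma smooth_on_differentiable: "smooth_on S f \<Longrightarrow> open S \<Longrightarrow> y \<in> S \<Longrightarrow> f differentiable (at y)"
  unfolding smooth_on_def
  by (metis Ck_on.simps(2) at_within_open differentiable_on_def)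

lemma smooth_on_partial: "smooth_on S f \<Longrightarrow> smooth_on S (partial_deriv i f)"
  unfolding smooth_on_def by (metis Ck_on.simps(2))

lemma vector_deriv_component:
  assumes "(c has_vector_derivative c') (at x)"
  shows "((\<lambda>x. c x $ i) has_real_derivative c' $ i) (at x)"
  using bounded_linear.has_vector_derivative[OF bounded_linear_vec_nth assms]
  by (simp add: has_real_derivative_iff_has_vector_derivative)

lemma vector_deriv_componentI:
  fixes c :: "real \<Rightarrow> real^'n::finite"
  assumes "\<And>i. ((\<lambda>x. c x $ i) has_real_derivative c' $ i) (at x)"
  shows "(c has_vector_derivative c') (at x)"
proof -
  have "((\<lambda>x. c x \<bullet> b) has_derivative (\<lambda>h. (h *\<^sub>R c') \<bullet> b)) (at x)" if b: "b \<in> Basis" for b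
  proof -
    obtain i where "b = axis i 1" using b by (auto simp: Basis_vec_def)
    moreover have "(*) (c' $ i) = (\<lambda>h. h * c' $ i)" by (simp add: fun_eq_iff)
    ultimately show ?thesis
      using assms[of i] by (simp add: has_field_derivative_def inner_axis)
  qed
  then show ?thesis
    unfolding has_vector_derivative_def by (subst has_derivative_componentwise_within) blast
qed

lemma jacobian_inverse:
  assumes pt: "point_transformation V W \<phi> \<psi>" and z: "z \<in> W"
  shows "(\<chi> i k. partial_deriv k (\<lambda>y. \<phi> y $ i) (\<psi> z)) ** (\<chi> k m. partial_deriv m (\<lambda>z. \<psi> z $ k) z)
    = mat 1"
proof -
  have W: "open W" and V: "open V" and hom: "homeomorphism V W \<phi> \<psi>"
    and sm: "\<And>i. smooth_on V (\<lambda>y. \<phi> y $ i)" "\<And>i. smooth_on W (\<lambda>z. \<psi> z $ i)"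
    using pt by (auto simp: point_transformation_def)
  have "(\<Sum>k\<in>UNIV. partial_deriv k (\<lambda>y. \<phi> y $ i) (\<psi> z) * partial_deriv m (\<lambda>z. \<psi> z $ k) z) =
     (if i = m then 1 else 0)" for i m
  proof -
    define l where "l = (\<lambda>h::real. z + h *\<^sub>R axis m 1)"
    have l: "(l has_vector_derivative axis m 1) (at h)" for h
      unfolding l_def by (auto intro!: derivative_eq_intros)
    have l0: "l 0 = z" by (simp add: l_def)
    have "((\<lambda>h. \<psi> (l h)) has_vector_derivative (\<chi> k. partial_deriv m (\<lambda>z. \<psi> z $ k) z)) (at 0)"
    proof (rule vector_deriv_componentI)
      fix k
      have "(\<lambda>z. \<psi> z $ k) differentiable at (l 0)"
        using smooth_on_differentiable[OF sm(2) W z] by (simp add: l0)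
      from partial_chain[OF this l]
      show "((\<lambda>h. \<psi> (l h) $ k) has_real_derivative (\<chi> k. partial_deriv m (\<lambda>z. \<psi> z $ k) z) $ k) (at 0)"
        by (simp add: l0 axis_def if_distrib sum.delta cong: if_cong)
    qed
    moreover have "\<psi> z \<in> V" using hom z by (auto simp: homeomorphism_def)
    then have "(\<lambda>y. \<phi> y $ i) differentiable at (\<psi> (l 0))"
      using smooth_on_differentiable[OF sm(1) V] by (simp add: l0)
    ultimately have d: "((\<lambda>h. \<phi> (\<psi> (l h)) $ i) has_real_derivative
        (\<Sum>k\<in>UNIV. partial_deriv k (\<lambda>y. \<phi> y $ i) (\<psi> z) * partial_deriv m (\<lambda>z. \<psi> z $ k) z)) (at 0)"
      using partial_chain[of "\<lambda>y. \<phi> y $ i" "\<lambda>h. \<psi> (l h)" 0 "\<chi> k. partial_deriv m (\<lambda>z. \<psi> z $ k) z"]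
      by (simp add: l0)
    have "continuous (at 0) l" using l has_vector_derivative_continuous by blast
    then have "\<forall>\<^sub>F h in at 0. l h \<in> W"
      using W z l0 by (metis continuous_at topological_tendstoD)
    then have "\<forall>\<^sub>F h in at 0. \<phi> (\<psi> (l h)) $ i = l h $ i"
      by eventually_elim (use hom in \<open>auto simp: homeomorphism_def\<close>)
    then have "\<forall>\<^sub>F h in nhds 0. \<phi> (\<psi> (l h)) $ i = l h $ i"
      using hom z l0 by (simp add: eventually_nhds_conv_at homeomorphism_def)
    then have "((\<lambda>h. l h $ i) has_real_derivative
        (\<Sum>k\<in>UNIV. partial_deriv k (\<lambda>y. \<phi> y $ i) (\<psi> z) * partial_deriv m (\<lambda>z. \<psi> z $ k) z)) (at 0)"
      using d by (rule DERIV_cong_ev[OF refl _ refl, THEN iffD1])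
    from DERIV_unique[OF this vector_deriv_component[OF l]] show ?thesis
      by (simp add: axis_def)
  qed
  then show ?thesis by (simp add: matrix_matrix_mult_def mat_def vec_eq_iff)
qed

lemma jet_transform:
  fixes z :: "real \<Rightarrow> real \<Rightarrow> real^'n::finite"
  assumes jet: "has_jet_at z t x zt zx zxx"
    and W: "open W" "z t x \<in> W" and sm: "\<And>i. smooth_on W (\<lambda>z. \<psi> z $ i)"
  shows "has_jet_at (\<lambda>t x. \<psi> (z t x)) t x
     (\<chi> k. \<Sum>m\<in>UNIV. partial_deriv m (\<lambda>z. \<psi> z $ k) (z t x) * zt $ m)
     (\<lambda>x. \<chi> k. \<Sum>m\<in>UNIV. partial_deriv m (\<lambda>z. \<psi> z $ k) (z t x) * zx x $ m)
     (\<chi> k. (\<Sum>r\<in>UNIV. partial_deriv r (\<lambda>z. \<psi> z $ k) (z t x) * zxx $ r) +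
        (\<Sum>r\<in>UNIV. \<Sum>s\<in>UNIV. partial_deriv s (partial_deriv r (\<lambda>z. \<psi> z $ k)) (z t x) * zx x $ r * zx x $ s))"
proof -
  have jt: "((\<lambda>t. z t x) has_vector_derivative zt) (at t)"
    and jx: "\<forall>\<^sub>F x' in nhds x. (z t has_vector_derivative zx x') (at x')"
    and jxx: "(zx has_vector_derivative zxx) (at x)"
    using jet by (auto simp: has_jet_at_def)
  have d: "(\<lambda>z. \<psi> z $ k) differentiable at w" "partial_deriv r (\<lambda>z. \<psi> z $ k) differentiable at w"
    if "w \<in> W" for w k r
    using that sm W(1) by (auto intro: smooth_on_differentiable smooth_on_partial)
  have jx0: "(z t has_vector_derivative zx x) (at x)" using jx by (rule eventually_nhds_x_imp_x)
  have "\<forall>\<^sub>F x' in at x. z t x' \<in> W"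
    using jx0 W has_vector_derivative_continuous by (metis continuous_at topological_tendstoD)
  then have ev: "\<forall>\<^sub>F x' in nhds x. z t x' \<in> W" using W by (simp add: eventually_nhds_conv_at)
  show ?thesis unfolding has_jet_at_def
  proof (intro conjI)
    show "((\<lambda>t. \<psi> (z t x)) has_vector_derivative
        (\<chi> k. \<Sum>m\<in>UNIV. partial_deriv m (\<lambda>z. \<psi> z $ k) (z t x) * zt $ m)) (at t)"
    proof (rule vector_deriv_componentI, simp only: vec_lambda_beta)
      show "((\<lambda>t. \<psi> (z t x) $ k) has_real_derivative
        (\<Sum>m\<in>UNIV. partial_deriv m (\<lambda>z. \<psi> z $ k) (z t x) * zt $ m)) (at t)" for k
        using partial_chain[of "\<lambda>z. \<psi> z $ k" "\<lambda>t. z t x", OF _ jt] d(1)[OF W(2)] by simp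
    qed
    show "\<forall>\<^sub>F x' in nhds x. ((\<lambda>x. \<psi> (z t x)) has_vector_derivative
        (\<chi> k. \<Sum>m\<in>UNIV. partial_deriv m (\<lambda>z. \<psi> z $ k) (z t x') * zx x' $ m)) (at x')"
      using ev jx
    proof eventually_elim
      case (elim x')
      show ?case
      proof (rule vector_deriv_componentI, simp only: vec_lambda_beta)
        show "((\<lambda>x. \<psi> (z t x) $ k) has_real_derivative
          (\<Sum>m\<in>UNIV. partial_deriv m (\<lambda>z. \<psi> z $ k) (z t x') * zx x' $ m)) (at x')" for k
          using partial_chain[of "\<lambda>z. \<psi> z $ k" "z t" x', OF _ elim(2)] d(1)[OF elim(1)] by simp
      qed
    qed
    show "((\<lambda>x. \<chi> k. \<Sum>m\<in>UNIV. partial_deriv m (\<lambda>z. \<psi> z $ k) (z t x) * zx x $ m) has_vector_derivative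
       (\<chi> k. (\<Sum>r\<in>UNIV. partial_deriv r (\<lambda>z. \<psi> z $ k) (z t x) * zxx $ r) +
        (\<Sum>r\<in>UNIV. \<Sum>s\<in>UNIV. partial_deriv s (partial_deriv r (\<lambda>z. \<psi> z $ k)) (z t x) * zx x $ r * zx x $ s))) (at x)"
    proof (rule vector_deriv_componentI, simp only: vec_lambda_beta)
      fix k
      have "((\<lambda>x. \<Sum>m\<in>UNIV. partial_deriv m (\<lambda>z. \<psi> z $ k) (z t x) * zx x $ m) has_real_derivative
        (\<Sum>m\<in>UNIV. (\<Sum>s\<in>UNIV. partial_deriv s (partial_deriv m (\<lambda>z. \<psi> z $ k)) (z t x) * zx x $ s) * zx x $ m
           + zxx $ m * partial_deriv m (\<lambda>z. \<psi> z $ k) (z t x))) (at x)"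
        by (intro DERIV_sum DERIV_mult partial_chain[OF d(2)[OF W(2)] jx0] vector_deriv_component[OF jxx])
      then show "((\<lambda>x. \<Sum>m\<in>UNIV. partial_deriv m (\<lambda>z. \<psi> z $ k) (z t x) * zx x $ m) has_real_derivative
        (\<Sum>r\<in>UNIV. partial_deriv r (\<lambda>z. \<psi> z $ k) (z t x) * zxx $ r) +
        (\<Sum>r\<in>UNIV. \<Sum>s\<in>UNIV. partial_deriv s (partial_deriv r (\<lambda>z. \<psi> z $ k)) (z t x) * zx x $ r * zx x $ s)) (at x)"
        by (simp add: sum.distrib sum_distrib_left sum_distrib_right ac_simps)
    qed
  qed
qed

lemma transformed_rhs:
  fixes B :: "real^'n \<Rightarrow> real^'n^'n::finite" and z :: "real^'n"
  shows "system_rhs (transformed_lead \<phi> \<psi> B) (transformed_quad \<phi> \<psi> B C) z p q =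
    (\<chi> i k. partial_deriv k (\<lambda>y. \<phi> y $ i) (\<psi> z)) *v
    system_rhs B C (\<psi> z)
      (\<chi> k. \<Sum>m\<in>UNIV. partial_deriv m (\<lambda>z. \<psi> z $ k) z * p $ m)
      (\<chi> k. (\<Sum>r\<in>UNIV. partial_deriv r (\<lambda>z. \<psi> z $ k) z * q $ r) +
        (\<Sum>r\<in>UNIV. \<Sum>s\<in>UNIV. partial_deriv s (partial_deriv r (\<lambda>z. \<psi> z $ k)) z * p $ r * p $ s))"
proof (simp only: vec_eq_iff, intro allI)
  fix i
  define P where "P k = partial_deriv k (\<lambda>y. \<phi> y $ i) (\<psi> z)" for k
  define Q where "Q k m = partial_deriv m (\<lambda>z. \<psi> z $ k) z" for k m
  define H where "H k r s = partial_deriv s (partial_deriv r (\<lambda>z. \<psi> z $ k)) z" for k r s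
  define b where "b k j = B (\<psi> z) $ k $ j" for k j
  define c where "c = C (\<psi> z)"
  have lead: "(\<Sum>r\<in>UNIV. (\<Sum>k\<in>UNIV. \<Sum>j\<in>UNIV. P k * b k j * Q j r) * q $ r)
     = (\<Sum>k\<in>UNIV. P k * (\<Sum>j\<in>UNIV. b k j * (\<Sum>r\<in>UNIV. Q j r * q $ r)))"
  proof -
    have "(\<Sum>r\<in>UNIV. (\<Sum>k\<in>UNIV. \<Sum>j\<in>UNIV. P k * b k j * Q j r) * q $ r)
      = (\<Sum>r\<in>UNIV. \<Sum>k\<in>UNIV. \<Sum>j\<in>UNIV. P k * b k j * Q j r * q $ r)"
      by (simp add: sum_distrib_right)
    also have "\<dots> = (\<Sum>k\<in>UNIV. \<Sum>r\<in>UNIV. \<Sum>j\<in>UNIV. P k * b k j * Q j r * q $ r)"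
      by (rule sum.swap)
    also have "\<dots> = (\<Sum>k\<in>UNIV. \<Sum>j\<in>UNIV. \<Sum>r\<in>UNIV. P k * b k j * Q j r * q $ r)"
      by (intro sum.cong refl sum.swap)
    finally show ?thesis by (simp add: sum_distrib_left mult.assoc)
  qed
  have hess: "(\<Sum>r\<in>UNIV. \<Sum>s\<in>UNIV. (\<Sum>j\<in>UNIV. b k j * H j r s) * p $ r * p $ s)
     = (\<Sum>j\<in>UNIV. b k j * (\<Sum>r\<in>UNIV. \<Sum>s\<in>UNIV. H j r s * p $ r * p $ s))" for k
  proof -
    have "(\<Sum>r\<in>UNIV. \<Sum>s\<in>UNIV. (\<Sum>j\<in>UNIV. b k j * H j r s) * p $ r * p $ s)
      = (\<Sum>r\<in>UNIV. \<Sum>s\<in>UNIV. \<Sum>j\<in>UNIV. b k j * H j r s * p $ r * p $ s)"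
      by (simp add: sum_distrib_right)
    also have "\<dots> = (\<Sum>r\<in>UNIV. \<Sum>j\<in>UNIV. \<Sum>s\<in>UNIV. b k j * H j r s * p $ r * p $ s)"
      by (intro sum.cong refl sum.swap)
    also have "\<dots> = (\<Sum>j\<in>UNIV. \<Sum>r\<in>UNIV. \<Sum>s\<in>UNIV. b k j * H j r s * p $ r * p $ s)"
      by (rule sum.swap)
    finally show ?thesis by (simp add: sum_distrib_left mult.assoc)
  qed
  have quad: "(\<Sum>r\<in>UNIV. \<Sum>s\<in>UNIV. (\<Sum>a\<in>UNIV. \<Sum>d\<in>UNIV. c k a d * Q a r * Q d s) * p $ r * p $ s)
     = (\<Sum>a\<in>UNIV. \<Sum>d\<in>UNIV. c k a d * (\<Sum>r\<in>UNIV. Q a r * p $ r) * (\<Sum>s\<in>UNIV. Q d s * p $ s))" for k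
  proof -
    have "(\<Sum>r\<in>UNIV. \<Sum>s\<in>UNIV. (\<Sum>a\<in>UNIV. \<Sum>d\<in>UNIV. c k a d * Q a r * Q d s) * p $ r * p $ s)
      = (\<Sum>r\<in>UNIV. \<Sum>s\<in>UNIV. \<Sum>a\<in>UNIV. \<Sum>d\<in>UNIV. c k a d * Q a r * Q d s * p $ r * p $ s)"
      by (simp add: sum_distrib_right)
    also have "\<dots> = (\<Sum>r\<in>UNIV. \<Sum>a\<in>UNIV. \<Sum>s\<in>UNIV. \<Sum>d\<in>UNIV. c k a d * Q a r * Q d s * p $ r * p $ s)"
      by (intro sum.cong refl sum.swap)
    also have "\<dots> = (\<Sum>a\<in>UNIV. \<Sum>r\<in>UNIV. \<Sum>s\<in>UNIV. \<Sum>d\<in>UNIV. c k a d * Q a r * Q d s * p $ r * p $ s)"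
      by (rule sum.swap)
    also have "\<dots> = (\<Sum>a\<in>UNIV. \<Sum>r\<in>UNIV. \<Sum>d\<in>UNIV. \<Sum>s\<in>UNIV. c k a d * Q a r * Q d s * p $ r * p $ s)"
      by (intro sum.cong refl sum.swap)
    also have "\<dots> = (\<Sum>a\<in>UNIV. \<Sum>d\<in>UNIV. \<Sum>r\<in>UNIV. \<Sum>s\<in>UNIV. c k a d * Q a r * Q d s * p $ r * p $ s)"
      by (intro sum.cong refl sum.swap)
    also have "\<dots> = (\<Sum>a\<in>UNIV. \<Sum>d\<in>UNIV. \<Sum>r\<in>UNIV. \<Sum>s\<in>UNIV. c k a d * ((Q a r * p $ r) * (Q d s * p $ s)))"
      by (intro sum.cong refl) (simp add: ac_simps)
    also have "\<dots> = (\<Sum>a\<in>UNIV. \<Sum>d\<in>UNIV. c k a d * ((\<Sum>r\<in>UNIV. Q a r * p $ r) * (\<Sum>s\<in>UNIV. Q d s * p $ s)))"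
      unfolding sum_product by (simp only: sum_distrib_left)
    finally show ?thesis by (simp only: mult.assoc)
  qed
  have outer: "(\<Sum>r\<in>UNIV. \<Sum>s\<in>UNIV. (\<Sum>k\<in>UNIV. P k * E k r s) * p $ r * p $ s)
     = (\<Sum>k\<in>UNIV. P k * (\<Sum>r\<in>UNIV. \<Sum>s\<in>UNIV. E k r s * p $ r * p $ s))" for E
  proof -
    have "(\<Sum>r\<in>UNIV. \<Sum>s\<in>UNIV. (\<Sum>k\<in>UNIV. P k * E k r s) * p $ r * p $ s)
      = (\<Sum>r\<in>UNIV. \<Sum>s\<in>UNIV. \<Sum>k\<in>UNIV. P k * E k r s * p $ r * p $ s)"
      by (simp add: sum_distrib_right)
    also have "\<dots> = (\<Sum>r\<in>UNIV. \<Sum>k\<in>UNIV. \<Sum>s\<in>UNIV. P k * E k r s * p $ r * p $ s)"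
      by (intro sum.cong refl sum.swap)
    also have "\<dots> = (\<Sum>k\<in>UNIV. \<Sum>r\<in>UNIV. \<Sum>s\<in>UNIV. P k * E k r s * p $ r * p $ s)"
      by (rule sum.swap)
    finally show ?thesis by (simp add: sum_distrib_left mult.assoc)
  qed
  have inner: "(\<Sum>r\<in>UNIV. \<Sum>s\<in>UNIV. ((\<Sum>j\<in>UNIV. b k j * H j r s) +
        (\<Sum>a\<in>UNIV. \<Sum>d\<in>UNIV. c k a d * Q a r * Q d s)) * p $ r * p $ s)
     = (\<Sum>j\<in>UNIV. b k j * (\<Sum>r\<in>UNIV. \<Sum>s\<in>UNIV. H j r s * p $ r * p $ s)) +
       (\<Sum>a\<in>UNIV. \<Sum>d\<in>UNIV. c k a d * (\<Sum>r\<in>UNIV. Q a r * p $ r) * (\<Sum>s\<in>UNIV. Q d s * p $ s))" for k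
    by (simp only: distrib_right sum.distrib hess quad)
  show "system_rhs (transformed_lead \<phi> \<psi> B) (transformed_quad \<phi> \<psi> B C) z p q $ i =
    ((\<chi> i k. partial_deriv k (\<lambda>y. \<phi> y $ i) (\<psi> z)) *v
    system_rhs B C (\<psi> z)
      (\<chi> k. \<Sum>m\<in>UNIV. partial_deriv m (\<lambda>z. \<psi> z $ k) z * p $ m)
      (\<chi> k. (\<Sum>r\<in>UNIV. partial_deriv r (\<lambda>z. \<psi> z $ k) z * q $ r) +
        (\<Sum>r\<in>UNIV. \<Sum>s\<in>UNIV. partial_deriv s (partial_deriv r (\<lambda>z. \<psi> z $ k)) z * p $ r * p $ s))) $ i"
    unfolding system_rhs_def transformed_lead_def transformed_quad_def matrix_vector_mult_def vec_lambda_beta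
    unfolding P_def[symmetric] Q_def[symmetric] H_def[symmetric] b_def[symmetric] c_def[symmetric]
      lead outer
      inner
    by (simp only: distrib_left sum.distrib add.assoc)
qed

lemma solves_transformed_iff:
  fixes z :: "real \<Rightarrow> real \<Rightarrow> real^'n::finite"
  assumes pt: "point_transformation V W \<phi> \<psi>" and z: "z t x \<in> W"
    and jz: "has_jet_at z t x zt zx zxx" and jy: "has_jet_at (\<lambda>t x. \<psi> (z t x)) t x yt yx yxx"
  shows "yt = system_rhs B C (\<psi> (z t x)) (yx x) yxx \<longleftrightarrow>
    zt = system_rhs (transformed_lead \<phi> \<psi> B) (transformed_quad \<phi> \<psi> B C) (z t x) (zx x) zxx"
proof -
  have W: "open W" and sm: "\<And>i. smooth_on W (\<lambda>z. \<psi> z $ i)"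
    using pt by (auto simp: point_transformation_def)
  let ?P = "\<chi> i k. partial_deriv k (\<lambda>y. \<phi> y $ i) (\<psi> (z t x))"
  let ?Q = "\<chi> k m. partial_deriv m (\<lambda>z. \<psi> z $ k) (z t x)"
  have PQ: "?P ** ?Q = mat 1" by (rule jacobian_inverse[OF pt z])
  then have QP: "?Q ** ?P = mat 1" by (simp add: matrix_left_right_inverse)
  define yx' where "yx' = (\<lambda>x. \<chi> k. \<Sum>m\<in>UNIV. partial_deriv m (\<lambda>z. \<psi> z $ k) (z t x) * zx x $ m)"
  define yxx' where "yxx' = (\<chi> k. (\<Sum>r\<in>UNIV. partial_deriv r (\<lambda>z. \<psi> z $ k) (z t x) * zxx $ r) +
        (\<Sum>r\<in>UNIV. \<Sum>s\<in>UNIV. partial_deriv s (partial_deriv r (\<lambda>z. \<psi> z $ k)) (z t x) * zx x $ r * zx x $ s))"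
  have jy': "has_jet_at (\<lambda>t x. \<psi> (z t x)) t x (?Q *v zt) yx' yxx'"
    using jet_transform[OF jz W z sm] by (simp add: yx'_def yxx'_def matrix_vector_mult_def)
  have yt: "yt = ?Q *v zt"
    using jy jy' vector_derivative_unique_at unfolding has_jet_at_def by blast
  have ev: "\<forall>\<^sub>F x' in nhds x. yx x' = yx' x'"
    using jy jy' unfolding has_jet_at_def
    by (auto elim: eventually_elim2 intro: vector_derivative_unique_at)
  then have yx: "yx x = yx' x" by (rule eventually_nhds_x_imp_x)
  have "(yx has_vector_derivative yxx) (at x)" using jy by (simp add: has_jet_at_def)
  then have "(yx' has_vector_derivative yxx) (at x)"
    using has_vector_derivative_cong_ev[where S = UNIV and f = yx and g = yx' and x = x] ev yx by simp
  then have yxx: "yxx = yxx'"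
    using jy' vector_derivative_unique_at unfolding has_jet_at_def by blast
  have rhs: "system_rhs (transformed_lead \<phi> \<psi> B) (transformed_quad \<phi> \<psi> B C) (z t x) (zx x) zxx =
      ?P *v system_rhs B C (\<psi> (z t x)) (yx x) yxx"
    unfolding transformed_rhs yx yxx yx'_def yxx'_def ..
  show ?thesis unfolding rhs yt
  proof
    let ?R = "system_rhs B C (\<psi> (z t x)) (yx x) yxx"
    assume "?Q *v zt = ?R"
    then have "?P *v (?Q *v zt) = ?P *v ?R" by (rule arg_cong)
    then show "zt = ?P *v ?R"
      by (simp only: matrix_vector_mul_assoc PQ matrix_vector_mul_lid)
  next
    let ?R = "system_rhs B C (\<psi> (z t x)) (yx x) yxx"
    assume "zt = ?P *v ?R"
    then have "?Q *v zt = ?Q *v (?P *v ?R)" by (rule arg_cong)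
    then show "?Q *v zt = ?R"
      by (simp only: matrix_vector_mul_assoc QP matrix_vector_mul_lid)
  qed
qed

lemma diffusion_expansion:
  fixes z :: "real \<Rightarrow> real \<Rightarrow> real^'n::finite"
  assumes "open W" "z t x \<in> W" "\<And>i j. smooth_on W (\<lambda>z. B z $ i $ j)"
    and jz: "has_jet_at z t x zt zx zxx"
  shows "((\<lambda>x. B (z t x) *v zx x) has_vector_derivative
     system_rhs B (diffusion_quad B) (z t x) (zx x) zxx) (at x)"
proof (rule vector_deriv_componentI)
  fix i
  have jx: "(z t has_vector_derivative zx x) (at x)" and jxx: "(zx has_vector_derivative zxx) (at x)"
    using jz by (auto simp: has_jet_at_def dest: eventually_nhds_x_imp_x)
  have d: "(\<lambda>z. B z $ i $ j) differentiable at (z t x)" for j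
    using assms by (auto intro: smooth_on_differentiable)
  have "((\<lambda>x. \<Sum>j\<in>UNIV. B (z t x) $ i $ j * zx x $ j) has_real_derivative
     (\<Sum>j\<in>UNIV. (\<Sum>s\<in>UNIV. partial_deriv s (\<lambda>z. B z $ i $ j) (z t x) * zx x $ s) * zx x $ j
           + zxx $ j * B (z t x) $ i $ j)) (at x)"
    by (intro DERIV_sum DERIV_mult partial_chain[OF d jx] vector_deriv_component[OF jxx])
  then show "((\<lambda>x. (B (z t x) *v zx x) $ i) has_real_derivative
      system_rhs B (diffusion_quad B) (z t x) (zx x) zxx $ i) (at x)"
    by (simp add: system_rhs_def diffusion_quad_def matrix_vector_mult_def sum.distrib sum_distrib_left sum_distrib_right ac_simps)
qed

end

theory Submission
  imports Defs
begin

text \<open>Let \<open>P = \<partial>\<phi>\<close> be the Jacobian of a point transformation and \<open>T\<close> the transformed leading matrix.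
  Differentiating \<open>T(\<phi>(y)) P(y) = P(y) A(y)\<close> and \<open>\<partial>\<psi>(\<phi>(y)) P(y) = 1\<close> and contracting the quadratic
  coefficients with \<open>P\<close>, all terms with \<open>T \<partial>P\<close> cancel, and the transformed system is in diffusion form
  iff \<open>\<Lambda>(\<partial>\<partial>\<phi>\<^sup>i) = \<Sum>\<^sub>k \<partial>\<^sub>k\<phi>\<^sup>i (A\<Gamma> - sym \<partial>A)\<^sup>k\<close>, that is, iff
  \<open>\<partial>\<^sub>a\<partial>\<^sub>b\<phi>\<^sup>i = \<Sum>\<^sub>m \<theta>\<^sup>m\<^sub>a\<^sub>b \<partial>\<^sub>m\<phi>\<^sup>i\<close>. Zero curvature is the integrability condition of this linear
  Pfaffian system; it is necessary by the symmetry of third derivatives and sufficient by Frobenius'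
  theorem together with the inverse function theorem.\<close>

section \<open>Calculus of smooth functions\<close>

text \<open>The leading coefficients leave no freedom: an admissible \<open>A'\<close> equals the
  transformed leading matrix on an open set, so only \<open>\<phi>\<close> is unknown.
  Non-degeneracy allows solving for the Hessian itself, and since \<open>D\<close> is linear the
  gradient passes through it. The resulting equation is linear in the gradient and separate for each
  component of \<open>\<phi>\<close>, so solutions whose gradients at the point are the unit vectors
  assemble into a map with identity Jacobian there. The obstacle in the sufficiency part is that
  integration along rays controls only radial derivatives. The radial problem is therefore posed as
  a fixed point equation on a whole ball, whose Neumann series converges together with its
  derivatives; flatness then removes the non-radial defect. Smoothness is gained afterwards, for the
  solution and for the inverse map alike: the first derivatives are expressed through the unknown
  itself and smooth data, so each order of differentiability yields the next.\<close>

lemma partial_deriv_eq: "(f has_derivative f') (at y) \<Longrightarrow> partial_deriv k f y = f' (axis k 1)"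
  unfolding partial_deriv_def by (metis frechet_derivative_at)

text \<open>No differentiability is assumed. \<open>frechet_derivative\<close> chooses from the set
  of all derivatives at the point, and functions that agree near the point have the same set, so the
  choice is the same.\<close>

lemma partial_deriv_cong:
  assumes "open S" "y \<in> S" "\<And>x. x \<in> S \<Longrightarrow> f x = g x"
  shows "partial_deriv k f y = partial_deriv k g y"
proof -
  have "(f has_derivative D) (at y) \<longleftrightarrow> (g has_derivative D) (at y)" for D
    using assms has_derivative_transform_within_open[of _ D y UNIV S] by metis
  then show ?thesis
    unfolding partial_deriv_def frechet_derivative_def by simp
qed

lemma partial_deriv_const: "partial_deriv k (\<lambda>y. c) y = 0"
  by (rule partial_deriv_eq) (rule has_derivative_const)

lemma partial_deriv_add:
  assumes "f differentiable at y" "g differentiable at y"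
  shows "partial_deriv k (\<lambda>y. f y + g y) y = partial_deriv k f y + partial_deriv k g y"
  using partial_deriv_eq[OF has_derivative_add[OF assms[unfolded frechet_derivative_works]]]
  by (simp add: partial_deriv_def)

lemma partial_deriv_mult:
  assumes "f differentiable at y" "g differentiable at y"
  shows "partial_deriv k (\<lambda>y. f y * g y) y = f y * partial_deriv k g y + partial_deriv k f y * g y"
  using partial_deriv_eq[OF has_derivative_mult[OF assms[unfolded frechet_derivative_works]]]
  by (simp add: partial_deriv_def)

lemma partial_deriv_inverse:
  assumes "f differentiable at y" "f y \<noteq> 0"
  shows "partial_deriv k (\<lambda>y. inverse (f y)) y = - (inverse (f y) * partial_deriv k f y * inverse (f y))"
  using partial_deriv_eq[OF Deriv.has_derivative_inverse[OF assms(2) assms(1)[unfolded frechet_derivative_works]]]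
  by (simp add: partial_deriv_def)

lemma partial_deriv_sum:
  assumes "\<And>i. i \<in> I \<Longrightarrow> f i differentiable at y"
  shows "partial_deriv k (\<lambda>y. \<Sum>i\<in>I. f i y) y = (\<Sum>i\<in>I. partial_deriv k (f i) y)"
proof -
  have "((\<lambda>y. \<Sum>i\<in>I. f i y) has_derivative (\<lambda>h. \<Sum>i\<in>I. frechet_derivative (f i) (at y) h)) (at y)"
    using assms by (intro has_derivative_sum) (simp add: frechet_derivative_works[symmetric])
  from partial_deriv_eq[OF this] show ?thesis by (simp add: partial_deriv_def)
qed

lemma has_derivative_vecI:
  fixes f :: "'a::real_normed_vector \<Rightarrow> real^'n::finite"
  assumes "\<And>j. ((\<lambda>y. f y $ j) has_derivative (\<lambda>h. f' h $ j)) (at y)"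
  shows "(f has_derivative f') (at y)"
  unfolding has_derivative_componentwise_within[of f]
proof
  fix b :: "real^'n" assume "b \<in> Basis"
  then obtain i where "b = axis i 1" by (auto simp: Basis_vec_def)
  then show "((\<lambda>x. f x \<bullet> b) has_derivative (\<lambda>x. f' x \<bullet> b)) (at y)"
    using assms[of i] by (simp add: inner_axis)
qed

lemma partial_deriv_compose:
  fixes f :: "real^'n::finite \<Rightarrow> real" and \<psi> :: "real^'m::finite \<Rightarrow> real^'n"
  assumes f: "f differentiable at (\<psi> z)" and \<psi>: "\<And>j. (\<lambda>z. \<psi> z $ j) differentiable at z"
  shows "partial_deriv k (\<lambda>z. f (\<psi> z)) z =
    (\<Sum>j\<in>UNIV. partial_deriv j f (\<psi> z) * partial_deriv k (\<lambda>z. \<psi> z $ j) z)"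
    and "(\<lambda>z. f (\<psi> z)) differentiable at z"
proof -
  have "(\<psi> has_derivative (\<lambda>h. \<chi> j. frechet_derivative (\<lambda>z. \<psi> z $ j) (at z) h)) (at z)"
    using \<psi> by (intro has_derivative_vecI) (simp add: frechet_derivative_works[symmetric])
  then have d: "((\<lambda>z. f (\<psi> z)) has_derivative
    (\<lambda>h. frechet_derivative f (at (\<psi> z)) (\<chi> j. frechet_derivative (\<lambda>z. \<psi> z $ j) (at z) h))) (at z)"
    using f[unfolded frechet_derivative_works] by (rule has_derivative_compose)
  then show "(\<lambda>z. f (\<psi> z)) differentiable at z" by (rule differentiableI)
  from partial_deriv_eq[OF d] show "partial_deriv k (\<lambda>z. f (\<psi> z)) z =
    (\<Sum>j\<in>UNIV. partial_deriv j f (\<psi> z) * partial_deriv k (\<lambda>z. \<psi> z $ j) z)"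
    by (simp add: frechet_partial[OF f]) (simp add: partial_deriv_def)
qed

section \<open>Closure properties of the classes \<open>Ck_on\<close> and of smooth
  functions\<close>

lemma Ck_on_cong:
  assumes "open S" "\<And>x. x \<in> S \<Longrightarrow> f x = g x"
  shows "Ck_on k S f \<longleftrightarrow> Ck_on k S g"
  using assms(2)
proof (induction k arbitrary: f g)
  case 0
  then show ?case by (simp cong: continuous_on_cong)
next
  case (Suc k)
  have "f differentiable_on S \<longleftrightarrow> g differentiable_on S"
    unfolding differentiable_on_def differentiable_def
    using Suc.prems has_derivative_transform[of _ S] by metis
  moreover have "Ck_on k S (partial_deriv i f) \<longleftrightarrow> Ck_on k S (partial_deriv i g)" for i
    by (rule Suc.IH) (rule partial_deriv_cong[OF \<open>open S\<close> _ Suc.prems])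
  ultimately show ?case by simp
qed

text \<open>Serves inductions on the order: the derivative may be given by a formula
  \<open>g\<close> valid on \<open>S\<close> only, and regularity is then proved for the formula.
  Openness of \<open>S\<close> makes the two indistinguishable for further derivatives.\<close>

lemma Ck_on_SucI:
  assumes "open S" "\<And>y. y \<in> S \<Longrightarrow> f differentiable at y"
    "\<And>i y. y \<in> S \<Longrightarrow> partial_deriv i f y = g i y" "\<And>i. Ck_on k S (g i)"
  shows "Ck_on (Suc k) S f"
  using assms Ck_on_cong[OF assms(1), of "partial_deriv _ f" "g _" k]
  by (simp add: differentiable_at_imp_differentiable_on)

lemma Ck_on_SucD:
  assumes "Ck_on (Suc k) S f" "open S"
  shows "y \<in> S \<Longrightarrow> f differentiable at y" "Ck_on k S (partial_deriv i f)"
  using assms by (simp_all add: differentiable_on_eq_differentiable_at)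

lemma Ck_on_lower: "Ck_on (Suc k) S f \<Longrightarrow> Ck_on k S f"
proof (induction k arbitrary: f)
  case 0
  then show ?case by (simp add: differentiable_imp_continuous_on)
next
  case (Suc k)
  from Suc.prems have "f differentiable_on S" "\<And>i. Ck_on (Suc k) S (partial_deriv i f)" by auto
  with Suc.IH show ?case by auto
qed

lemma Ck_on_imp_continuous_on: "Ck_on k S f \<Longrightarrow> continuous_on S f"
  by (cases k) (auto simp: differentiable_imp_continuous_on)

lemma Ck_on_subset: "Ck_on k S f \<Longrightarrow> T \<subseteq> S \<Longrightarrow> Ck_on k T f"
  by (induction k arbitrary: f) (auto intro: continuous_on_subset differentiable_on_subset)

lemma Ck_on_const: "open S \<Longrightarrow> Ck_on k S (\<lambda>y. c)"
proof (induction k arbitrary: c)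
  case (Suc k)
  then show ?case by (intro Ck_on_SucI[where g = "\<lambda>_ _. 0"]) (auto simp: partial_deriv_const)
qed simp

lemma Ck_on_add: "open S \<Longrightarrow> Ck_on k S f \<Longrightarrow> Ck_on k S g \<Longrightarrow> Ck_on k S (\<lambda>y. f y + g y)"
proof (induction k arbitrary: f g)
  case 0
  then show ?case by (simp add: continuous_on_add)
next
  case (Suc k)
  note d = Ck_on_SucD[OF Suc.prems(2,1)] Ck_on_SucD[OF Suc.prems(3,1)]
  show ?case
    by (rule Ck_on_SucI[where g = "\<lambda>i y. partial_deriv i f y + partial_deriv i g y"])
      (use d Suc in \<open>auto intro!: partial_deriv_add\<close>)
qed

lemma Ck_on_mult: "open S \<Longrightarrow> Ck_on k S f \<Longrightarrow> Ck_on k S g \<Longrightarrow> Ck_on k S (\<lambda>y. f y * g y)"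
proof (induction k arbitrary: f g)
  case 0
  then show ?case by (simp add: continuous_on_mult)
next
  case (Suc k)
  note d = Ck_on_SucD[OF Suc.prems(2,1)] Ck_on_SucD[OF Suc.prems(3,1)]
  show ?case
    by (rule Ck_on_SucI[where g = "\<lambda>i y. f y * partial_deriv i g y + partial_deriv i f y * g y"])
      (use d Suc Ck_on_lower[OF Suc.prems(2)] Ck_on_lower[OF Suc.prems(3)]
        in \<open>auto intro!: partial_deriv_mult Ck_on_add simp del: Ck_on.simps\<close>)
qed

lemma Ck_on_inverse:
  "open S \<Longrightarrow> Ck_on k S f \<Longrightarrow> (\<And>y. y \<in> S \<Longrightarrow> f y \<noteq> 0) \<Longrightarrow> Ck_on k S (\<lambda>y. inverse (f y))"
proof (induction k)
  case 0
  then show ?case by (simp add: continuous_on_inverse)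
next
  case (Suc k)
  note d = Ck_on_SucD[OF Suc.prems(2,1)]
  have I: "Ck_on k S (\<lambda>y. inverse (f y))" using Suc Ck_on_lower by blast
  have g: "Ck_on k S (\<lambda>y. (- 1) * (inverse (f y) * partial_deriv i f y * inverse (f y)))" for i
    by (intro Ck_on_mult Ck_on_const d I Suc.prems(1))
  show ?case
    by (rule Ck_on_SucI[OF Suc.prems(1) _ _ g])
      (simp_all add: partial_deriv_inverse d Suc.prems(3) differentiable_inverse)
qed

lemma Ck_on_sum:
  "open S \<Longrightarrow> (\<And>i. i \<in> I \<Longrightarrow> Ck_on k S (f i)) \<Longrightarrow> Ck_on k S (\<lambda>y. \<Sum>i\<in>I. f i y)"
  by (induction I rule: infinite_finite_induct) (auto intro: Ck_on_add Ck_on_const)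

lemma Ck_on_prod:
  "open S \<Longrightarrow> (\<And>i. i \<in> I \<Longrightarrow> Ck_on k S (f i)) \<Longrightarrow> Ck_on k S (\<lambda>y. \<Prod>i\<in>I. f i y)"
  by (induction I rule: infinite_finite_induct) (auto intro: Ck_on_mult Ck_on_const)

text \<open>\<open>f\<close> stays arbitrary in the induction, because the chain rule produces
  \<open>partial_deriv j f\<close> composed with \<open>\<psi>\<close>.\<close>

lemma Ck_on_compose:
  assumes "open V" "open W" "\<psi> ` W \<subseteq> V" "Ck_on k V f" "\<And>j. Ck_on k W (\<lambda>z. \<psi> z $ j)"
  shows "Ck_on k W (\<lambda>z. f (\<psi> z))"
  using assms(4,5)
proof (induction k arbitrary: f)
  case 0
  then have "continuous_on W (\<lambda>z. \<chi> j. \<psi> z $ j)" by (intro continuous_on_vec_lambda) simp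
  then have "continuous_on W \<psi>" by (simp add: vec_lambda_eta)
  with 0 show ?case using continuous_on_compose2[OF _ _ assms(3), of f] by simp
next
  case (Suc k)
  note d = Ck_on_SucD[OF Suc.prems(1) assms(1)] Ck_on_SucD[OF Suc.prems(2) assms(2)]
  have \<psi>: "\<And>j. Ck_on k W (\<lambda>z. \<psi> z $ j)" using Suc.prems(2) by (rule Ck_on_lower)
  have V: "z \<in> W \<Longrightarrow> \<psi> z \<in> V" for z using assms(3) by blast
  have g: "Ck_on k W (\<lambda>z. \<Sum>j\<in>UNIV. partial_deriv j f (\<psi> z) * partial_deriv i (\<lambda>z. \<psi> z $ j) z)" for i
    by (intro Ck_on_sum Ck_on_mult assms(2) d(4) Suc.IH[OF d(2) \<psi>])
  show ?case
    by (rule Ck_on_SucI[OF assms(2) _ _ g]; rule partial_deriv_compose) (simp_all add: d V)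
qed

lemma smooth_onD: "smooth_on S f \<Longrightarrow> Ck_on k S f"
  by (simp add: smooth_on_def)

lemma smooth_on_cong: "open S \<Longrightarrow> (\<And>x. x \<in> S \<Longrightarrow> f x = g x) \<Longrightarrow> smooth_on S f \<longleftrightarrow> smooth_on S g"
  unfolding smooth_on_def using Ck_on_cong by blast

lemma smooth_on_subset: "smooth_on S f \<Longrightarrow> T \<subseteq> S \<Longrightarrow> smooth_on T f"
  unfolding smooth_on_def using Ck_on_subset by blast

lemma
  assumes "open S"
  shows smooth_on_const: "smooth_on S (\<lambda>y. c)"
    and smooth_on_add: "smooth_on S f \<Longrightarrow> smooth_on S g \<Longrightarrow> smooth_on S (\<lambda>y. f y + g y)"
    and smooth_on_mult: "smooth_on S f \<Longrightarrow> smooth_on S g \<Longrightarrow> smooth_on S (\<lambda>y. f y * g y)"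
    and smooth_on_inverse: "smooth_on S f \<Longrightarrow> (\<And>y. y \<in> S \<Longrightarrow> f y \<noteq> 0) \<Longrightarrow> smooth_on S (\<lambda>y. inverse (f y))"
    and smooth_on_sum: "(\<And>i. i \<in> I \<Longrightarrow> smooth_on S (F i)) \<Longrightarrow> smooth_on S (\<lambda>y. \<Sum>i\<in>I. F i y)"
    and smooth_on_prod: "(\<And>i. i \<in> I \<Longrightarrow> smooth_on S (F i)) \<Longrightarrow> smooth_on S (\<lambda>y. \<Prod>i\<in>I. F i y)"
  using assms by (auto simp: smooth_on_def intro!: Ck_on_const Ck_on_add Ck_on_mult Ck_on_inverse Ck_on_sum Ck_on_prod)

lemma smooth_on_minus: "open S \<Longrightarrow> smooth_on S f \<Longrightarrow> smooth_on S g \<Longrightarrow> smooth_on S (\<lambda>y. f y - g y)"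
  using smooth_on_add[of S f "\<lambda>y. (-1) * g y"] smooth_on_mult[of S "\<lambda>_. -1" g] smooth_on_const[of S "-1"]
  by simp

lemma smooth_on_compose:
  assumes "open V" "open W" "\<psi> ` W \<subseteq> V" "smooth_on V f" "\<And>j. smooth_on W (\<lambda>z. \<psi> z $ j)"
  shows "smooth_on W (\<lambda>z. f (\<psi> z))"
  unfolding smooth_on_def
proof
  show "Ck_on k W (\<lambda>z. f (\<psi> z))" for k
    by (rule Ck_on_compose[OF assms(1-3) smooth_onD[OF assms(4)] smooth_onD[OF assms(5)]])
qed

section \<open>Determinants and linear systems with smooth coefficients\<close>

lemma smooth_on_det:
  fixes M :: "real^'n::finite \<Rightarrow> real^'m^'m::finite"
  assumes "open S" "\<And>i j. smooth_on S (\<lambda>y. M y $ i $ j)"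
  shows "smooth_on S (\<lambda>y. det (M y))"
  unfolding det_def using assms
  by (intro smooth_on_sum smooth_on_mult smooth_on_prod smooth_on_const) auto

text \<open>Cramer's rule writes the solution as a quotient of determinants of smooth entries. The
  function \<open>x\<close> is only known pointwise, which suits inverses: the lemma is applied to
  \<open>D\<close> and to the inverse Jacobian.\<close>

lemma smooth_on_linear_solution:
  fixes M :: "real^'n::finite \<Rightarrow> real^'m^'m::finite" and x b :: "real^'n \<Rightarrow> real^'m"
  assumes "open S" "\<And>i j. smooth_on S (\<lambda>y. M y $ i $ j)" "\<And>i. smooth_on S (\<lambda>y. b y $ i)"
    "\<And>y. y \<in> S \<Longrightarrow> det (M y) \<noteq> 0" "\<And>y. y \<in> S \<Longrightarrow> M y *v x y = b y"
  shows "smooth_on S (\<lambda>y. x y $ k)"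
proof -
  have "smooth_on S (\<lambda>y. det (\<chi> i j. if j = k then b y $ i else M y $ i $ j) * inverse (det (M y)))"
  proof (intro smooth_on_mult smooth_on_inverse smooth_on_det assms(1,2,4))
    show "smooth_on S (\<lambda>y. (\<chi> i j. if j = k then b y $ i else M y $ i $ j) $ i $ j)" for i j
      using assms(2,3) by (cases "j = k") simp_all
  qed
  moreover have "x y $ k = det (\<chi> i j. if j = k then b y $ i else M y $ i $ j) * inverse (det (M y))"
    if "y \<in> S" for y
    using cramer[OF assms(4)[OF that], of "x y" "b y"] assms(5)[OF that] by (simp add: divide_inverse)
  ultimately show ?thesis using smooth_on_cong[OF assms(1)] by (metis (no_types, lifting))
qed

text \<open>Both sides are the limit of the second difference of \<open>f\<close> over \<open>h\<^sup>2\<close>.\<close>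

lemma partial_deriv_commute:
  fixes f :: "real^'n::finite \<Rightarrow> real"
  assumes "open S" "y \<in> S" "smooth_on S f"
  shows "partial_deriv a (partial_deriv b f) y = partial_deriv b (partial_deriv a f) y"
proof (rule ccontr)
  define F where "F a b = partial_deriv a (partial_deriv b f)" for a b
  \<comment> \<open>Half the gap: a value within \<open>e\<close> of one mixed derivative at
    \<open>y\<close> cannot equal a value within \<open>e\<close> of the other.\<close>
  define e where "e = \<bar>F a b y - F b a y\<bar> / 2"
  assume "\<not> ?thesis"
  then have "e > 0" by (simp add: e_def F_def)
  have sm: "smooth_on S (F a b)" "smooth_on S (partial_deriv a f)" for a b
    unfolding F_def by (intro smooth_on_partial assms)+
  have "isCont (F a b) y" for a b
    using smooth_on_differentiable[OF sm(1) assms(1,2)] by (rule differentiable_imp_continuous_within)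
  then have "\<forall>\<^sub>F x in nhds y. dist (F a b x) (F a b y) < e" for a b
    using \<open>e > 0\<close> unfolding isCont_def tendsto_at_iff_tendsto_nhds by (rule tendstoD)
  then have "\<forall>\<^sub>F x in nhds y. dist (F a b x) (F a b y) < e \<and> dist (F b a x) (F b a y) < e \<and> x \<in> S"
    using assms by (intro eventually_conj eventually_nhds_in_open)
  then obtain d where "d > 0" and d: "\<And>x. dist x y < d \<Longrightarrow>
      dist (F a b x) (F a b y) < e \<and> dist (F b a x) (F b a y) < e \<and> x \<in> S"
    unfolding eventually_nhds_metric by auto
  \<comment> \<open>A third, since the points used below are at distance up to \<open>2 * h\<close>
    from \<open>y\<close>, which must stay below \<open>d\<close>.\<close>
  define h where "h = d / 3"
  have "h > 0" using \<open>d > 0\<close> by (simp add: h_def)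
  define p where "p s t a b = y + s *\<^sub>R axis a 1 + t *\<^sub>R axis b (1::real)" for s t a and b :: 'n
  have pd: "dist (p s t a b) y < d" if "0 \<le> s" "s \<le> h" "0 \<le> t" "t \<le> h" for s t a b
  proof -
    have "norm (s *\<^sub>R axis a (1::real) + t *\<^sub>R axis b (1::real) :: real^'n) \<le> s + t"
      using that by (intro norm_triangle_le) (auto simp: norm_axis_1)
    then show ?thesis using that \<open>d > 0\<close> by (auto simp: p_def dist_norm h_def)
  qed
  have pS: "p s t a b \<in> S" if "0 \<le> s" "s \<le> h" "0 \<le> t" "t \<le> h" for s t a b
    using d[OF pd[OF that]] by blast
  have deriv: "((\<lambda>s. g (p s t a b)) has_real_derivative partial_deriv a g (p s t a b)) (at s)"
    "((\<lambda>t. g (p s t a b)) has_real_derivative partial_deriv b g (p s t a b)) (at t)"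
    if "smooth_on S g" "0 \<le> s" "s \<le> h" "0 \<le> t" "t \<le> h" for g s t a b
  proof -
    have g: "g differentiable at (p s t a b)"
      using smooth_on_differentiable[OF that(1) assms(1) pS] that by blast
    have c: "((\<lambda>s. p s t a b) has_vector_derivative axis a 1) (at s)"
      "((\<lambda>t. p s t a b) has_vector_derivative axis b 1) (at t)"
      unfolding p_def by (auto intro!: derivative_eq_intros)
    show "((\<lambda>s. g (p s t a b)) has_real_derivative partial_deriv a g (p s t a b)) (at s)"
      "((\<lambda>t. g (p s t a b)) has_real_derivative partial_deriv b g (p s t a b)) (at t)"
      using partial_chain[of g "\<lambda>s. p s t a b", OF g c(1)] partial_chain[of g "\<lambda>t. p s t a b", OF g c(2)]
      by (simp_all add: axis_def if_distrib sum.delta cong: if_cong)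
  qed
  \<comment> \<open>The mean value theorem is used twice: in direction \<open>a\<close>, for the
    difference of \<open>f\<close> across a step along \<open>b\<close>, and then in direction
    \<open>b\<close>. The left side is symmetric in \<open>a\<close> and \<open>b\<close>, so
    exchanging them gives the other mixed derivative.\<close>
  have key: "\<exists>s t. 0 \<le> s \<and> s \<le> h \<and> 0 \<le> t \<and> t \<le> h \<and>
      f (p h h a b) - f (p 0 h a b) - f (p h 0 a b) + f y = h * h * F b a (p s t a b)" for a b
  proof -
    have "\<exists>s>0. s < h \<and> (f (p h h a b) - f (p h 0 a b)) - (f (p 0 h a b) - f (p 0 0 a b)) =
        (h - 0) * (partial_deriv a f (p s h a b) - partial_deriv a f (p s 0 a b))"
      using \<open>h > 0\<close> by (intro MVT2 DERIV_diff deriv assms) auto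
    then obtain s where s: "s > 0" "s < h" and 1: "f (p h h a b) - f (p h 0 a b) - (f (p 0 h a b) - f (p 0 0 a b)) =
        h * (partial_deriv a f (p s h a b) - partial_deriv a f (p s 0 a b))" by auto
    have "\<exists>t>0. t < h \<and> partial_deriv a f (p s h a b) - partial_deriv a f (p s 0 a b) = (h - 0) * F b a (p s t a b)"
      unfolding F_def using \<open>h > 0\<close> s by (intro MVT2 deriv sm) auto
    then obtain t where t: "t > 0" "t < h" and 2: "partial_deriv a f (p s h a b) - partial_deriv a f (p s 0 a b) = h * F b a (p s t a b)"
      by auto
    have "p 0 0 a b = y" by (simp add: p_def)
    with 1 2 s t show ?thesis
      by (intro exI[of _ s] exI[of _ t]) (simp add: algebra_simps)
  qed
  obtain s t where st: "0 \<le> s" "s \<le> h" "0 \<le> t" "t \<le> h"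
    "f (p h h a b) - f (p 0 h a b) - f (p h 0 a b) + f y = h * h * F b a (p s t a b)"
    using key by blast
  obtain s' t' where st': "0 \<le> s'" "s' \<le> h" "0 \<le> t'" "t' \<le> h"
    "f (p h h b a) - f (p 0 h b a) - f (p h 0 b a) + f y = h * h * F a b (p s' t' b a)"
    using key by blast
  have sw: "p s t b a = p t s a b" for s t by (simp add: p_def)
  have "h * h * F b a (p s t a b) = h * h * F a b (p s' t' b a)"
    using st(5) st'(5)[unfolded sw[of h h] sw[of 0 h] sw[of h 0]] by linarith
  then have "F b a (p s t a b) = F a b (p s' t' b a)" using \<open>h > 0\<close> by simp
  then show False
    using d[OF pd[OF st(1-4), of a b]] d[OF pd[OF st'(1-4), of b a]]
    by (auto simp: e_def dist_real_def abs_if split: if_splits)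
qed

section \<open>Frobenius theorem for flat linear connections\<close>

text \<open>The setting for \<open>du = \<omega> u\<close> on a ball about 0. \<open>flat\<close>
  equates the two mixed second derivatives that a solution with value \<open>w\<close> at
  \<open>x\<close> would have. The bound on \<open>M * r\<close> makes integration along rays a
  contraction by 1/4; \<open>r \<le> 1\<close> allows \<open>norm x\<close> to be dropped from a
  derivative estimate.\<close>

locale flat_ball =
  fixes \<omega> :: "'a::euclidean_space \<Rightarrow> 'a \<Rightarrow>\<^sub>L 'b::euclidean_space \<Rightarrow>\<^sub>L 'b"
    and \<omega>' :: "'a \<Rightarrow> 'a \<Rightarrow>\<^sub>L 'a \<Rightarrow>\<^sub>L 'b \<Rightarrow>\<^sub>L 'b" and r M :: real
  assumes r: "0 < r" "r \<le> 1" "4 * (M * r) \<le> 1"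
    and deriv_form: "\<And>x. x \<in> ball 0 r \<Longrightarrow> (\<omega> has_derivative \<omega>' x) (at x)"
    and continuous_form': "continuous_on (ball 0 r) \<omega>'"
    and bound_form: "\<And>x. x \<in> ball 0 r \<Longrightarrow> norm (\<omega> x) \<le> M"
    and bound_form': "\<And>x. x \<in> ball 0 r \<Longrightarrow> norm (\<omega>' x) \<le> M"
    and flat: "\<And>x h k w. x \<in> ball 0 r \<Longrightarrow>
      \<omega>' x h k w + \<omega> x k (\<omega> x h w) = \<omega>' x k h w + \<omega> x h (\<omega> x k w)"
begin

text \<open>A solution of \<open>du = \<omega> u\<close> with \<open>u 0 = c\<close> satisfies
  \<open>u x = c + transport u x\<close>, by the fundamental theorem of calculus along the ray from
  0 to \<open>x\<close>. The ray is scaled to the unit interval, so that differentiation in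
  \<open>x\<close> acts under an integral with fixed limits.\<close>

definition transport :: "('a \<Rightarrow> 'b) \<Rightarrow> 'a \<Rightarrow> 'b" where
  "transport u x = integral {0..1} (\<lambda>t. \<omega> (t *\<^sub>R x) x (u (t *\<^sub>R x)))"

text \<open>The three terms come from the three places where \<open>x\<close> occurs in the
  integrand of \<open>transport\<close>: the point at which the form is evaluated, the direction,
  and the argument of \<open>u\<close>.\<close>

definition transport_deriv_integrand :: "('a \<Rightarrow> 'b) \<Rightarrow> ('a \<Rightarrow> 'a \<Rightarrow>\<^sub>L 'b) \<Rightarrow> 'a \<Rightarrow> real \<Rightarrow> 'a \<Rightarrow>\<^sub>L 'b" where
  "transport_deriv_integrand u u' x t = Blinfun (\<lambda>h. t *\<^sub>R \<omega>' (t *\<^sub>R x) h x (u (t *\<^sub>R x))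
     + \<omega> (t *\<^sub>R x) h (u (t *\<^sub>R x)) + t *\<^sub>R \<omega> (t *\<^sub>R x) x (u' (t *\<^sub>R x) h))"

definition transport_deriv :: "('a \<Rightarrow> 'b) \<Rightarrow> ('a \<Rightarrow> 'a \<Rightarrow>\<^sub>L 'b) \<Rightarrow> 'a \<Rightarrow> 'a \<Rightarrow>\<^sub>L 'b" where
  "transport_deriv u u' x = integral {0..1} (transport_deriv_integrand u u' x)"

lemma scale_ball: "x \<in> ball 0 r \<Longrightarrow> 0 \<le> t \<Longrightarrow> t \<le> 1 \<Longrightarrow> t *\<^sub>R x \<in> ball (0::'a) r"
  by (simp add: mult_left_le_one_le order_le_less_trans[rotated])

lemma M_nonneg: "0 \<le> M"
  using bound_form[of 0] r norm_ge_zero order_trans by (metis centre_in_ball)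

lemma transport_deriv_integrand_apply:
  "blinfun_apply (transport_deriv_integrand u u' x t) h = t *\<^sub>R \<omega>' (t *\<^sub>R x) h x (u (t *\<^sub>R x))
     + \<omega> (t *\<^sub>R x) h (u (t *\<^sub>R x)) + t *\<^sub>R \<omega> (t *\<^sub>R x) x (u' (t *\<^sub>R x) h)"
  unfolding transport_deriv_integrand_def
  by (subst bounded_linear_Blinfun_apply)
    (auto intro!: linearI simp: linear_conv_bounded_linear[symmetric] blinfun.bilinear_simps algebra_simps)

lemma continuous_form: "continuous_on (ball 0 r) \<omega>"
  using deriv_form by (meson continuous_at_imp_continuous_on has_derivative_continuous)

lemma continuous_scale:
  assumes "continuous_on (ball (0::'a) r) f"
  shows "continuous_on (ball 0 r \<times> cbox 0 1) (\<lambda>p. f (snd p *\<^sub>R fst p))"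
  by (rule continuous_on_compose2[OF assms]) (auto intro!: continuous_intros scale_ball simp del: mem_ball)

lemma continuous_scale1:
  assumes "continuous_on (ball (0::'a) r) f" "x \<in> ball 0 r"
  shows "continuous_on {0..1} (\<lambda>t. f (t *\<^sub>R x))"
  by (rule continuous_on_compose2[OF assms(1)]) (use assms(2) in \<open>auto intro!: continuous_intros scale_ball simp del: mem_ball\<close>)

lemma continuous_transport_integrand:
  assumes "continuous_on (ball 0 r) u" "x \<in> ball 0 r"
  shows "continuous_on {0..1} (\<lambda>t. \<omega> (t *\<^sub>R x) x (u (t *\<^sub>R x)))"
  by (intro continuous_intros continuous_scale1 assms continuous_form)

lemma continuous_transport_deriv_integrand:
  assumes "continuous_on (ball 0 r) u" "continuous_on (ball 0 r) u'"
  shows "continuous_on (ball 0 r \<times> cbox 0 1) (\<lambda>(x, t). transport_deriv_integrand u u' x t)"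
  unfolding split_beta
  by (rule continuous_on_blinfun_componentwise, unfold transport_deriv_integrand_apply)
    (intro continuous_intros continuous_scale assms continuous_form continuous_form')

lemma continuous_transport_deriv_integrand1:
  assumes "continuous_on (ball 0 r) u" "continuous_on (ball 0 r) u'" "x \<in> ball 0 r"
  shows "continuous_on {0..1} (transport_deriv_integrand u u' x)"
  by (rule continuous_on_blinfun_componentwise, unfold transport_deriv_integrand_apply)
    (intro continuous_intros continuous_scale1 assms continuous_form continuous_form')

section \<open>Estimates and differentiation of the ray integral\<close>

lemma norm_transport_le:
  assumes "continuous_on (ball 0 r) u" "\<And>x. x \<in> ball 0 r \<Longrightarrow> norm (u x) \<le> a" "x \<in> ball 0 r"
  shows "norm (transport u x) \<le> a / 4"
proof -
  have 1: "norm (\<omega> (t *\<^sub>R x) x (u (t *\<^sub>R x))) \<le> a / 4" if "t \<in> {0..1}" for t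
  proof -
    have B: "t *\<^sub>R x \<in> ball 0 r" using that assms(3) scale_ball by simp
    have "norm (\<omega> (t *\<^sub>R x) x (u (t *\<^sub>R x))) \<le> norm (\<omega> (t *\<^sub>R x)) * norm x * norm (u (t *\<^sub>R x))"
      by (meson mult_right_mono norm_blinfun norm_ge_zero order_trans)
    also have "\<dots> \<le> M * r * a"
      using B assms(2,3) M_nonneg r bound_form by (intro mult_mono) auto
    also have "\<dots> \<le> 1 / 4 * a"
      using assms(2)[OF B] r by (intro mult_right_mono) (auto intro: order_trans[OF norm_ge_zero])
    finally show ?thesis by simp
  qed
  have "norm (transport u x) \<le> a / 4 * (1 - 0)"
    unfolding transport_def
    by (intro integral_bound continuous_transport_integrand assms 1) auto
  then show ?thesis by simp
qed

text \<open>Only one term contains \<open>u'\<close>, and there \<open>norm x\<close> supplies the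
  factor \<open>M * r \<le> 1/4\<close>. The other two terms involve \<open>u\<close> alone and cost
  \<open>M * a\<close> each.\<close>

lemma norm_transport_deriv_le:
  assumes "continuous_on (ball 0 r) u" "continuous_on (ball 0 r) u'"
    "\<And>x. x \<in> ball 0 r \<Longrightarrow> norm (u x) \<le> a" "\<And>x. x \<in> ball 0 r \<Longrightarrow> norm (u' x) \<le> b" "x \<in> ball 0 r"
  shows "norm (transport_deriv u u' x) \<le> 2 * M * a + b / 4"
proof -
  have a: "0 \<le> a" and b: "0 \<le> b"
    using assms(3,4)[OF assms(5)] norm_ge_zero order_trans by blast+
  have 1: "norm (transport_deriv_integrand u u' x t) \<le> 2 * M * a + b / 4" if "t \<in> {0..1}" for t
  proof (rule norm_blinfun_bound)
    show "0 \<le> 2 * M * a + b / 4" using a b M_nonneg by simp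
    fix h
    have B: "t *\<^sub>R x \<in> ball 0 r" using that assms(5) scale_ball by simp
    have "norm (\<omega>' (t *\<^sub>R x) h x (u (t *\<^sub>R x))) \<le> norm (\<omega>' (t *\<^sub>R x)) * norm h * norm x * norm (u (t *\<^sub>R x))"
      by (meson mult_right_mono norm_blinfun norm_ge_zero order_trans)
    also have "\<dots> \<le> M * norm h * 1 * a"
      using B assms(3,5) M_nonneg r bound_form' a by (intro mult_mono) auto
    finally have 1: "norm (\<omega>' (t *\<^sub>R x) h x (u (t *\<^sub>R x))) \<le> M * norm h * a" by simp
    have "norm (\<omega> (t *\<^sub>R x) h (u (t *\<^sub>R x))) \<le> norm (\<omega> (t *\<^sub>R x)) * norm h * norm (u (t *\<^sub>R x))"
      by (meson mult_right_mono norm_blinfun norm_ge_zero order_trans)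
    also have "\<dots> \<le> M * norm h * a"
      using B assms(3,5) M_nonneg bound_form a by (intro mult_mono) auto
    finally have 2: "norm (\<omega> (t *\<^sub>R x) h (u (t *\<^sub>R x))) \<le> M * norm h * a" .
    have "norm (\<omega> (t *\<^sub>R x) x (u' (t *\<^sub>R x) h)) \<le> norm (\<omega> (t *\<^sub>R x)) * norm x * (norm (u' (t *\<^sub>R x)) * norm h)"
      by (meson mult_mono norm_blinfun norm_ge_zero order_trans mult_nonneg_nonneg)
    also have "\<dots> \<le> (M * r) * (b * norm h)"
      using B assms(4,5) M_nonneg bound_form b r by (intro mult_mono) auto
    also have "\<dots> \<le> 1 / 4 * (b * norm h)"
      using r b by (intro mult_right_mono) auto
    finally have 3: "norm (\<omega> (t *\<^sub>R x) x (u' (t *\<^sub>R x) h)) \<le> b / 4 * norm h" by simp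
    have t: "norm (t *\<^sub>R z) \<le> norm z" for z :: 'b
      using that by (simp add: mult_left_le_one_le)
    have "norm (transport_deriv_integrand u u' x t h) \<le> M * norm h * a + M * norm h * a + b / 4 * norm h"
      unfolding transport_deriv_integrand_apply
      by (intro norm_triangle_le add_mono order_trans[OF t] 1 2 3)
    then show "norm (transport_deriv_integrand u u' x t h) \<le> (2 * M * a + b / 4) * norm h"
      by (simp add: algebra_simps)
  qed
  have "norm (transport_deriv u u' x) \<le> (2 * M * a + b / 4) * (1 - 0)"
    unfolding transport_deriv_def by (intro integral_bound continuous_transport_deriv_integrand1 assms 1) auto
  then show ?thesis by simp
qed

lemma continuous_transport_deriv:
  assumes "continuous_on (ball 0 r) u" "continuous_on (ball 0 r) u'"
  shows "continuous_on (ball 0 r) (transport_deriv u u')"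
  using integral_continuous_on_param[OF continuous_transport_deriv_integrand[OF assms]]
  unfolding transport_deriv_def by simp

lemma has_derivative_transport:
  fixes u' :: "'a \<Rightarrow> 'a \<Rightarrow>\<^sub>L 'b"
  assumes u: "\<And>x. x \<in> ball 0 r \<Longrightarrow> (u has_derivative u' x) (at x)" and u': "continuous_on (ball 0 r) u'"
    and x: "x \<in> ball 0 r"
  shows "(transport u has_derivative transport_deriv u u' x) (at x)"
proof -
  have cu: "continuous_on (ball 0 r) u"
    using u by (meson continuous_at_imp_continuous_on has_derivative_continuous)
  have "((\<lambda>x. \<omega> (t *\<^sub>R x) x (u (t *\<^sub>R x))) has_derivative transport_deriv_integrand u u' x t) (at x within ball 0 r)"
    if "x \<in> ball 0 r" "t \<in> cbox 0 1" for x t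
  proof -
    have B: "t *\<^sub>R x \<in> ball 0 r" using that scale_ball by simp
    have s: "((\<lambda>x. t *\<^sub>R x) has_derivative (\<lambda>h. t *\<^sub>R h)) (at x)" by (auto intro!: derivative_eq_intros)
    have 1: "((\<lambda>x. \<omega> (t *\<^sub>R x)) has_derivative (\<lambda>h. \<omega>' (t *\<^sub>R x) (t *\<^sub>R h))) (at x)"
      by (rule has_derivative_compose[OF s deriv_form[OF B]])
    have 2: "((\<lambda>x. u (t *\<^sub>R x)) has_derivative (\<lambda>h. u' (t *\<^sub>R x) (t *\<^sub>R h))) (at x)"
      by (rule has_derivative_compose[OF s u[OF B]])
    have "((\<lambda>x. \<omega> (t *\<^sub>R x) x (u (t *\<^sub>R x))) has_derivative
      (\<lambda>h. \<omega> (t *\<^sub>R x) x (u' (t *\<^sub>R x) (t *\<^sub>R h)) + (\<omega> (t *\<^sub>R x) h + \<omega>' (t *\<^sub>R x) (t *\<^sub>R h) x) (u (t *\<^sub>R x)))) (at x)"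
      by (rule blinfun.FDERIV[OF blinfun.FDERIV[OF 1 has_derivative_ident] 2])
    then have "((\<lambda>x. \<omega> (t *\<^sub>R x) x (u (t *\<^sub>R x))) has_derivative transport_deriv_integrand u u' x t) (at x)"
      by (rule has_derivative_eq_rhs) (simp add: fun_eq_iff transport_deriv_integrand_apply blinfun.bilinear_simps algebra_simps)
    then show ?thesis by (rule has_derivative_at_withinI)
  qed
  then have "((\<lambda>x. integral (cbox 0 1) (\<lambda>t. \<omega> (t *\<^sub>R x) x (u (t *\<^sub>R x)))) has_derivative
      integral (cbox 0 1) (transport_deriv_integrand u u' x)) (at x within ball 0 r)"
    by (rule leibniz_rule[OF _ _ continuous_transport_deriv_integrand[OF cu u'] x convex_ball])
      (auto intro!: integrable_continuous_real continuous_transport_integrand cu simp del: mem_ball)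
  then show ?thesis
    using x by (simp add: transport_def[abs_def] transport_deriv_def at_within_open[OF x open_ball])
qed

text \<open>The terms of the Neumann series for \<open>u = c + transport u\<close>, that is, the
  iterates of \<open>transport\<close> on the constant \<open>c\<close>, and not the partial sums.
  Each carries its derivative along, because the derivative of the next term is computed from
  both.\<close>

primrec picard :: "'b \<Rightarrow> nat \<Rightarrow> ('a \<Rightarrow> 'b) \<times> ('a \<Rightarrow> 'a \<Rightarrow>\<^sub>L 'b)" where
  "picard c 0 = (\<lambda>x. c, \<lambda>x. 0)"
| "picard c (Suc n) = (transport (fst (picard c n)), transport_deriv (fst (picard c n)) (snd (picard c n)))"

lemma picard_deriv:
  "x \<in> ball 0 r \<Longrightarrow> (fst (picard c n) has_derivative snd (picard c n) x) (at x)"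
  "continuous_on (ball 0 r) (snd (picard c n))"
proof (induction n arbitrary: x)
  case 0
  { case 1 show ?case by simp }
  { case 2 show ?case by simp }
next
  case (Suc n)
  { case 1 show ?case using has_derivative_transport[OF Suc 1] by simp }
  { case 2
    have "continuous_on (ball 0 r) (fst (picard c n))"
      using Suc(1) by (meson continuous_at_imp_continuous_on has_derivative_continuous)
    then show ?case using continuous_transport_deriv Suc(2) by simp }
qed

lemma continuous_picard: "continuous_on (ball 0 r) (fst (picard c n))"
  using picard_deriv(1) by (meson continuous_at_imp_continuous_on has_derivative_continuous)

text \<open>The ratio is 1/2 although \<open>transport\<close> contracts by 1/4, which makes room
  for the summand \<open>2 * M * a\<close> in the derivative bound. The factor 8 closes the
  induction: \<open>2 * M + 8 * M / 4 = 8 * M / 2\<close>.\<close>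

lemma picard_bound:
  "x \<in> ball 0 r \<Longrightarrow> norm (fst (picard c n) x) \<le> norm c * (1/2)^n"
  "x \<in> ball 0 r \<Longrightarrow> norm (snd (picard c n) x) \<le> 8 * M * norm c * (1/2)^n"
proof (induction n arbitrary: x)
  case 0
  { case 1 show ?case by simp }
  { case 2 show ?case using M_nonneg by simp }
next
  case (Suc n)
  { case 1
    have "norm (fst (picard c (Suc n)) x) \<le> (norm c * (1/2)^n) / 4"
      using norm_transport_le[OF continuous_picard Suc(1) 1] by simp
    also have "\<dots> \<le> norm c * (1/2)^Suc n" by simp
    finally show ?case . }
  { case 2
    show ?case using norm_transport_deriv_le[OF continuous_picard picard_deriv(2) Suc 2] by simp }
qed

lemma summable_geometric_half: "summable (\<lambda>n. C * (1/2)^n :: real)"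
  by (intro summable_mult summable_geometric) simp

text \<open>\<open>u\<close> is the sum of the Neumann series. The derivatives of its terms are
  dominated by a geometric series, so they converge uniformly; this permits termwise differentiation
  and makes \<open>u'\<close> continuous.\<close>

lemma transport_fixed_point:
  obtains u u' where "\<And>x. x \<in> ball 0 r \<Longrightarrow> (u has_derivative blinfun_apply (u' x)) (at x)"
    "continuous_on (ball 0 r) u'" "\<And>x. x \<in> ball 0 r \<Longrightarrow> u x = c + transport u x"
proof -
  define e where "e n = fst (picard c n)" for n
  define e' where "e' n = snd (picard c n)" for n
  define u' where "u' x = (\<Sum>n. e' n x)" for x
  have ul: "uniform_limit (ball 0 r) (\<lambda>n x. \<Sum>i<n. e' i x) u' sequentially"
    unfolding u'_def e'_def by (rule Weierstrass_m_test[OF picard_bound(2) summable_geometric_half])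
  have cont: "continuous_on (ball 0 r) u'"
    by (rule uniform_limit_theorem[OF _ ul])
      (auto simp: e'_def intro!: always_eventually continuous_on_sum picard_deriv(2))
  have "\<exists>g. \<forall>x\<in>ball 0 r. (\<lambda>n. e n x) sums g x \<and> (g has_derivative blinfun_apply (u' x)) (at x within ball 0 r)"
  proof (rule has_derivative_series)
    show "convex (ball (0::'a) r)" by (rule convex_ball)
    show "(0::'a) \<in> ball 0 r" using r by simp
    then show "(\<lambda>n. e n 0) sums suminf (\<lambda>n. e n 0)"
      unfolding e_def using summable_comparison_test'[OF summable_geometric_half picard_bound(1)]
      by (auto intro: summable_sums)
    show "(e n has_derivative blinfun_apply (e' n x)) (at x within ball 0 r)" if "x \<in> ball 0 r" for n x
      unfolding e_def e'_def using picard_deriv(1)[OF that] by (rule has_derivative_at_withinI)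
    show "\<forall>\<^sub>F n in sequentially. \<forall>x\<in>ball 0 r. \<forall>h. norm ((\<Sum>i<n. e' i x h) - u' x h) \<le> \<epsilon> * norm h"
      if "\<epsilon> > 0" for \<epsilon>
      using uniform_limitD[OF ul that]
    proof eventually_elim
      case (elim n)
      have "norm ((\<Sum>i<n. e' i x h) - u' x h) \<le> \<epsilon> * norm h" if "x \<in> ball 0 r" for x h
      proof -
        have "norm ((\<Sum>i<n. e' i x h) - u' x h) = norm (((\<Sum>i<n. e' i x) - u' x) h)"
          by (simp add: blinfun.bilinear_simps)
        also have "\<dots> \<le> norm ((\<Sum>i<n. e' i x) - u' x) * norm h" by (rule norm_blinfun)
        also have "\<dots> \<le> \<epsilon> * norm h"
          using elim that by (intro mult_right_mono) (auto simp: dist_norm less_imp_le simp del: mem_ball)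
        finally show ?thesis .
      qed
      then show ?case by blast
    qed
  qed
  then obtain u where u: "\<And>x. x \<in> ball 0 r \<Longrightarrow> (\<lambda>n. e n x) sums u x"
    and du: "\<And>x. x \<in> ball 0 r \<Longrightarrow> (u has_derivative u' x) (at x within ball 0 r)" by blast
  have "u x = c + transport u x" if x: "x \<in> ball 0 r" for x
  proof -
    define F where "F n t = \<omega> (t *\<^sub>R x) x (e n (t *\<^sub>R x))" for n t
    have B: "t *\<^sub>R x \<in> ball 0 r" if "t \<in> {0..1}" for t using that x scale_ball by simp
    have Fb: "norm (F n t) \<le> M * r * norm c * (1/2)^n" if "t \<in> {0..1}" for n t
    proof -
      have "norm (F n t) \<le> norm (\<omega> (t *\<^sub>R x)) * norm x * norm (e n (t *\<^sub>R x))"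
        unfolding F_def by (meson mult_right_mono norm_blinfun norm_ge_zero order_trans)
      also have "\<dots> \<le> M * r * (norm c * (1/2)^n)"
        using B[OF that] x M_nonneg r bound_form picard_bound(1)[OF B[OF that]]
        by (intro mult_mono) (auto simp: e_def)
      finally show ?thesis by (simp add: mult.assoc)
    qed
    have Fsum: "(\<Sum>n. F n t) = \<omega> (t *\<^sub>R x) x (u (t *\<^sub>R x))" if "t \<in> {0..1}" for t
      unfolding F_def using bounded_linear.sums[OF blinfun.bounded_linear_right u[OF B[OF that]]]
      by (rule sums_unique[symmetric])
    \<comment> \<open>Uniform convergence along the ray lets the sum pass through the integral, so
      \<open>transport\<close> of the sum is the sum of the shifted terms.\<close>
    have "uniform_limit {0..1} (\<lambda>n t. \<Sum>i<n. F i t) (\<lambda>t. \<Sum>i. F i t) sequentially"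
      by (rule Weierstrass_m_test[OF Fb summable_geometric_half])
    then obtain I J where I: "\<And>n. ((\<lambda>t. \<Sum>i<n. F i t) has_integral I n) {0..1}"
      and J: "((\<lambda>t. \<Sum>i. F i t) has_integral J) {0..1}" and IJ: "I \<longlonglongrightarrow> J"
      by (rule uniform_limit_integral)
        (auto simp: F_def e_def intro!: continuous_on_sum continuous_transport_integrand[OF continuous_picard x])
    have "J = transport u x"
      unfolding transport_def using J Fsum by (metis (no_types, lifting) has_integral_cong integral_unique)
    moreover have "I = (\<lambda>n. \<Sum>i<n. e (Suc i) x)"
    proof
      fix n
      have "(F i has_integral e (Suc i) x) {0..1}" for i
        unfolding e_def F_def
        by (simp add: transport_def) (intro integrable_integral integrable_continuous_real continuous_transport_integrand continuous_picard x)
      then have "((\<lambda>t. \<Sum>i<n. F i t) has_integral (\<Sum>i<n. e (Suc i) x)) {0..1}"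
        by (intro has_integral_sum) auto
      with I show "I n = (\<Sum>i<n. e (Suc i) x)" by (rule has_integral_unique)
    qed
    \<comment> \<open>The shift drops the term \<open>e 0 = c\<close>; this is the summand
      \<open>c\<close> of the fixed point equation.\<close>
    moreover have "(\<lambda>n. e (Suc n) x) sums (u x - c)"
      using u[OF x] by (subst sums_Suc_iff) (simp add: e_def)
    ultimately have "transport u x = u x - c"
      using LIMSEQ_unique[OF IJ, of "u x - c"] by (simp add: sums_def)
    then show ?thesis by simp
  qed
  moreover have "(u has_derivative u' x) (at x)" if "x \<in> ball 0 r" for x
    using du[OF that] by (simp add: at_within_open[OF that open_ball])
  ultimately show ?thesis using cont that by blast
qed

text \<open>The defect \<open>v h = du h - \<omega> h u\<close> of the radially transported \<open>u\<close> satisfies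
  \<open>v h x = \<integral> t (\<omega> x (v h) - \<omega> h (v x)) dt\<close> along the ray by flatness. Taking \<open>h = x\<close> shows that it
  vanishes radially, and then \<open>\<bar>v h\<bar> \<le> \<bar>v h\<bar> / 4\<close> at a maximum on a smaller closed ball.\<close>

lemma parallel_section:
  obtains u where "u 0 = c" "\<And>x. x \<in> ball 0 r \<Longrightarrow> (u has_derivative (\<lambda>h. \<omega> x h (u x))) (at x)"
proof -
  obtain u u' where du: "\<And>x. x \<in> ball 0 r \<Longrightarrow> (u has_derivative blinfun_apply (u' x)) (at x)"
    and cu': "continuous_on (ball 0 r) u'" and fp: "\<And>x. x \<in> ball 0 r \<Longrightarrow> u x = c + transport u x"
    by (rule transport_fixed_point[of c]) (rule that)
  have cu: "continuous_on (ball 0 r) u"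
    using du by (meson continuous_at_imp_continuous_on has_derivative_continuous)
  \<comment> \<open>Differentiating the fixed point equation gives \<open>u'\<close> an integral
    equation of its own, from which the defect can be computed.\<close>
  have u'_eq: "u' x = transport_deriv u u' x" if x: "x \<in> ball 0 r" for x
  proof -
    have "((\<lambda>x. c + transport u x) has_derivative transport_deriv u u' x) (at x)"
      using has_derivative_add[OF has_derivative_const has_derivative_transport[OF du cu' x], of c] by simp
    then have "(u has_derivative transport_deriv u u' x) (at x)"
      by (rule has_derivative_transform_within_open[OF _ open_ball x]) (simp add: fp[symmetric])
    from has_derivative_unique[OF this du[OF x]] show ?thesis by (simp add: blinfun_apply_inject)
  qed
  define v where "v h x = u' x h - \<omega> x h (u x)" for h x
  have v_int: "((\<lambda>t. t *\<^sub>R (\<omega> (t *\<^sub>R x) x (v h (t *\<^sub>R x)) - \<omega> (t *\<^sub>R x) h (v x (t *\<^sub>R x)))) has_integral v h x) {0..1}"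
    if x: "x \<in> ball 0 r" for x h
  proof -
    have B: "t *\<^sub>R x \<in> ball 0 r" if "t \<in> {0..1}" for t using that x scale_ball by simp
    \<comment> \<open>\<open>G\<close> is the derivative of
      \<open>t \<mapsto> t \<omega> (t x) h (u (t x))\<close>. It turns the subtracted term
      \<open>\<omega> x h (u x)\<close> into an integral along the ray, so that the whole defect is
      one integral.\<close>
    define G where "G t = \<omega> (t *\<^sub>R x) h (u (t *\<^sub>R x))
      + t *\<^sub>R (\<omega>' (t *\<^sub>R x) x h (u (t *\<^sub>R x)) + \<omega> (t *\<^sub>R x) h (u' (t *\<^sub>R x) x))" for t
    have "(G has_integral (1 *\<^sub>R \<omega> (1 *\<^sub>R x) h (u (1 *\<^sub>R x)) - 0 *\<^sub>R \<omega> (0 *\<^sub>R x) h (u (0 *\<^sub>R x)))) {0..1}"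
    proof (rule fundamental_theorem_of_calculus)
      fix t :: real assume t: "t \<in> {0..1}"
      have s: "((\<lambda>t. t *\<^sub>R x) has_derivative (\<lambda>s. s *\<^sub>R x)) (at t)" by (auto intro!: derivative_eq_intros)
      have 1: "((\<lambda>t. \<omega> (t *\<^sub>R x)) has_derivative (\<lambda>s. \<omega>' (t *\<^sub>R x) (s *\<^sub>R x))) (at t)"
        by (rule has_derivative_compose[OF s deriv_form[OF B[OF t]]])
      have 2: "((\<lambda>t. u (t *\<^sub>R x)) has_derivative (\<lambda>s. u' (t *\<^sub>R x) (s *\<^sub>R x))) (at t)"
        by (rule has_derivative_compose[OF s du[OF B[OF t]]])
      have "((\<lambda>t. t *\<^sub>R \<omega> (t *\<^sub>R x) h (u (t *\<^sub>R x))) has_derivative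
        (\<lambda>s. t *\<^sub>R (\<omega> (t *\<^sub>R x) h (u' (t *\<^sub>R x) (s *\<^sub>R x)) + (\<omega> (t *\<^sub>R x) 0 + \<omega>' (t *\<^sub>R x) (s *\<^sub>R x) h) (u (t *\<^sub>R x)))
           + s *\<^sub>R \<omega> (t *\<^sub>R x) h (u (t *\<^sub>R x)))) (at t)"
        by (rule has_derivative_scaleR[OF has_derivative_ident blinfun.FDERIV[OF blinfun.FDERIV[OF 1 has_derivative_const] 2]])
      then have "((\<lambda>t. t *\<^sub>R \<omega> (t *\<^sub>R x) h (u (t *\<^sub>R x))) has_derivative (\<lambda>s. s *\<^sub>R G t)) (at t)"
        by (rule has_derivative_eq_rhs) (simp add: fun_eq_iff G_def blinfun.bilinear_simps algebra_simps)
      then show "((\<lambda>t. t *\<^sub>R \<omega> (t *\<^sub>R x) h (u (t *\<^sub>R x))) has_vector_derivative G t) (at t within {0..1})"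
        unfolding has_vector_derivative_def by (rule has_derivative_at_withinI)
    qed simp
    then have G: "(G has_integral \<omega> x h (u x)) {0..1}" by simp
    have "transport_deriv_integrand u u' x integrable_on {0..1}"
      by (intro integrable_continuous_real continuous_transport_deriv_integrand1 cu cu' x)
    from has_integral_linear[OF integrable_integral[OF this] blinfun.bounded_linear_left[of h]]
    have "((\<lambda>t. transport_deriv_integrand u u' x t h) has_integral u' x h) {0..1}"
      by (simp add: u'_eq[OF x] transport_deriv_def o_def)
    from has_integral_diff[OF this G]
    have "((\<lambda>t. transport_deriv_integrand u u' x t h - G t) has_integral v h x) {0..1}"
      by (simp add: v_def)
    moreover have "transport_deriv_integrand u u' x t h - G t =
      t *\<^sub>R (\<omega> (t *\<^sub>R x) x (v h (t *\<^sub>R x)) - \<omega> (t *\<^sub>R x) h (v x (t *\<^sub>R x)))" if "t \<in> {0..1}" for t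
    proof -
      let ?w = "u (t *\<^sub>R x)" and ?\<omega> = "\<omega> (t *\<^sub>R x)"
      have f: "\<omega>' (t *\<^sub>R x) h x ?w = \<omega>' (t *\<^sub>R x) x h ?w + ?\<omega> h (?\<omega> x ?w) - ?\<omega> x (?\<omega> h ?w)"
        using flat[OF B[OF that], of h x ?w] by (simp add: algebra_simps)
      show ?thesis
        unfolding transport_deriv_integrand_apply G_def v_def f
        by (simp add: blinfun.bilinear_simps algebra_simps)
    qed
    ultimately show ?thesis by (rule has_integral_eq[rotated])
  qed
  have vx0: "v x x = 0" if "x \<in> ball 0 r" for x
    using has_integral_unique[OF v_int[OF that, of x]] has_integral_0 by simp
  \<comment> \<open>\<open>v\<close> is linear in its direction, so the factor \<open>t\<close>
    moves into it and the radial case applies at \<open>t x\<close>. The factor is kept because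
    \<open>v x\<close> is not yet known to vanish at 0.\<close>
  have vx: "t *\<^sub>R v x (t *\<^sub>R x) = 0" if "x \<in> ball 0 r" "t \<in> {0..1}" for x t
  proof -
    have "t *\<^sub>R v x (t *\<^sub>R x) = v (t *\<^sub>R x) (t *\<^sub>R x)"
      by (simp add: v_def blinfun.bilinear_simps algebra_simps)
    also have "\<dots> = 0" using that by (intro vx0 scale_ball) auto
    finally show ?thesis .
  qed
  have v0: "v h y = 0" if y: "y \<in> ball 0 r" for h y
  proof -
    have cv: "continuous_on (ball 0 r) (\<lambda>x. norm (v h x))"
      unfolding v_def by (intro continuous_intros cu cu' continuous_form)
    have sub: "cball (0::'a) (norm y) \<subseteq> ball 0 r" using y by auto
    have "cball (0::'a) (norm y) \<noteq> {}" by simp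
    then obtain x where x: "x \<in> cball 0 (norm y)"
      and max: "\<And>z. z \<in> cball 0 (norm y) \<Longrightarrow> norm (v h z) \<le> norm (v h x)"
      using continuous_attains_sup[OF compact_cball _ continuous_on_subset[OF cv sub]] by blast
    have xB: "x \<in> ball 0 r" using x sub by blast
    have B: "t *\<^sub>R x \<in> cball 0 (norm y)" if "t \<in> {0..1}" for t
      using that x by (simp add: mult_le_one mult_left_le_one_le order_trans[rotated])
    have I: "((\<lambda>t. t *\<^sub>R \<omega> (t *\<^sub>R x) x (v h (t *\<^sub>R x))) has_integral v h x) {0..1}"
      using v_int[OF xB, of h]
    proof (rule has_integral_eq[rotated])
      fix t :: real assume "t \<in> {0..1}"
      then have "t *\<^sub>R v x (t *\<^sub>R x) = 0" by (intro vx xB) simp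
      then have "t = 0 \<or> v x (t *\<^sub>R x) = 0" by simp
      then show "t *\<^sub>R (\<omega> (t *\<^sub>R x) x (v h (t *\<^sub>R x)) - \<omega> (t *\<^sub>R x) h (v x (t *\<^sub>R x)))
         = t *\<^sub>R \<omega> (t *\<^sub>R x) x (v h (t *\<^sub>R x))" by (auto simp: blinfun.bilinear_simps)
    qed
    have "norm (t *\<^sub>R \<omega> (t *\<^sub>R x) x (v h (t *\<^sub>R x))) \<le> 1 / 4 * norm (v h x)" if "t \<in> cbox 0 1" for t
    proof -
      have t: "t \<in> {0..1}" using that by simp
      have "norm (t *\<^sub>R \<omega> (t *\<^sub>R x) x (v h (t *\<^sub>R x))) \<le> norm (\<omega> (t *\<^sub>R x) x (v h (t *\<^sub>R x)))"
        using t by (simp add: mult_left_le_one_le)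
      also have "\<dots> \<le> norm (\<omega> (t *\<^sub>R x)) * norm x * norm (v h (t *\<^sub>R x))"
        by (meson mult_right_mono norm_blinfun norm_ge_zero order_trans)
      also have "\<dots> \<le> M * r * norm (v h x)"
        using B[OF t] sub xB M_nonneg r bound_form max[OF B[OF t]] by (intro mult_mono) auto
      also have "\<dots> \<le> 1 / 4 * norm (v h x)" using r by (intro mult_right_mono) auto
      finally show ?thesis .
    qed
    from has_integral_bound[OF _ I[folded box_real(2)] this] have "norm (v h x) \<le> 1 / 4 * norm (v h x)" by simp
    then have "norm (v h x) = 0" by simp
    with max[of y] show ?thesis by simp
  qed
  have "(u has_derivative (\<lambda>h. \<omega> x h (u x))) (at x)" if "x \<in> ball 0 r" for x
    using du[OF that] by (rule has_derivative_eq_rhs) (use v0[OF that] in \<open>auto simp: v_def\<close>)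
  moreover have "u 0 = c" using fp[of 0] r by (simp add: transport_def blinfun.bilinear_simps)
  ultimately show ?thesis using that by blast
qed

end

text \<open>The radius is fixed before the initial value: by linearity the smallness condition
  involves only bounds for \<open>\<omega>\<close> and its derivative on a compact ball. Solutions
  with different initial values thus share a ball and can be components of one map.\<close>

theorem frobenius_linear:
  fixes \<omega> :: "'a::euclidean_space \<Rightarrow> 'a \<Rightarrow>\<^sub>L 'b::euclidean_space \<Rightarrow>\<^sub>L 'b"
    and \<omega>' :: "'a \<Rightarrow> 'a \<Rightarrow>\<^sub>L 'a \<Rightarrow>\<^sub>L 'b \<Rightarrow>\<^sub>L 'b"
  assumes "open S" "y0 \<in> S" and d: "\<And>x. x \<in> S \<Longrightarrow> (\<omega> has_derivative \<omega>' x) (at x)"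
    and c: "continuous_on S \<omega>'"
    and flat: "\<And>x h k w. x \<in> S \<Longrightarrow>
      \<omega>' x h k w + \<omega> x k (\<omega> x h w) = \<omega>' x k h w + \<omega> x h (\<omega> x k w)"
  obtains r where "r > 0" "ball y0 r \<subseteq> S"
    "\<And>c. \<exists>u. u y0 = c \<and> (\<forall>x\<in>ball y0 r. (u has_derivative (\<lambda>h. \<omega> x h (u x))) (at x))"
proof -
  obtain R where "R > 0" and R: "cball y0 R \<subseteq> S" using assms(1,2) open_contains_cball by blast
  have c\<omega>: "continuous_on S \<omega>" using d by (meson continuous_at_imp_continuous_on has_derivative_continuous)
  have "bounded (\<omega> ` cball y0 R)" "bounded (\<omega>' ` cball y0 R)"
    using c c\<omega> R by (auto intro!: compact_imp_bounded compact_continuous_image intro: continuous_on_subset)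
  then obtain M1 M2 where M: "\<And>x. x \<in> cball y0 R \<Longrightarrow> norm (\<omega> x) \<le> M1" "\<And>x. x \<in> cball y0 R \<Longrightarrow> norm (\<omega>' x) \<le> M2"
    unfolding bounded_iff by blast
  define M where "M = max 1 (max M1 M2)"
  define r where "r = min R (min 1 (1 / (4 * M)))"
  have "M > 0" by (simp add: M_def)
  then have r_le: "0 < r" "r \<le> 1" "r \<le> R" "r \<le> 1 / (4 * M)" using \<open>R > 0\<close> by (auto simp: r_def)
  have rS: "x \<in> ball 0 r \<Longrightarrow> y0 + x \<in> cball y0 R" for x using r_le by (simp add: dist_norm)
  interpret flat_ball "\<lambda>x. \<omega> (y0 + x)" "\<lambda>x. \<omega>' (y0 + x)" r M
  proof
    show "0 < r" "r \<le> 1" by fact+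
    show "4 * (M * r) \<le> 1" using r_le(4) \<open>M > 0\<close> by (simp add: field_simps)
    fix x :: 'a assume x: "x \<in> ball 0 r"
    have "((\<lambda>x. y0 + x) has_derivative (\<lambda>h. h)) (at x)" by (auto intro!: derivative_eq_intros)
    then show "((\<lambda>x. \<omega> (y0 + x)) has_derivative \<omega>' (y0 + x)) (at x)"
      by (rule has_derivative_compose) (use rS[OF x] R in \<open>blast intro: d\<close>)
    show "norm (\<omega> (y0 + x)) \<le> M" "norm (\<omega>' (y0 + x)) \<le> M"
      using M[OF rS[OF x]] by (auto simp: M_def)
    show "\<omega>' (y0 + x) h k w + \<omega> (y0 + x) k (\<omega> (y0 + x) h w) = \<omega>' (y0 + x) k h w + \<omega> (y0 + x) h (\<omega> (y0 + x) k w)" for h k w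
      using flat rS[OF x] R by blast
  next
    show "continuous_on (ball 0 r) (\<lambda>x. \<omega>' (y0 + x))"
    proof (rule continuous_on_compose2[OF c])
      show "(+) y0 ` ball 0 r \<subseteq> S" using rS R by blast
    qed (intro continuous_intros)
  qed
  have "\<exists>u. u y0 = c \<and> (\<forall>x\<in>ball y0 r. (u has_derivative (\<lambda>h. \<omega> x h (u x))) (at x))" for c
  proof -
    obtain u where u: "u 0 = c" "\<And>x. x \<in> ball 0 r \<Longrightarrow> (u has_derivative (\<lambda>h. \<omega> (y0 + x) h (u x))) (at x)"
      by (rule parallel_section[of c]) (rule that)
    have "((\<lambda>x. u (x - y0)) has_derivative (\<lambda>h. \<omega> x h (u (x - y0)))) (at x)" if "x \<in> ball y0 r" for x
    proof -
      have "((\<lambda>x. x - y0) has_derivative (\<lambda>h. h)) (at x)" by (auto intro!: derivative_eq_intros)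
      from has_derivative_compose[OF this u(2)] show ?thesis using that by (simp add: dist_norm norm_minus_commute)
    qed
    with u(1) show ?thesis by (intro exI[of _ "\<lambda>x. u (x - y0)"]) simp
  qed
  moreover have "ball y0 r \<subseteq> S"
    using R subset_cball[OF r_le(3), of y0] ball_subset_cball[of y0 r] by blast
  ultimately show ?thesis using r_le(1) that by blast
qed

section \<open>Diffusion form and the Hessian equation\<close>

lemma linear_Lambda_coords:
  fixes A :: "real^'n^'n::finite"
  shows "linear (inv sym_form \<circ> Lambda A \<circ> sym_form)"
proof -
  have "inv sym_form (v + w) = inv sym_form v + inv sym_form w" "inv sym_form (r *\<^sub>R v) = r *\<^sub>R inv sym_form v"
    if "v \<in> sym_forms" "w \<in> sym_forms" for v w :: "real^'n^'n" and r
    using that unfolding range_sym_form[symmetric]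
    by (auto simp: sym_form_inj linear_add[OF sym_form_linear, symmetric] linear_cmul[OF sym_form_linear, symmetric])
  note inv = this(1) this(2)[OF _ Lambda_mem]
  show ?thesis
    by (intro linearI) (simp_all add: inv linear_add[OF sym_form_linear] linear_cmul[OF sym_form_linear]
      linear_add[OF Lambda_linear] linear_cmul[OF Lambda_linear] Lambda_mem)
qed

lemma inv_sym_form_component:
  fixes w :: "real^'n^'n::finite"
  assumes "w \<in> sym_forms"
  shows "inv sym_form w $ Upair i j = w $ i $ j"
proof -
  have "sym_form (inv sym_form w) = w" using assms by (simp add: f_inv_into_f range_sym_form)
  then show ?thesis by (metis sym_form_def vec_lambda_beta)
qed

text \<open>\<open>D\<close> is an inverse chosen pointwise. In coordinates indexed by unordered
  pairs, its value on a fixed form solves a linear system whose determinant is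
  \<open>det_Lambda_sym\<close>, so Cramer's rule applies.\<close>

lemma smooth_on_D_coeff:
  fixes A :: "real^'n \<Rightarrow> real^'n^'n::finite"
  assumes "open U" and A: "\<And>i j. smooth_on U (\<lambda>y. A y $ i $ j)"
    and nondeg: "\<And>y. y \<in> U \<Longrightarrow> det_Lambda_sym (A y) \<noteq> 0"
  shows "smooth_on U (\<lambda>y. D_coeff (A y) i j p q)"
proof -
  define w :: "real^'n^'n" where "w = axis i (axis j 1)"
  define L where "L A = matrix (inv sym_form \<circ> Lambda A \<circ> sym_form)" for A :: "real^'n^'n"
  have smL: "smooth_on U (\<lambda>y. L (A y) $ u $ v)" for u v
  proof (cases u)
    case (Upair a b)
    have "L (A y) $ u $ v =
      (\<Sum>p\<in>UNIV. \<Sum>q\<in>UNIV. Lambda_coeff (A y) p q a b * sym_form (axis v 1) $ p $ q)" for y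
      unfolding L_def matrix_def Upair by (simp add: inv_sym_form_component Lambda_mem) (simp add: Lambda_def)
    then show ?thesis
      unfolding Lambda_coeff_def divide_inverse
      by (simp only:) (intro smooth_on_sum smooth_on_mult smooth_on_add smooth_on_const assms)
  qed
  have sol: "L (A y) *v inv sym_form (D_op (A y) w) = inv sym_form (sym_part w)" if "y \<in> U" for y
  proof -
    note D = D_op_inverse[OF nondeg[OF that]]
    have "sym_form (inv sym_form (D_op (A y) w)) = D_op (A y) w"
      using D(3) by (simp add: f_inv_into_f range_sym_form)
    then show ?thesis
      using linear_Lambda_coords[of "A y"] by (simp add: L_def matrix_works D(2))
  qed
  have "det (L (A y)) \<noteq> 0" if "y \<in> U" for y
    using nondeg[OF that] by (simp add: det_Lambda_sym_def L_def)
  from smooth_on_linear_solution[OF assms(1) smL smooth_on_const[OF assms(1)] this sol]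
  have "smooth_on U (\<lambda>y. inv sym_form (D_op (A y) w) $ Upair p q)" .
  moreover have "inv sym_form (D_op (A y) w) $ Upair p q = D_coeff (A y) i j p q" if "y \<in> U" for y
    unfolding D_coeff_def w_def by (rule inv_sym_form_component) (rule D_op_inverse(3)[OF nondeg[OF that]])
  ultimately show ?thesis
    using smooth_on_cong[OF assms(1), of "\<lambda>y. inv sym_form (D_op (A y) w) $ Upair p q" "\<lambda>y. D_coeff (A y) i j p q"]
    by simp
qed

lemma smooth_on_theta:
  fixes A :: "real^'n \<Rightarrow> real^'n^'n::finite"
  assumes "open U" "\<And>i j. smooth_on U (\<lambda>y. A y $ i $ j)" "\<And>j r s. smooth_on U (\<lambda>y. \<Gamma> y j r s)"
    "\<And>y. y \<in> U \<Longrightarrow> det_Lambda_sym (A y) \<noteq> 0"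
  shows "smooth_on U (\<lambda>y. theta A \<Gamma> y r p q)"
  unfolding theta_def
  by (intro smooth_on_sum smooth_on_mult smooth_on_minus smooth_on_add smooth_on_const smooth_on_D_coeff smooth_on_partial assms)

text \<open>The bracket on which \<open>D\<close> acts in \<open>theta\<close>, collected for a
  fixed upper index into one form, so that \<open>D\<close> can be used as an operator instead of
  through its components.\<close>

definition theta_source ::
  "(real^'n \<Rightarrow> real^'n^'n::finite) \<Rightarrow> (real^'n \<Rightarrow> 'n \<Rightarrow> 'n \<Rightarrow> 'n \<Rightarrow> real) \<Rightarrow> real^'n \<Rightarrow> 'n \<Rightarrow> real^'n^'n"
where
  "theta_source A \<Gamma> y r = (\<chi> i j. source_quad A \<Gamma> y r i j
     - (partial_deriv j (\<lambda>y. A y $ r $ i) y + partial_deriv i (\<lambda>y. A y $ r $ j) y) / 2)"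

lemma theta_eq_D_op:
  assumes "det_Lambda_sym (A y) \<noteq> 0"
  shows "theta A \<Gamma> y r p q = D_op (A y) (theta_source A \<Gamma> y r) $ p $ q"
  unfolding D_op_components[OF assms] theta_def theta_source_def source_quad_def by simp

lemma theta_commute:
  assumes "det_Lambda_sym (A y) \<noteq> 0"
  shows "theta A \<Gamma> y r p q = theta A \<Gamma> y r q p"
  unfolding theta_eq_D_op[where A = A and y = y, OF assms] by (rule sym_formsD[OF D_op_inverse(3)[OF assms]])

lemma sym_part_id: "w \<in> sym_forms \<Longrightarrow> sym_part w = w"
  by (simp add: sym_part_def sym_forms_def scaleR_2[symmetric])

text \<open>For symmetric \<open>w\<close> the four terms of \<open>Lambda_coeff\<close> agree in
  pairs, which leaves the symmetric part of \<open>transpose A ** w\<close>. This is how \<Lambda>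
  arises from the transformation law, where the Hessian of a component of \<phi> is contracted with
  \<open>A\<close> in one index.\<close>

lemma Lambda_sym_component:
  fixes w :: "real^'n^'n::finite"
  assumes "w \<in> sym_forms"
  shows "Lambda A w $ i $ j = (\<Sum>k\<in>UNIV. A $ k $ i * w $ k $ j + A $ k $ j * w $ k $ i) / 2"
proof -
  have k: "(\<Sum>q\<in>UNIV. kron q j * f q) = f j" for f and j :: 'n
  proof -
    have "kron q j * f q = (if q = j then f q else 0)" for q by (simp add: kron_def)
    then show ?thesis by simp
  qed
  have 1: "(\<Sum>p\<in>UNIV. \<Sum>q\<in>UNIV. A $ p $ a * kron q b * w $ p $ q) = (\<Sum>p\<in>UNIV. A $ p $ a * w $ p $ b)" for a b
  proof -
    have "(\<Sum>q\<in>UNIV. A $ p $ a * kron q b * w $ p $ q) = A $ p $ a * w $ p $ b" for p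
      using k[of b "\<lambda>q. A $ p $ a * w $ p $ q"] by (simp add: ac_simps)
    then show ?thesis by simp
  qed
  have 2: "(\<Sum>p\<in>UNIV. \<Sum>q\<in>UNIV. A $ q $ a * kron p b * w $ p $ q) = (\<Sum>p\<in>UNIV. A $ p $ a * w $ p $ b)" for a b
    by (subst sum.swap) (simp add: 1[symmetric] sym_formsD[OF assms])
  have "Lambda A w $ i $ j = (\<Sum>p\<in>UNIV. \<Sum>q\<in>UNIV. A $ p $ i * kron q j * w $ p $ q + A $ p $ j * kron q i * w $ p $ q
      + A $ q $ i * kron p j * w $ p $ q + A $ q $ j * kron p i * w $ p $ q) / 4"
    by (simp add: Lambda_def Lambda_coeff_def sum_divide_distrib algebra_simps add_divide_distrib)
  also have "\<dots> = (\<Sum>k\<in>UNIV. A $ k $ i * w $ k $ j + A $ k $ j * w $ k $ i) / 2"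
    by (simp add: sum.distrib 1 2)
  finally show ?thesis .
qed

section \<open>Contraction of the quadratic coefficients with the Jacobian\<close>

definition pullback :: "real^'n^'n::finite \<Rightarrow> real^'n^'n \<Rightarrow> real^'n^'n" where
  "pullback P X = transpose P ** X ** P"

lemma pullback_component:
  "pullback P X $ a $ b = (\<Sum>r\<in>UNIV. \<Sum>s\<in>UNIV. X $ r $ s * P $ r $ a * P $ s $ b)"
proof -
  have "pullback P X $ a $ b = (\<Sum>s\<in>UNIV. \<Sum>r\<in>UNIV. X $ r $ s * P $ r $ a * P $ s $ b)"
    by (simp add: pullback_def matrix_matrix_mult_def transpose_def sum_distrib_right sum_distrib_left ac_simps)
  then show ?thesis by (subst sum.swap)
qed

lemma linear_pullback: "linear (pullback P)"
  by (rule linearI) (simp_all add: vec_eq_iff pullback_component sum.distrib sum_distrib_left algebra_simps)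

lemma pullback_pullback: "pullback P (pullback Q X) = pullback (Q ** P) X"
  by (simp add: pullback_def matrix_transpose_mul matrix_mul_assoc)

lemma pullback_mat: "pullback (mat 1) X = X"
  by (simp add: pullback_def)

lemma pullback_sym_part: "pullback P (sym_part X) = sym_part (pullback P X)"
proof -
  have "pullback P (transpose X) = transpose (pullback P X)"
    by (simp add: pullback_def matrix_transpose_mul matrix_mul_assoc)
  then show ?thesis
    by (simp add: sym_part_def linear_add[OF linear_pullback] linear_cmul[OF linear_pullback])
qed

lemma transformed_lead_matrix:
  "transformed_lead \<phi> \<psi> A z = (\<chi> i a. partial_deriv a (\<lambda>y. \<phi> y $ i) (\<psi> z)) ** A (\<psi> z)
     ** (\<chi> j r. partial_deriv r (\<lambda>z. \<psi> z $ j) z)"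
  unfolding transformed_lead_def matrix_matrix_mult_def vec_eq_iff
  by (simp add: sum_distrib_right) (intro allI sum.swap)

lemma det_transformed_lead:
  assumes "point_transformation V W \<phi> \<psi>" "z \<in> W"
  shows "det (transformed_lead \<phi> \<psi> A z) = det (A (\<psi> z))"
proof -
  have "det (\<chi> i a. partial_deriv a (\<lambda>y. \<phi> y $ i) (\<psi> z)) * det (\<chi> j r. partial_deriv r (\<lambda>z. \<psi> z $ j) z) = 1"
    using jacobian_inverse[OF assms] by (simp flip: det_mul)
  then show ?thesis by (simp add: transformed_lead_matrix det_mul mult.left_commute)
qed

lemma smooth_on_transformed_lead:
  assumes pt: "point_transformation V W \<phi> \<psi>" and A: "\<And>i j. smooth_on V (\<lambda>y. A y $ i $ j)"
  shows "smooth_on W (\<lambda>z. transformed_lead \<phi> \<psi> A z $ i $ r)"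
proof -
  have V: "open V" and W: "open W" and \<psi>V: "\<psi> ` W \<subseteq> V"
    and sm: "\<And>i. smooth_on V (\<lambda>y. \<phi> y $ i)" "\<And>i. smooth_on W (\<lambda>z. \<psi> z $ i)"
    using pt by (auto simp: point_transformation_def homeomorphism_def)
  show ?thesis
    unfolding transformed_lead_def vec_lambda_beta
    by (intro smooth_on_sum smooth_on_mult W smooth_on_compose[OF V W \<psi>V _ sm(2)] smooth_on_partial sm A)
qed

text \<open>Contraction with \<open>P\<close> turns derivatives in \<open>z\<close> into derivatives
  in \<open>y\<close>. Both the second derivatives of \<psi> and the first derivatives of
  \<open>T\<close> are derivatives of a row whose product with \<open>P\<close> is known, namely a
  row of the identity or of \<open>P A\<close>, so one product rule treats both. Nothing is
  symmetrized yet.\<close>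

lemma contraction_identity:
  fixes \<phi> \<psi> :: "real^'n \<Rightarrow> real^'n::finite" and A :: "real^'n \<Rightarrow> real^'n^'n"
  assumes pt: "point_transformation V W \<phi> \<psi>" and A: "\<And>i j. smooth_on V (\<lambda>y. A y $ i $ j)"
    and y: "y \<in> V"
  defines "P \<equiv> (\<lambda>y. \<chi> i a. partial_deriv a (\<lambda>y. \<phi> y $ i) y)"
    and "H \<equiv> (\<lambda>i. \<chi> a b. partial_deriv b (partial_deriv a (\<lambda>y. \<phi> y $ i)) y)"
    and "T \<equiv> transformed_lead \<phi> \<psi> A"
  shows "pullback (P y) (\<chi> r s. transformed_quad \<phi> \<psi> A C (\<phi> y) i r s - diffusion_quad T (\<phi> y) i r s) $ a $ b =
    (\<Sum>k\<in>UNIV. P y $ i $ k * (C y k a b - partial_deriv b (\<lambda>y. A y $ k $ a) y))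
     - (\<Sum>k\<in>UNIV. A y $ k $ a * H i $ k $ b)"
proof -
  have V: "open V" and W: "open W" and hom: "homeomorphism V W \<phi> \<psi>"
    and sm: "\<And>i. smooth_on V (\<lambda>y. \<phi> y $ i)" "\<And>i. smooth_on W (\<lambda>z. \<psi> z $ i)"
    using pt by (auto simp: point_transformation_def)
  have \<phi>W: "\<phi> x \<in> W" and \<psi>\<phi>: "\<psi> (\<phi> x) = x" if "x \<in> V" for x
    using hom that by (auto simp: homeomorphism_def)
  define z where "z = \<phi> y"
  have z: "z \<in> W" "\<psi> z = y" using \<phi>W \<psi>\<phi> y by (auto simp: z_def)
  define Q where "Q z = (\<chi> j r. partial_deriv r (\<lambda>z. \<psi> z $ j) z)" for z
  have smP: "smooth_on V (\<lambda>y. P y $ i $ a)" for i a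
    unfolding P_def by (simp add: smooth_on_partial sm)
  have smQ: "smooth_on W (\<lambda>z. Q z $ i $ a)" for i a
    unfolding Q_def by (simp add: smooth_on_partial sm)
  have T: "T z = P (\<psi> z) ** A (\<psi> z) ** Q z" for z
    unfolding T_def P_def Q_def by (rule transformed_lead_matrix)
  have smT: "smooth_on W (\<lambda>z. T z $ i $ r)" for i r
    unfolding T_def by (rule smooth_on_transformed_lead[OF pt A])
  have QP: "Q (\<phi> x) ** P x = mat 1" if "x \<in> V" for x
    using jacobian_inverse[OF pt \<phi>W[OF that]] \<psi>\<phi>[OF that]
    by (simp add: matrix_left_right_inverse P_def Q_def)
  have TP: "T (\<phi> x) ** P x = P x ** A x" if "x \<in> V" for x
    using QP[OF that] by (simp add: T \<psi>\<phi>[OF that] flip: matrix_mul_assoc)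
  have d\<phi>: "(\<lambda>y. \<phi> y $ j) differentiable at y" for j
    using sm(1) V y by (rule smooth_on_differentiable)
  have dP: "(\<lambda>y. P y $ j $ a) differentiable at y" and dA: "(\<lambda>y. A y $ j $ a) differentiable at y" for j a
    by (rule smooth_on_differentiable[OF smP V y], rule smooth_on_differentiable[OF A V y])
  have chain: "partial_deriv b (\<lambda>x. F (\<phi> x)) y = (\<Sum>s\<in>UNIV. partial_deriv s F z * P y $ s $ b)"
    "(\<lambda>x. F (\<phi> x)) differentiable at y" if "smooth_on W F" for F b
  proof -
    have "F differentiable at (\<phi> y)" using smooth_on_differentiable[OF that W z(1)] by (simp add: z_def)
    from partial_deriv_compose[of F \<phi>, OF this d\<phi>]
    show "partial_deriv b (\<lambda>x. F (\<phi> x)) y = (\<Sum>s\<in>UNIV. partial_deriv s F z * P y $ s $ b)"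
      "(\<lambda>x. F (\<phi> x)) differentiable at y" by (simp_all add: P_def z_def)
  qed
  have pP: "partial_deriv b (\<lambda>y. P y $ r $ a) y = H r $ a $ b" for r a b
    by (simp add: P_def H_def)
  \<comment> \<open>The product rule for \<open>F (\<phi> x)\<close> times \<open>P x\<close>,
    solved for the term that contains the derivative of \<open>F\<close>.\<close>
  have contract: "pullback (P y) (\<chi> r s. partial_deriv s (\<lambda>z. F z $ r) z) $ a $ b =
      partial_deriv b (\<lambda>x. \<Sum>r\<in>UNIV. F (\<phi> x) $ r * P x $ r $ a) y - (\<Sum>r\<in>UNIV. F z $ r * H r $ a $ b)"
    if F: "\<And>r. smooth_on W (\<lambda>z. F z $ r)" for F :: "real^'n \<Rightarrow> real^'n"
  proof -
    have "partial_deriv b (\<lambda>x. \<Sum>r\<in>UNIV. F (\<phi> x) $ r * P x $ r $ a) y =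
      (\<Sum>r\<in>UNIV. F (\<phi> y) $ r * H r $ a $ b + (\<Sum>s\<in>UNIV. partial_deriv s (\<lambda>z. F z $ r) z * P y $ s $ b) * P y $ r $ a)"
      by (simp add: partial_deriv_sum partial_deriv_mult differentiable_mult chain[OF F] dP pP)
    then show ?thesis
      by (simp add: pullback_component sum.distrib sum_distrib_right sum_distrib_left z_def ac_simps)
  qed
  have pb\<psi>: "pullback (P y) (\<chi> r s. partial_deriv s (partial_deriv r (\<lambda>z. \<psi> z $ j)) z) $ a $ b =
      - (\<Sum>r\<in>UNIV. Q z $ j $ r * H r $ a $ b)" for j
  proof -
    have "partial_deriv b (\<lambda>x. \<Sum>r\<in>UNIV. Q (\<phi> x) $ j $ r * P x $ r $ a) y = partial_deriv b (\<lambda>x. mat 1 $ j $ a) y"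
      by (rule partial_deriv_cong[OF V y]) (simp add: matrix_matrix_mult_def flip: QP)
    with contract[of "\<lambda>z. Q z $ j", OF smQ] show ?thesis
      by (simp add: partial_deriv_const Q_def)
  qed
  have pbT: "pullback (P y) (\<chi> r s. diffusion_quad T z i r s) $ a $ b =
      (\<Sum>k\<in>UNIV. P y $ i $ k * partial_deriv b (\<lambda>y. A y $ k $ a) y) + (\<Sum>k\<in>UNIV. A y $ k $ a * H i $ k $ b)
      - (\<Sum>r\<in>UNIV. T z $ i $ r * H r $ a $ b)"
  proof -
    have "partial_deriv b (\<lambda>x. \<Sum>r\<in>UNIV. T (\<phi> x) $ i $ r * P x $ r $ a) y =
        partial_deriv b (\<lambda>x. \<Sum>k\<in>UNIV. P x $ i $ k * A x $ k $ a) y"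
    proof (rule partial_deriv_cong[OF V y])
      fix x assume "x \<in> V"
      then have "(T (\<phi> x) ** P x) $ i $ a = (P x ** A x) $ i $ a" by (simp add: TP)
      then show "(\<Sum>r\<in>UNIV. T (\<phi> x) $ i $ r * P x $ r $ a) = (\<Sum>k\<in>UNIV. P x $ i $ k * A x $ k $ a)"
        by (simp add: matrix_matrix_mult_def)
    qed
    also have "\<dots> = (\<Sum>k\<in>UNIV. P y $ i $ k * partial_deriv b (\<lambda>y. A y $ k $ a) y) + (\<Sum>k\<in>UNIV. A y $ k $ a * H i $ k $ b)"
      by (simp add: partial_deriv_sum partial_deriv_mult differentiable_mult dP dA pP sum.distrib ac_simps)
    finally show ?thesis
      using contract[of "\<lambda>z. T z $ i", OF smT] by (simp add: diffusion_quad_def)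
  qed
  have C: "pullback (P y) (pullback (Q z) (\<chi> c d. C y k c d)) $ a $ b = C y k a b" for k
    using QP[OF y] by (simp add: pullback_pullback pullback_mat z_def)
  have quad: "(\<chi> r s. transformed_quad \<phi> \<psi> A C z i r s) = (\<Sum>k\<in>UNIV. P y $ i $ k *\<^sub>R
      ((\<Sum>j\<in>UNIV. A y $ k $ j *\<^sub>R (\<chi> r s. partial_deriv s (partial_deriv r (\<lambda>z. \<psi> z $ j)) z))
        + pullback (Q z) (\<chi> c d. C y k c d)))"
    by (simp add: vec_eq_iff transformed_quad_def pullback_component z(2) P_def Q_def)
  \<comment> \<open>\<open>T = P A Q\<close> folds the contribution of the second derivatives of
    \<psi> into the very term that the derivative of \<open>T\<close> produces, so the two cancel in
    the difference.\<close>
  have TH: "(\<Sum>k\<in>UNIV. P y $ i $ k * (\<Sum>j\<in>UNIV. A y $ k $ j * (\<Sum>r\<in>UNIV. Q z $ j $ r * H r $ a $ b)))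
      = (\<Sum>r\<in>UNIV. T z $ i $ r * H r $ a $ b)"
  proof -
    have "T z *v (\<chi> r. H r $ a $ b) = P y *v (A y *v (Q z *v (\<chi> r. H r $ a $ b)))"
      by (simp add: T z(2) matrix_vector_mul_assoc matrix_mul_assoc)
    from arg_cong[OF this, of "\<lambda>v. v $ i"] show ?thesis by (simp add: matrix_vector_mult_def)
  qed
  have "pullback (P y) (\<chi> r s. transformed_quad \<phi> \<psi> A C z i r s) $ a $ b =
    (\<Sum>k\<in>UNIV. P y $ i $ k * C y k a b) - (\<Sum>r\<in>UNIV. T z $ i $ r * H r $ a $ b)"
    unfolding quad TH[symmetric] linear_sum[OF linear_pullback] linear_cmul[OF linear_pullback] linear_add[OF linear_pullback]
    by (simp add: C pb\<psi> distrib_left right_diff_distrib sum.distrib sum_negf sum_subtractf)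
  moreover have "(\<chi> r s. transformed_quad \<phi> \<psi> A C z i r s - diffusion_quad T z i r s) =
    (\<chi> r s. transformed_quad \<phi> \<psi> A C z i r s) - (\<chi> r s. diffusion_quad T z i r s)"
    by (simp add: vec_eq_iff)
  ultimately show ?thesis
    using pbT by (simp add: linear_diff[OF linear_pullback] right_diff_distrib sum_subtractf flip: z_def)
qed

lemma pullback_eq_0_iff:
  assumes "Q ** P = mat 1"
  shows "pullback P X = 0 \<longleftrightarrow> X = 0"
proof
  assume "pullback P X = 0"
  then have "pullback Q (pullback P X) = 0" by (simp add: linear_0[OF linear_pullback])
  with assms show "X = 0" by (simp add: pullback_pullback pullback_mat matrix_left_right_inverse)
qed (simp add: linear_0[OF linear_pullback])

text \<open>\<open>X\<close> is the discrepancy of the quadratic coefficients. As \<open>P\<close>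
  is invertible, the symmetric part of \<open>X\<close> vanishes iff that of its contraction does,
  and the latter is \<open>S - Lambda (A y) (H i)\<close>. Both \<open>S\<close> and
  \<open>H i\<close> are symmetric, so \<open>D_op\<close> inverts \<open>Lambda\<close> on them
  exactly; by linearity it passes through the sum in \<open>S\<close> and turns each
  \<open>R k\<close> into components of \<open>theta\<close>.\<close>

lemma same_quad_iff_hessian:
  fixes \<phi> \<psi> :: "real^'n \<Rightarrow> real^'n::finite" and A :: "real^'n \<Rightarrow> real^'n^'n"
  assumes pt: "point_transformation V W \<phi> \<psi>" and A: "\<And>i j. smooth_on V (\<lambda>y. A y $ i $ j)"
    and nondeg: "det_Lambda_sym (A y) \<noteq> 0" and \<Gamma>: "\<And>j r s. \<Gamma> y j r s = \<Gamma> y j s r"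
    and y: "y \<in> V"
  shows "(\<forall>r s. (transformed_quad \<phi> \<psi> A (source_quad A \<Gamma>) (\<phi> y) i r s + transformed_quad \<phi> \<psi> A (source_quad A \<Gamma>) (\<phi> y) i s r) / 2 =
      (diffusion_quad (transformed_lead \<phi> \<psi> A) (\<phi> y) i r s + diffusion_quad (transformed_lead \<phi> \<psi> A) (\<phi> y) i s r) / 2) \<longleftrightarrow>
    (\<forall>a b. partial_deriv b (partial_deriv a (\<lambda>y. \<phi> y $ i)) y =
      (\<Sum>m\<in>UNIV. partial_deriv m (\<lambda>y. \<phi> y $ i) y * theta A \<Gamma> y m a b))"
proof -
  have V: "open V" and hom: "homeomorphism V W \<phi> \<psi>" and sm: "\<And>i. smooth_on V (\<lambda>y. \<phi> y $ i)"
    using pt by (auto simp: point_transformation_def)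
  have z: "\<phi> y \<in> W" "\<psi> (\<phi> y) = y" using hom y by (auto simp: homeomorphism_def)
  define P where "P = (\<lambda>y. \<chi> i a. partial_deriv a (\<lambda>y. \<phi> y $ i) y)"
  define H where "H = (\<lambda>i. \<chi> a b. partial_deriv b (partial_deriv a (\<lambda>y. \<phi> y $ i)) y)"
  define X where "X = (\<chi> r s. transformed_quad \<phi> \<psi> A (source_quad A \<Gamma>) (\<phi> y) i r s
    - diffusion_quad (transformed_lead \<phi> \<psi> A) (\<phi> y) i r s)"
  define R where "R = theta_source A \<Gamma> y"
  have Hsym: "H i \<in> sym_forms"
    by (rule sym_formsI) (simp add: H_def partial_deriv_commute[OF V y sm])
  have Rsym: "R k \<in> sym_forms" for k
    by (rule sym_formsI) (simp add: R_def theta_source_def source_quad_def \<Gamma>[of _ _ _] ac_simps)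
  define S where "S = (\<Sum>k\<in>UNIV. P y $ i $ k *\<^sub>R R k)"
  have Ssym: "S \<in> sym_forms"
    by (rule sym_formsI) (simp add: S_def sym_formsD[OF Rsym])
  have "(\<chi> k m. partial_deriv m (\<lambda>z. \<psi> z $ k) (\<phi> y)) ** P y = mat 1"
    using jacobian_inverse[OF pt z(1)] z(2) by (simp add: matrix_left_right_inverse P_def)
  note P0 = pullback_eq_0_iff[OF this]
  have ci: "pullback (P y) X $ a $ b =
    (\<Sum>k\<in>UNIV. P y $ i $ k * (source_quad A \<Gamma> y k a b - partial_deriv b (\<lambda>y. A y $ k $ a) y))
     - (\<Sum>k\<in>UNIV. A y $ k $ a * H i $ k $ b)" for a b
    unfolding P_def H_def X_def by (rule contraction_identity[OF pt A y])
  have "sym_part (pullback (P y) X) = S - Lambda (A y) (H i)"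
  proof -
    have "sym_part (pullback (P y) X) $ a $ b = (S - Lambda (A y) (H i)) $ a $ b" for a b
    proof -
      have "sym_part (pullback (P y) X) $ a $ b = (pullback (P y) X $ a $ b + pullback (P y) X $ b $ a) / 2"
        by (simp add: sym_part_def transpose_def)
      also have "\<dots> = (\<Sum>k\<in>UNIV. P y $ i $ k * R k $ a $ b)
          - (\<Sum>k\<in>UNIV. A y $ k $ a * H i $ k $ b + A y $ k $ b * H i $ k $ a) / 2"
      proof -
        have "P y $ i $ k * (source_quad A \<Gamma> y k a b - partial_deriv b (\<lambda>y. A y $ k $ a) y)
          + P y $ i $ k * (source_quad A \<Gamma> y k b a - partial_deriv a (\<lambda>y. A y $ k $ b) y)
          = 2 * (P y $ i $ k * R k $ a $ b)" for k
        proof -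
          have "source_quad A \<Gamma> y k b a = source_quad A \<Gamma> y k a b" by (simp add: source_quad_def \<Gamma>[of _ a b])
          then show ?thesis by (simp add: R_def theta_source_def algebra_simps)
        qed
        then have "(\<Sum>k\<in>UNIV. P y $ i $ k * (source_quad A \<Gamma> y k a b - partial_deriv b (\<lambda>y. A y $ k $ a) y))
          + (\<Sum>k\<in>UNIV. P y $ i $ k * (source_quad A \<Gamma> y k b a - partial_deriv a (\<lambda>y. A y $ k $ b) y))
          = 2 * (\<Sum>k\<in>UNIV. P y $ i $ k * R k $ a $ b)"
          by (simp add: sum.distrib[symmetric] sum_distrib_left)
        moreover have "(s - c + (t - d)) / 2 = r - (c + d) / 2" if "s + t = 2 * r" for s t c d r :: real
          using that by (simp add: field_simps)
        ultimately show ?thesis unfolding ci sum.distrib by blast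
      qed
      finally show ?thesis by (simp add: Lambda_sym_component[OF Hsym] S_def)
    qed
    then show ?thesis by (simp add: vec_eq_iff)
  qed
  then have *: "sym_part X = 0 \<longleftrightarrow> S = Lambda (A y) (H i)"
    using P0[of "sym_part X"] by (simp add: pullback_sym_part)
  note D = D_op_inverse[OF nondeg] and linD = D_op_linear[OF nondeg]
  have "S = Lambda (A y) (H i) \<longleftrightarrow> D_op (A y) S = H i"
    using D(1)[of "H i"] D(2)[of S] sym_part_id[OF Hsym] sym_part_id[OF Ssym] by metis
  moreover have "D_op (A y) S = (\<chi> a b. \<Sum>m\<in>UNIV. P y $ i $ m * theta A \<Gamma> y m a b)"
    unfolding S_def linear_sum[OF linD] linear_cmul[OF linD]
    by (simp add: vec_eq_iff R_def theta_eq_D_op[where A = A and y = y, OF nondeg])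
  moreover have "sym_part X = 0 \<longleftrightarrow> (\<forall>r s. (transformed_quad \<phi> \<psi> A (source_quad A \<Gamma>) (\<phi> y) i r s + transformed_quad \<phi> \<psi> A (source_quad A \<Gamma>) (\<phi> y) i s r) / 2 =
      (diffusion_quad (transformed_lead \<phi> \<psi> A) (\<phi> y) i r s + diffusion_quad (transformed_lead \<phi> \<psi> A) (\<phi> y) i s r) / 2)"
    unfolding X_def sym_part_def transpose_def vec_eq_iff by (simp add: field_simps)
  ultimately show ?thesis using * by (auto simp: vec_eq_iff P_def H_def)
qed

section \<open>Integrability of the Hessian equation\<close>

text \<open>The third derivatives of each component are its gradient paired with the vector
  \<open>K k q\<close>. Exchanging \<open>k\<close> and \<open>q\<close> shows that every row of the
  Jacobian annihilates the difference of these vectors, which is the curvature; invertibility makes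
  it vanish.\<close>

lemma zero_curvature_of_hessian:
  fixes \<phi> :: "real^'n \<Rightarrow> real^'n::finite" and \<theta> :: "real^'n \<Rightarrow> 'n \<Rightarrow> 'n \<Rightarrow> 'n \<Rightarrow> real"
  assumes V: "open V" and \<theta>: "\<And>m a b. smooth_on V (\<lambda>y. \<theta> y m a b)"
    and sym: "\<And>y m a b. y \<in> V \<Longrightarrow> \<theta> y m a b = \<theta> y m b a"
    and \<phi>: "\<And>i. smooth_on V (\<lambda>y. \<phi> y $ i)"
    and hess: "\<And>y i a b. y \<in> V \<Longrightarrow> partial_deriv b (partial_deriv a (\<lambda>y. \<phi> y $ i)) y =
      (\<Sum>m\<in>UNIV. partial_deriv m (\<lambda>y. \<phi> y $ i) y * \<theta> y m a b)"
    and y: "y \<in> V" and inv: "invertible (\<chi> i a. partial_deriv a (\<lambda>y. \<phi> y $ i) y)"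
  shows "zero_curvature_at \<theta> y"
  unfolding zero_curvature_at_def
proof (intro allI)
  fix m k p q
  define P where "P i a = partial_deriv a (\<lambda>y. \<phi> y $ i)" for i a
  have smP: "smooth_on V (P i a)" for i a unfolding P_def by (intro smooth_on_partial \<phi>)
  have dP: "P i a differentiable at y" and d\<theta>: "(\<lambda>y. \<theta> y m a b) differentiable at y" for i a b m
    by (rule smooth_on_differentiable[OF smP V y], rule smooth_on_differentiable[OF \<theta> V y])
  have hP: "partial_deriv b (P i a) x = (\<Sum>m\<in>UNIV. P i m x * \<theta> x m a b)" if "x \<in> V" for i a b x
    unfolding P_def by (rule hess[OF that])
  define K where "K k q m = partial_deriv q (\<lambda>y. \<theta> y m k p) y + (\<Sum>r\<in>UNIV. \<theta> y m q r * \<theta> y r k p)" for k q m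
  have third: "partial_deriv q (partial_deriv k (P i p)) y = (\<Sum>m\<in>UNIV. P i m y * K k q m)" for i k q
  proof -
    have "partial_deriv q (partial_deriv k (P i p)) y = partial_deriv q (\<lambda>x. \<Sum>m\<in>UNIV. P i m x * \<theta> x m k p) y"
      by (rule partial_deriv_cong[OF V y]) (simp add: hP sym[of _ _ p])
    also have "\<dots> = (\<Sum>m\<in>UNIV. P i m y * partial_deriv q (\<lambda>x. \<theta> x m k p) y)
        + (\<Sum>m\<in>UNIV. (\<Sum>r\<in>UNIV. P i r y * \<theta> y r m q) * \<theta> y m k p)"
      by (simp add: partial_deriv_sum partial_deriv_mult differentiable_mult dP d\<theta> hP[OF y] sum.distrib)
    also have "(\<Sum>m\<in>UNIV. (\<Sum>r\<in>UNIV. P i r y * \<theta> y r m q) * \<theta> y m k p) =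
        (\<Sum>r\<in>UNIV. \<Sum>m\<in>UNIV. P i r y * \<theta> y r m q * \<theta> y m k p)"
      unfolding sum_distrib_right by (rule sum.swap)
    finally show ?thesis
      by (simp add: K_def distrib_left sum.distrib sum_distrib_left mult.assoc sym[OF y, of _ q])
  qed
  have "(\<chi> i a. partial_deriv a (\<lambda>y. \<phi> y $ i) y) *v (\<chi> m. K k q m - K q k m) = 0"
  proof -
    have "(\<Sum>m\<in>UNIV. P i m y * (K k q m - K q k m)) = 0" for i
      using partial_deriv_commute[OF V y smP, of q k i p]
      by (simp add: third right_diff_distrib sum_subtractf)
    then show ?thesis by (simp add: vec_eq_iff matrix_vector_mult_def P_def)
  qed
  then have "(\<chi> m. K k q m - K q k m) = 0"
    using inv[THEN invertible_left_inverse[THEN iffD1], unfolded matrix_left_invertible_ker] by blast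
  then have "K k q m - K q k m = 0" by (simp add: vec_eq_iff)
  then show "partial_deriv q (\<lambda>y. \<theta> y m k p) y - partial_deriv k (\<lambda>y. \<theta> y m q p) y +
      (\<Sum>r\<in>UNIV. \<theta> y m q r * \<theta> y r k p) - (\<Sum>r\<in>UNIV. \<theta> y m k r * \<theta> y r q p) = 0"
    by (simp add: K_def)
qed

section \<open>The Hessian equation as a Pfaffian system with operator-valued coefficients\<close>

lemma Blinfun_bilinear_apply:
  fixes f :: "'a::euclidean_space \<Rightarrow> 'b::euclidean_space \<Rightarrow> 'c::real_normed_vector"
  assumes "bilinear f"
  shows "blinfun_apply (blinfun_apply (Blinfun (\<lambda>h. Blinfun (f h))) h) w = f h w"
proof -
  have 1: "blinfun_apply (Blinfun (f h)) = f h" for h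
    using assms by (intro bounded_linear_Blinfun_apply) (simp add: linear_conv_bounded_linear[symmetric] bilinear_def)
  have "linear (\<lambda>h. Blinfun (f h))"
    using assms by (intro linearI blinfun_eqI)
      (simp_all add: 1 blinfun.bilinear_simps bilinear_ladd bilinear_lmul)
  then have "blinfun_apply (Blinfun (\<lambda>h. Blinfun (f h))) = (\<lambda>h. Blinfun (f h))"
    by (intro bounded_linear_Blinfun_apply) (simp add: linear_conv_bounded_linear[symmetric])
  then show ?thesis by (simp add: 1)
qed

text \<open>Constant tensors to be combined with scalar coefficients: a form written as such a
  finite combination inherits differentiability and continuity from the coefficients
  \<theta>.\<close>

definition pfaff_basis :: "'n \<Rightarrow> 'n \<Rightarrow> 'n \<Rightarrow> (real^'n::finite) \<Rightarrow>\<^sub>L (real \<times> (real^'n)) \<Rightarrow>\<^sub>L (real \<times> (real^'n))" where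
  "pfaff_basis m a b = Blinfun (\<lambda>h. Blinfun (\<lambda>w. (0, (snd w $ m * h $ b) *\<^sub>R axis a 1)))"

text \<open>With \<open>w\<close> a pair of function value and gradient, this part makes the second
  component the gradient of the first. The equation for the gradient itself, with \<theta>, is
  \<open>pfaff_comb\<close>.\<close>

definition pfaff_const :: "(real^'n::finite) \<Rightarrow>\<^sub>L (real \<times> (real^'n)) \<Rightarrow>\<^sub>L (real \<times> (real^'n))" where
  "pfaff_const = Blinfun (\<lambda>h. Blinfun (\<lambda>w. (snd w \<bullet> h, 0)))"

definition pfaff_comb :: "('n \<Rightarrow> 'n \<Rightarrow> 'n \<Rightarrow> real) \<Rightarrow> (real^'n::finite) \<Rightarrow>\<^sub>L (real \<times> (real^'n)) \<Rightarrow>\<^sub>L (real \<times> (real^'n))" where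
  "pfaff_comb c = (\<Sum>m\<in>UNIV. \<Sum>b\<in>UNIV. \<Sum>a\<in>UNIV. c m a b *\<^sub>R pfaff_basis m a b)"

lemma pfaff_basis_apply: "pfaff_basis m a b h w = (0, (snd w $ m * h $ b) *\<^sub>R axis a 1)"
  unfolding pfaff_basis_def
  by (rule Blinfun_bilinear_apply) (auto simp: bilinear_def algebra_simps intro!: linearI)

lemma pfaff_const_apply: "pfaff_const h w = (snd w \<bullet> h, 0)"
  unfolding pfaff_const_def
  by (rule Blinfun_bilinear_apply) (auto simp: bilinear_def inner_simps intro!: linearI)

lemma pfaff_comb_apply:
  "pfaff_comb c h w = (0, \<chi> a. \<Sum>m\<in>UNIV. \<Sum>b\<in>UNIV. snd w $ m * c m a b * h $ b)"
proof (rule prod_eqI)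
  show "fst (pfaff_comb c h w) = fst (0, \<chi> a. \<Sum>m\<in>UNIV. \<Sum>b\<in>UNIV. snd w $ m * c m a b * h $ b)"
    by (simp add: pfaff_comb_def blinfun.bilinear_simps pfaff_basis_apply fst_sum)
  have "snd (pfaff_comb c h w) $ d = (\<Sum>m\<in>UNIV. \<Sum>b\<in>UNIV. snd w $ m * c m d b * h $ b)" for d
  proof -
    have "snd (pfaff_comb c h w) $ d =
      (\<Sum>m\<in>UNIV. \<Sum>b\<in>UNIV. \<Sum>a\<in>UNIV. c m a b * (snd w $ m * h $ b) * axis a 1 $ d)"
      by (simp add: pfaff_comb_def blinfun.bilinear_simps pfaff_basis_apply snd_sum mult.assoc)
    also have "\<dots> = (\<Sum>m\<in>UNIV. \<Sum>b\<in>UNIV. \<Sum>a\<in>UNIV. if a = d then snd w $ m * c m a b * h $ b else 0)"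
      by (intro sum.cong refl) (simp add: axis_def)
    finally show ?thesis by simp
  qed
  then show "snd (pfaff_comb c h w) = snd (0, \<chi> a. \<Sum>m\<in>UNIV. \<Sum>b\<in>UNIV. snd w $ m * c m a b * h $ b)"
    by (simp add: vec_eq_iff)
qed

text \<open>The unknown is the pair of a coordinate function and its gradient.\<close>

lemma pfaffian_solution:
  fixes \<theta> :: "real^'n \<Rightarrow> 'n \<Rightarrow> 'n \<Rightarrow> 'n::finite \<Rightarrow> real"
  assumes V: "open V" "y0 \<in> V" and \<theta>: "\<And>m a b. smooth_on V (\<lambda>y. \<theta> y m a b)"
    and sym: "\<And>y m a b. y \<in> V \<Longrightarrow> \<theta> y m a b = \<theta> y m b a"
    and flat: "\<And>y. y \<in> V \<Longrightarrow> zero_curvature_at \<theta> y"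
  obtains r \<phi> where "r > 0" "ball y0 r \<subseteq> V" "\<And>i. smooth_on (ball y0 r) (\<lambda>y. \<phi> y $ i)"
    "\<And>y i a b. y \<in> ball y0 r \<Longrightarrow> partial_deriv b (partial_deriv a (\<lambda>y. \<phi> y $ i)) y =
      (\<Sum>m\<in>UNIV. partial_deriv m (\<lambda>y. \<phi> y $ i) y * \<theta> y m a b)"
    "(\<chi> i a. partial_deriv a (\<lambda>y. \<phi> y $ i) y0) = (mat 1 :: real^'n^'n)"
proof -
  define \<omega> where "\<omega> y = pfaff_const + pfaff_comb (\<theta> y)" for y
  define D where "D y c m a b = frechet_derivative (\<lambda>y. \<theta> y m a b) (at y) c" for y c m a b
  define \<omega>' where "\<omega>' y = Blinfun (\<lambda>c. pfaff_comb (D y c))" for y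
  have d\<theta>: "(\<lambda>y. \<theta> y m a b) differentiable at y" if "y \<in> V" for y m a b
    using \<theta> V(1) that by (rule smooth_on_differentiable)
  have D: "D y c m a b = (\<Sum>k\<in>UNIV. partial_deriv k (\<lambda>y. \<theta> y m a b) y * c $ k)" if "y \<in> V" for y c m a b
    unfolding D_def by (rule frechet_partial[OF d\<theta>[OF that]])
  have \<omega>: "\<omega> y h w = (snd w \<bullet> h, \<chi> a. \<Sum>m\<in>UNIV. \<Sum>b\<in>UNIV. snd w $ m * \<theta> y m a b * h $ b)" for y h w
    by (simp add: \<omega>_def blinfun.bilinear_simps pfaff_const_apply pfaff_comb_apply)
  have \<omega>': "blinfun_apply (\<omega>' y) = (\<lambda>c. pfaff_comb (D y c))" if "y \<in> V" for y
  proof -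
    have "linear (\<lambda>c. pfaff_comb (D y c))"
      by (intro linearI blinfun_eqI)
        (simp_all add: pfaff_comb_apply D[OF that] blinfun.bilinear_simps vec_eq_iff sum.distrib
          sum_distrib_left sum_distrib_right algebra_simps)
    then show ?thesis
      unfolding \<omega>'_def by (intro bounded_linear_Blinfun_apply) (simp add: linear_conv_bounded_linear[symmetric])
  qed
  have d\<omega>: "(\<omega> has_derivative \<omega>' y) (at y)" if "y \<in> V" for y
  proof -
    have "((\<lambda>y. pfaff_const + (\<Sum>m\<in>UNIV. \<Sum>b\<in>UNIV. \<Sum>a\<in>UNIV. \<theta> y m a b *\<^sub>R pfaff_basis m a b)) has_derivative
      (\<lambda>c. 0 + (\<Sum>m\<in>UNIV. \<Sum>b\<in>UNIV. \<Sum>a\<in>UNIV. D y c m a b *\<^sub>R pfaff_basis m a b))) (at y)"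
      using d\<theta>[OF that] unfolding D_def frechet_derivative_works
      by (intro has_derivative_add has_derivative_const has_derivative_sum has_derivative_scaleR_left)
    then show ?thesis by (simp add: \<omega>'[OF that] \<omega>_def[abs_def] pfaff_comb_def)
  qed
  have c\<omega>': "continuous_on V \<omega>'"
  proof (rule continuous_on_blinfun_componentwise)
    fix c :: "real^'n"
    have "continuous_on V (partial_deriv k (\<lambda>y. \<theta> y m a b))" for k m a b
      using smooth_on_partial[OF \<theta>] Ck_on.simps(1) unfolding smooth_on_def by blast
    then have "continuous_on V (\<lambda>y. \<Sum>m\<in>UNIV. \<Sum>b\<in>UNIV. \<Sum>a\<in>UNIV.
        (\<Sum>k\<in>UNIV. partial_deriv k (\<lambda>y. \<theta> y m a b) y * c $ k) *\<^sub>R (pfaff_basis m a b))"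
      by (intro continuous_intros)
    then show "continuous_on V (\<lambda>y. \<omega>' y c)"
      by (rule continuous_on_eq) (simp add: \<omega>' pfaff_comb_def D)
  qed
  \<comment> \<open>The components rest on different facts: the first on the symmetry of \<theta> in
    its lower indices, the second on zero curvature, with symmetry serving to reorder
    indices.\<close>
  have flat': "\<omega>' y h k w + \<omega> y k (\<omega> y h w) = \<omega>' y k h w + \<omega> y h (\<omega> y k w)" if y: "y \<in> V" for y h k w
  proof -
    define K where "K a m b c = partial_deriv c (\<lambda>y. \<theta> y m a b) y + (\<Sum>l\<in>UNIV. \<theta> y m l c * \<theta> y l a b)" for a m b c
    have K: "K a m b c = K a m c b" for a m b c
    proof -
      have eq: "K a m b c = partial_deriv c (\<lambda>y. \<theta> y m b a) y + (\<Sum>l\<in>UNIV. \<theta> y m c l * \<theta> y l b a)" for b c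
      proof -
        have "partial_deriv c (\<lambda>y. \<theta> y m a b) y = partial_deriv c (\<lambda>y. \<theta> y m b a) y"
          by (rule partial_deriv_cong[OF V(1) y]) (rule sym)
        then show ?thesis
          unfolding K_def by (simp add: sym[OF y, of _ a b] sym[OF y, of m _ c])
      qed
      show ?thesis
        using eq[of b c] eq[of c b] flat[OF y, unfolded zero_curvature_at_def, rule_format, of c m b a] by linarith
    qed
    have "\<omega>' y h k w + \<omega> y k (\<omega> y h w) =
      (\<Sum>a\<in>UNIV. \<Sum>m\<in>UNIV. \<Sum>b\<in>UNIV. snd w $ m * \<theta> y m a b * (h $ b * k $ a),
       \<chi> a. \<Sum>m\<in>UNIV. \<Sum>b\<in>UNIV. \<Sum>c\<in>UNIV. snd w $ m * K a m b c * (h $ c * k $ b))" (is "_ = ?R h k") for h k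
    proof (rule prod_eqI)
      show "fst (\<omega>' y h k w + \<omega> y k (\<omega> y h w)) = fst (?R h k)"
        by (simp add: \<omega>'[OF y] pfaff_comb_apply \<omega> inner_vec_def sum_distrib_left sum_distrib_right ac_simps)
      have "snd (\<omega>' y h k w + \<omega> y k (\<omega> y h w)) $ a = snd (?R h k) $ a" for a
      proof -
        have "(\<Sum>l\<in>UNIV. \<Sum>b\<in>UNIV. (\<Sum>m\<in>UNIV. \<Sum>c\<in>UNIV. snd w $ m * \<theta> y m l c * h $ c) * \<theta> y l a b * k $ b)
          = (\<Sum>l\<in>UNIV. \<Sum>b\<in>UNIV. \<Sum>m\<in>UNIV. \<Sum>c\<in>UNIV. snd w $ m * (\<theta> y m l c * \<theta> y l a b) * (h $ c * k $ b))"
          by (simp add: sum_distrib_left sum_distrib_right ac_simps)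
        also have "\<dots> = (\<Sum>l\<in>UNIV. \<Sum>m\<in>UNIV. \<Sum>b\<in>UNIV. \<Sum>c\<in>UNIV. snd w $ m * (\<theta> y m l c * \<theta> y l a b) * (h $ c * k $ b))"
          by (intro sum.cong refl sum.swap)
        also have "\<dots> = (\<Sum>m\<in>UNIV. \<Sum>l\<in>UNIV. \<Sum>b\<in>UNIV. \<Sum>c\<in>UNIV. snd w $ m * (\<theta> y m l c * \<theta> y l a b) * (h $ c * k $ b))"
          by (rule sum.swap)
        also have "\<dots> = (\<Sum>m\<in>UNIV. \<Sum>b\<in>UNIV. \<Sum>l\<in>UNIV. \<Sum>c\<in>UNIV. snd w $ m * (\<theta> y m l c * \<theta> y l a b) * (h $ c * k $ b))"
          by (intro sum.cong refl sum.swap)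
        also have "\<dots> = (\<Sum>m\<in>UNIV. \<Sum>b\<in>UNIV. \<Sum>c\<in>UNIV. \<Sum>l\<in>UNIV. snd w $ m * (\<theta> y m l c * \<theta> y l a b) * (h $ c * k $ b))"
          by (intro sum.cong refl sum.swap)
        finally have 1: "(\<Sum>l\<in>UNIV. \<Sum>b\<in>UNIV. (\<Sum>m\<in>UNIV. \<Sum>c\<in>UNIV. snd w $ m * \<theta> y m l c * h $ c) * \<theta> y l a b * k $ b)
          = (\<Sum>m\<in>UNIV. \<Sum>b\<in>UNIV. \<Sum>c\<in>UNIV. snd w $ m * (\<Sum>l\<in>UNIV. \<theta> y m l c * \<theta> y l a b) * (h $ c * k $ b))"
          by (simp only: sum_distrib_left sum_distrib_right)
        have 2: "(\<Sum>m\<in>UNIV. \<Sum>b\<in>UNIV. snd w $ m * D y h m a b * k $ b)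
          = (\<Sum>m\<in>UNIV. \<Sum>b\<in>UNIV. \<Sum>c\<in>UNIV. snd w $ m * partial_deriv c (\<lambda>y. \<theta> y m a b) y * (h $ c * k $ b))"
          by (simp add: D[OF y] sum_distrib_left sum_distrib_right ac_simps)
        show ?thesis
          by (simp add: \<omega>'[OF y] pfaff_comb_apply \<omega> 1 2 K_def distrib_left distrib_right sum.distrib)
      qed
      then show "snd (\<omega>' y h k w + \<omega> y k (\<omega> y h w)) = snd (?R h k)" by (simp add: vec_eq_iff)
    qed
    moreover have "?R h k = ?R k h"
    proof -
      have "(\<Sum>a\<in>UNIV. \<Sum>m\<in>UNIV. \<Sum>b\<in>UNIV. snd w $ m * \<theta> y m a b * (h $ b * k $ a)) =
        (\<Sum>m\<in>UNIV. \<Sum>a\<in>UNIV. \<Sum>b\<in>UNIV. snd w $ m * \<theta> y m a b * (h $ b * k $ a))" for h k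
        by (rule sum.swap)
      moreover have "(\<Sum>a\<in>UNIV. \<Sum>b\<in>UNIV. snd w $ m * \<theta> y m a b * (h $ b * k $ a)) =
        (\<Sum>a\<in>UNIV. \<Sum>b\<in>UNIV. snd w $ m * \<theta> y m a b * (k $ b * h $ a))" for m
        by (subst sum.swap) (simp add: sym[OF y, of m] ac_simps)
      moreover have "(\<Sum>b\<in>UNIV. \<Sum>c\<in>UNIV. snd w $ m * K a m b c * (h $ c * k $ b)) =
        (\<Sum>b\<in>UNIV. \<Sum>c\<in>UNIV. snd w $ m * K a m b c * (k $ c * h $ b))" for a m
        by (subst sum.swap) (simp add: K[of a m] ac_simps)
      ultimately show ?thesis by simp
    qed
    ultimately show ?thesis by simp
  qed
  obtain r where r: "r > 0" "ball y0 r \<subseteq> V" and sol: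
    "\<And>c. \<exists>u. u y0 = c \<and> (\<forall>x\<in>ball y0 r. (u has_derivative (\<lambda>h. \<omega> x h (u x))) (at x))"
    using frobenius_linear[OF V d\<omega> c\<omega>' flat'] by blast
  \<comment> \<open>The value at \<open>y0\<close> is an arbitrary additive constant, set to 0; the
    gradients are the unit vectors, which makes the Jacobian at \<open>y0\<close> the
    identity.\<close>
  have "\<forall>i::'n. \<exists>u. u y0 = (0, axis i 1) \<and> (\<forall>x\<in>ball y0 r. (u has_derivative (\<lambda>h. \<omega> x h (u x))) (at x))"
    using sol by blast
  from choice[OF this] obtain u where u0: "\<And>i::'n. u i y0 = (0, axis i 1)"
    and du: "\<And>i x. x \<in> ball y0 r \<Longrightarrow> (u i has_derivative (\<lambda>h. \<omega> x h (u i x))) (at x)"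
    by blast
  define \<phi> where "\<phi> y = (\<chi> i. fst (u i y))" for y
  define p where "p i a y = snd (u i y) $ a" for i a y
  have d\<phi>: "((\<lambda>y. \<phi> y $ i) has_derivative (\<lambda>h. snd (u i x) \<bullet> h)) (at x)" if "x \<in> ball y0 r" for i x
    using has_derivative_fst[OF du[OF that, of i]] by (simp add: \<phi>_def \<omega>)
  have dp: "(p i a has_derivative (\<lambda>h. \<Sum>m\<in>UNIV. \<Sum>b\<in>UNIV. p i m x * \<theta> x m a b * h $ b)) (at x)"
    if "x \<in> ball y0 r" for i a x
    using bounded_linear.has_derivative[OF bounded_linear_vec_nth has_derivative_snd[OF du[OF that, of i]], of a]
    by (simp add: p_def[abs_def] \<omega>)
  have pd\<phi>: "partial_deriv a (\<lambda>y. \<phi> y $ i) x = p i a x" if "x \<in> ball y0 r" for a i x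
    using partial_deriv_eq[OF d\<phi>[OF that]] by (simp add: p_def inner_axis)
  have pdp: "partial_deriv b (p i a) x = (\<Sum>m\<in>UNIV. p i m x * \<theta> x m a b)" if "x \<in> ball y0 r" for a b i x
  proof -
    have "(\<Sum>b'\<in>UNIV. p i m x * \<theta> x m a b' * axis b 1 $ b') = (\<Sum>b'\<in>UNIV. if b' = b then p i m x * \<theta> x m a b' else 0)" for m
      by (intro sum.cong refl) (simp add: axis_def)
    then show ?thesis using partial_deriv_eq[OF dp[OF that]] by simp
  qed
  \<comment> \<open>Bootstrap: \<open>pdp\<close> writes the derivatives of the gradient as sums of
    products of the gradient with \<theta>, so each order of differentiability yields the
    next.\<close>
  have smp: "Ck_on k (ball y0 r) (p i a)" for k i a
  proof (induction k arbitrary: a)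
    case 0
    show ?case using dp by (auto intro!: continuous_at_imp_continuous_on has_derivative_continuous)
  next
    case (Suc k)
    show ?case
    proof (rule Ck_on_SucI[OF open_ball _ pdp])
      show "Ck_on k (ball y0 r) (\<lambda>x. \<Sum>m\<in>UNIV. p i m x * \<theta> x m a b)" for b
        by (intro Ck_on_sum Ck_on_mult open_ball Suc.IH smooth_onD smooth_on_subset[OF \<theta> r(2)])
    qed (use dp differentiableI in blast)
  qed
  have "Ck_on k (ball y0 r) (\<lambda>y. \<phi> y $ i)" for k i
    by (rule Ck_on_lower, rule Ck_on_SucI[OF open_ball _ pd\<phi> smp]) (use d\<phi> differentiableI in blast)
  moreover have "partial_deriv b (partial_deriv a (\<lambda>y. \<phi> y $ i)) x =
      (\<Sum>m\<in>UNIV. partial_deriv m (\<lambda>y. \<phi> y $ i) x * \<theta> x m a b)" if "x \<in> ball y0 r" for x i a b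
    using partial_deriv_cong[OF open_ball that, of "partial_deriv a (\<lambda>y. \<phi> y $ i)" "p i a" b, OF pd\<phi>] by (simp add: pdp[OF that] pd\<phi>[OF that])
  moreover have "(\<chi> i a. partial_deriv a (\<lambda>y. \<phi> y $ i) y0) = (mat 1 :: real^'n^'n)"
    using r(1) by (simp add: vec_eq_iff pd\<phi> p_def u0 mat_def axis_def eq_commute)
  ultimately show ?thesis using r that[of r \<phi>] by (simp add: smooth_on_def)
qed

text \<open>The partial derivatives of \<open>\<psi>\<close> are \<open>X r\<close> composed with
  \<open>\<psi>\<close>, where \<open>X r\<close> is column \<open>r\<close> of the inverse Jacobian
  and is smooth on \<open>V\<close> by Cramer's rule. So \<open>\<psi>\<close> of class
  \<open>C^k\<close> has derivatives of class \<open>C^k\<close>, and induction gives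
  smoothness.\<close>

lemma smooth_inverse_function:
  fixes \<phi> :: "real^'n \<Rightarrow> real^'n::finite"
  assumes S: "open S" "y0 \<in> S" and \<phi>: "\<And>i. smooth_on S (\<lambda>y. \<phi> y $ i)"
    and inv: "invertible (\<chi> i a. partial_deriv a (\<lambda>y. \<phi> y $ i) y0)"
  obtains V W \<psi> where "y0 \<in> V" "V \<subseteq> S" "point_transformation V W \<phi> \<psi>"
proof -
  define P where "P y = (\<chi> i a. partial_deriv a (\<lambda>y. \<phi> y $ i) y)" for y
  define F where "F y = Blinfun ((*v) (P y))" for y
  have blinfun_mult: "blinfun_apply (Blinfun ((*v) M)) = (*v) M" for M :: "real^'n^'n"
    by (rule bounded_linear_Blinfun_apply) (rule matrix_vector_mul_bounded_linear)
  have F: "blinfun_apply (F y) = (*v) (P y)" for y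
    unfolding F_def by (rule blinfun_mult)
  have smP: "smooth_on S (\<lambda>y. P y $ i $ a)" for i a
    by (simp add: P_def smooth_on_partial \<phi>)
  have der: "(\<phi> has_derivative blinfun_apply (F y)) (at y)" if "y \<in> S" for y
  proof (rule has_derivative_vecI)
    fix j
    have d: "(\<lambda>y. \<phi> y $ j) differentiable at y" using \<phi> S(1) that by (rule smooth_on_differentiable)
    have "(\<lambda>h. F y h $ j) = frechet_derivative (\<lambda>y. \<phi> y $ j) (at y)"
      by (simp add: fun_eq_iff F frechet_partial[OF d] P_def matrix_vector_mult_def)
    then show "((\<lambda>y. \<phi> y $ j) has_derivative (\<lambda>h. F y h $ j)) (at y)"
      using d by (simp add: frechet_derivative_works)
  qed
  have cont: "continuous_on S F"
  proof (rule continuous_on_blinfun_componentwise)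
    fix h :: "real^'n"
    have "continuous_on S (\<lambda>y. P y $ i $ a)" for i a
      using smooth_onD[OF smP] by (rule Ck_on_imp_continuous_on)
    then show "continuous_on S (\<lambda>y. F y h)"
      unfolding F matrix_vector_mult_def by (intro continuous_on_vec_lambda continuous_on_sum continuous_on_mult continuous_on_const)
  qed
  obtain B where B: "B ** P y0 = mat 1"
    using inv unfolding P_def by (auto simp: invertible_def)
  have left_inv: "Blinfun ((*v) B) o\<^sub>L F y0 = id_blinfun"
    by (rule blinfun_eqI) (simp add: blinfun_mult F matrix_vector_mul_assoc B)
  obtain V W \<psi> g' where V: "open V" "V \<subseteq> S" "y0 \<in> V" "open W" "\<phi> y0 \<in> W" "homeomorphism V W \<phi> \<psi>"
    and d\<psi>: "\<And>z. z \<in> W \<Longrightarrow> (\<psi> has_derivative g' z) (at z)"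
    and g': "\<And>z. z \<in> W \<Longrightarrow> g' z = inv (blinfun_apply (F (\<psi> z)))"
    and bij: "\<And>z. z \<in> W \<Longrightarrow> bij (blinfun_apply (F (\<psi> z)))"
    by (rule inverse_function_theorem[OF S(1) der cont S(2) left_inv]) (assumption, rule that)
  have \<psi>V: "\<psi> ` W = V" using V(6) by (simp add: homeomorphism_def)
  have detP: "det (P y) \<noteq> 0" if "y \<in> V" for y
    using bij that unfolding F \<psi>V[symmetric] by (auto simp: invertible_eq_bij[symmetric] invertible_det_nz)
  define X where "X r y = inv ((*v) (P y)) (axis r 1)" for r y
  have PX: "P y *v X r y = axis r 1" if y: "y \<in> V" for r y
  proof -
    have "bij ((*v) (P y))" using detP[OF y] by (simp add: invertible_eq_bij[symmetric] invertible_det_nz)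
    then show ?thesis unfolding X_def by (rule surj_f_inv_f[OF bij_is_surj])
  qed
  have smX: "smooth_on V (\<lambda>y. X r y $ j)" for r j
    by (rule smooth_on_linear_solution[OF V(1) smooth_on_subset[OF smP V(2)] smooth_on_const[OF V(1)] detP PX])
  have dj: "((\<lambda>z. \<psi> z $ j) has_derivative (\<lambda>h. g' z h $ j)) (at z)" if "z \<in> W" for z j
    using bounded_linear.has_derivative[OF bounded_linear_vec_nth d\<psi>[OF that]] .
  have pd: "partial_deriv r (\<lambda>z. \<psi> z $ j) z = X r (\<psi> z) $ j" if "z \<in> W" for r j z
    using partial_deriv_eq[OF dj[OF that]] by (simp add: g'[OF that] X_def F)
  have "Ck_on k W (\<lambda>z. \<psi> z $ j)" for k j
  proof (induction k arbitrary: j)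
    case 0
    show ?case using dj by (auto intro!: continuous_at_imp_continuous_on has_derivative_continuous)
  next
    case (Suc k)
    have "Ck_on k W (\<lambda>z. X r (\<psi> z) $ j)" for r
      using Ck_on_compose[OF V(1,4) _ smooth_onD[OF smX[of r j]] Suc.IH] \<psi>V by simp
    then show ?case
      by (intro Ck_on_SucI[OF V(4) _ pd]) (use dj differentiableI in blast)+
  qed
  then have "point_transformation V W \<phi> \<psi>"
    unfolding point_transformation_def using V smooth_on_subset[OF \<phi> V(2)] by (simp add: smooth_on_def)
  then show ?thesis using that V(2,3) by blast
qed

text \<open>The leading coefficients coincide by choice, so only the quadratic ones are compared. As
  \<open>W\<close> is the image of \<open>V\<close>, the condition at \<open>z\<close> in
  \<open>W\<close> is read at the point \<open>y\<close> with \<open>\<phi> y = z\<close>.\<close>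

lemma transformed_is_diffusion_iff_hessian:
  fixes \<phi> \<psi> :: "real^'n \<Rightarrow> real^'n::finite" and A :: "real^'n \<Rightarrow> real^'n^'n"
  assumes pt: "point_transformation V W \<phi> \<psi>" and A: "\<And>i j. smooth_on V (\<lambda>y. A y $ i $ j)"
    and nondeg: "\<And>y. y \<in> V \<Longrightarrow> det_Lambda_sym (A y) \<noteq> 0"
    and \<Gamma>: "\<And>y j r s. y \<in> V \<Longrightarrow> \<Gamma> y j r s = \<Gamma> y j s r"
  shows "same_system_on W (transformed_lead \<phi> \<psi> A) (transformed_quad \<phi> \<psi> A (source_quad A \<Gamma>))
      (transformed_lead \<phi> \<psi> A) (diffusion_quad (transformed_lead \<phi> \<psi> A)) \<longleftrightarrow>
    (\<forall>y\<in>V. \<forall>i a b. partial_deriv b (partial_deriv a (\<lambda>y. \<phi> y $ i)) y =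
      (\<Sum>m\<in>UNIV. partial_deriv m (\<lambda>y. \<phi> y $ i) y * theta A \<Gamma> y m a b))"
proof -
  have W: "W = \<phi> ` V" using pt by (auto simp: point_transformation_def homeomorphism_def)
  show ?thesis
    unfolding same_system_on_def W ball_simps
    using same_quad_iff_hessian[where \<Gamma> = \<Gamma> and A = A, OF pt A nondeg \<Gamma>] by simp
qed

theorem theorem6p1:
  fixes U :: "(real^'n::finite) set"
    and A :: "real^'n \<Rightarrow> real^'n^'n"
    and \<Gamma> :: "real^'n \<Rightarrow> 'n \<Rightarrow> 'n \<Rightarrow> 'n \<Rightarrow> real"
    and y0 :: "real^'n"
  assumes "open U" and "y0 \<in> U"
    and "\<And>i j. smooth_on U (\<lambda>y. A y $ i $ j)"
    and "\<And>j r s. smooth_on U (\<lambda>y. \<Gamma> y j r s)"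
    and "\<And>y j r s. y \<in> U \<Longrightarrow> \<Gamma> y j r s = \<Gamma> y j s r"
    and "\<And>y. y \<in> U \<Longrightarrow> det (A y) \<noteq> 0"
    and "\<And>y. y \<in> U \<Longrightarrow> det_Lambda_sym (A y) \<noteq> 0"
  shows "diffusion_form_near U A \<Gamma> y0 \<longleftrightarrow>
    (\<exists>V. open V \<and> y0 \<in> V \<and> V \<subseteq> U \<and> (\<forall>y\<in>V. zero_curvature_at (theta A \<Gamma>) y))"
proof
  have \<theta>: "smooth_on V (\<lambda>y. theta A \<Gamma> y m a b)" if "V \<subseteq> U" for V m a b
    by (rule smooth_on_subset[OF smooth_on_theta that]) (use assms in auto)
  have \<theta>_sym: "theta A \<Gamma> y m a b = theta A \<Gamma> y m b a" if "y \<in> U" for y m a b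
    by (rule theta_commute[where A = A and y = y, OF assms(7)[OF that]])
  have iff: "same_system_on W (transformed_lead \<phi> \<psi> A) (transformed_quad \<phi> \<psi> A (source_quad A \<Gamma>))
      (transformed_lead \<phi> \<psi> A) (diffusion_quad (transformed_lead \<phi> \<psi> A)) \<longleftrightarrow>
    (\<forall>y\<in>V. \<forall>i a b. partial_deriv b (partial_deriv a (\<lambda>y. \<phi> y $ i)) y =
      (\<Sum>m\<in>UNIV. partial_deriv m (\<lambda>y. \<phi> y $ i) y * theta A \<Gamma> y m a b))"
    if "point_transformation V W \<phi> \<psi>" "V \<subseteq> U" for V W \<phi> \<psi>
    using that(2) assms(5,7)
    by (intro transformed_is_diffusion_iff_hessian[OF that(1)] smooth_on_subset[OF assms(3) that(2)]) blast+
  {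
    assume "diffusion_form_near U A \<Gamma> y0"
    then obtain V W \<phi> \<psi> A' where V: "y0 \<in> V" "V \<subseteq> U" and pt: "point_transformation V W \<phi> \<psi>"
      and same: "same_system_on W (transformed_lead \<phi> \<psi> A) (transformed_quad \<phi> \<psi> A (source_quad A \<Gamma>))
        A' (diffusion_quad A')"
      unfolding diffusion_form_near_def by blast
    have oV: "open V" and oW: "open W" and W: "W = \<phi> ` V" and sm: "\<And>i. smooth_on V (\<lambda>y. \<phi> y $ i)"
      using pt by (auto simp: point_transformation_def homeomorphism_def)
    \<comment> \<open>\<open>A'\<close> agrees with the transformed leading matrix on all of the
      open set \<open>W\<close>, so the derivatives agree too and \<open>A'\<close> can be replaced
      by that matrix.\<close>
    have "diffusion_quad A' z i r s = diffusion_quad (transformed_lead \<phi> \<psi> A) z i r s" if "z \<in> W" for z i r s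
      unfolding diffusion_quad_def using same
      by (intro partial_deriv_cong[OF oW that]) (simp add: same_system_on_def)
    with same have "same_system_on W (transformed_lead \<phi> \<psi> A) (transformed_quad \<phi> \<psi> A (source_quad A \<Gamma>))
        (transformed_lead \<phi> \<psi> A) (diffusion_quad (transformed_lead \<phi> \<psi> A))"
      by (simp add: same_system_on_def)
    then have hess: "partial_deriv b (partial_deriv a (\<lambda>y. \<phi> y $ i)) y =
        (\<Sum>m\<in>UNIV. partial_deriv m (\<lambda>y. \<phi> y $ i) y * theta A \<Gamma> y m a b)" if "y \<in> V" for y i a b
      using iff[OF pt V(2)] V(2) that by blast
    have "zero_curvature_at (theta A \<Gamma>) y" if y: "y \<in> V" for y
    proof (rule zero_curvature_of_hessian[OF oV \<theta>[OF V(2)] _ sm hess y])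
      show "theta A \<Gamma> y m a b = theta A \<Gamma> y m b a" if "y \<in> V" for y m a b
        using that V(2) by (blast intro: \<theta>_sym)
      have z: "\<phi> y \<in> W" "\<psi> (\<phi> y) = y" using pt y by (auto simp: point_transformation_def homeomorphism_def)
      show "invertible (\<chi> i a. partial_deriv a (\<lambda>y. \<phi> y $ i) y)"
        using jacobian_inverse[OF pt z(1)] unfolding z(2) invertible_right_inverse by blast
    qed
    then show "\<exists>V. open V \<and> y0 \<in> V \<and> V \<subseteq> U \<and> (\<forall>y\<in>V. zero_curvature_at (theta A \<Gamma>) y)"
      using oV V by blast
  next
    assume "\<exists>V. open V \<and> y0 \<in> V \<and> V \<subseteq> U \<and> (\<forall>y\<in>V. zero_curvature_at (theta A \<Gamma>) y)"
    then obtain S where S: "open S" "y0 \<in> S" "S \<subseteq> U" and flat: "\<And>y. y \<in> S \<Longrightarrow> zero_curvature_at (theta A \<Gamma>) y"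
      by blast
    have S_sym: "theta A \<Gamma> y m a b = theta A \<Gamma> y m b a" if "y \<in> S" for y m a b
      using that S(3) by (blast intro: \<theta>_sym)
    obtain r \<phi> where r: "r > 0" "ball y0 r \<subseteq> S" and \<phi>: "\<And>i. smooth_on (ball y0 r) (\<lambda>y. \<phi> y $ i)"
      and hess: "\<And>y i a b. y \<in> ball y0 r \<Longrightarrow> partial_deriv b (partial_deriv a (\<lambda>y. \<phi> y $ i)) y =
        (\<Sum>m\<in>UNIV. partial_deriv m (\<lambda>y. \<phi> y $ i) y * theta A \<Gamma> y m a b)"
      and J: "(\<chi> i a. partial_deriv a (\<lambda>y. \<phi> y $ i) y0) = (mat 1 :: real^'n^'n)"
      by (rule pfaffian_solution[OF S(1,2) \<theta>[OF S(3)] S_sym flat]) (assumption | rule that)+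
    have "invertible (mat 1 :: real^'n^'n)" by (auto simp: invertible_def)
    then obtain V W \<psi> where V: "y0 \<in> V" "V \<subseteq> ball y0 r" and pt: "point_transformation V W \<phi> \<psi>"
      using smooth_inverse_function[OF open_ball _ \<phi>] J r(1) by (metis centre_in_ball)
    have VU: "V \<subseteq> U" using V r S by blast
    note smA = smooth_on_subset[OF assms(3) VU]
    have "det (transformed_lead \<phi> \<psi> A z) \<noteq> 0" if "z \<in> W" for z
      using det_transformed_lead[OF pt that] assms(6) pt that VU
      by (auto simp: point_transformation_def homeomorphism_def)
    moreover have "same_system_on W (transformed_lead \<phi> \<psi> A) (transformed_quad \<phi> \<psi> A (source_quad A \<Gamma>))
        (transformed_lead \<phi> \<psi> A) (diffusion_quad (transformed_lead \<phi> \<psi> A))"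
      using iff[OF pt VU] VU hess V(2) by blast
    ultimately show "diffusion_form_near U A \<Gamma> y0"
      unfolding diffusion_form_near_def using V(1) VU pt smooth_on_transformed_lead[OF pt smA] by blast
  }
qed

end
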